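(* Let $\mu\ge 0$, let $n\ge 0$ be an integer and $\xi_\nu=\frac{\nu\pi}{n+1}$ for $0\le\nu\le 2n+1$. Then for every $f\in L^2(W_\mu;B^2)$ and $(x,y)\in B^2$, the partial sum $S_n^\mu(f;x,y)=\sum_{k=0}^n\operatorname{proj}_k^\mu f(x,y)$ satisfies $$S_n^\mu(f;x,y)=\frac{1}{n+1}\sum_{\nu=0}^{n}a_\mu\int_{-1}^1\mathcal R_{\xi_\nu}^\mu(f;t)\,\Phi_n^\mu(\xi_\nu,t;x,y)\,dt=\frac{1}{2n+2}\sum_{\nu=0}^{2n+1}a_\mu\int_{-1}^1\mathcal R_{\xi_\nu}^\mu(f;t)\,\Phi_n^\mu(\xi_\nu,t;x,y)\,dt,$$ where $$\Phi_n^\mu(\xi,t;x,y)=\sum_{k=0}^n\frac{k+\mu+1/2}{\mu+1/2}\,C_k^{\mu+1/2}(t)\,D_k^{\mu+1/2}(\xi;x,y).$$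
   Context: $B^2$ is the closed unit disk in $\mathbb R^2$; $W_\mu(x,y)=(1-x^2-y^2)^{\mu-1/2}$ on $B^2$; $a_\mu=(\mu+1/2)/\pi=1/\int_{B^2}W_\mu$; $\langle P,Q\rangle_\mu=a_\mu\int_{B^2}PQW_\mu\,dx\,dy$. $\mathcal V_k^2(W_\mu)$ is the space of polynomials in two variables of degree $k$ (together with $0$) that are orthogonal under $\langle\cdot,\cdot\rangle_\mu$ to all polynomials of total degree $<k$, and $\operatorname{proj}_k^\mu$ is the orthogonal projection of $L^2(W_\mu;B^2)$ onto $\mathcal V_k^2(W_\mu)$ (identified with its polynomial representative). Attenuated Radon projection: $$\mathcal R_\theta^\mu(f;t)=\int_{-\sqrt{1-t^2}}^{\sqrt{1-t^2}}f(t\cos\theta-s\sin\theta,\,t\sin\theta+s\cos\theta)\,(1-s^2-t^2)^{\mu-1/2}\,ds,\qquad -1\le t\le 1$$ (defined for a.e. $t$ for $f\in L^2(W_\mu;B^2)$). $(a)_k=a(a+1)\cdots(a+k-1)$. $C_k^\lambda$ is the Gegenbauer polynomial of degree $k$, orthogonal for $(1-s^2)^{\lambda-1/2}$ on $[-1,1]$, with $C_k^\lambda(1)=(2\lambda)_k/k!$. $p_l^{(\alpha,\beta)}$ is the Jacobi polynomial of degree $l$ with positive leading coefficient, orthonormal for the weight $(1-t)^\alpha(1+t)^\beta$ normalized to have integral $1$ on $[-1,1]$. Orthonormal basis of $\mathcal V_k^2(W_\mu)$: in polar coordinates $x=r\cos\phi$, $y=r\sin\phi$, $$P_{l,\varepsilon}^k(x,y)=h_{l,k}\,p_l^{(\mu-1/2,\,k-2l)}(2r^2-1)\,r^{k-2l}S_{k-2l,\varepsilon}(\phi),$$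 where $S_{j,0}(\phi)=\cos j\phi$, $S_{j,1}(\phi)=\sin j\phi$, $0\le 2l\le k$ if $\varepsilon=0$, $0\le 2l\le k-1$ if $\varepsilon=1$, and $$h_{l,k}^2=\frac1{d_{l,k}}\,\frac{\Gamma(k-2l+\mu+3/2)}{\Gamma(\mu+3/2)\Gamma(k-2l+1)},\quad h_{l,k}>0,\qquad d_{l,k}=\tfrac12\ (2l<k),\quad d_{l,k}=1\ (2l=k).$$ $$\lambda_{l,k}^\mu=\frac{l!\,(k-l)!\,(k-l+\mu+\frac12)}{(\mu+\frac12)_l\,(\mu+\frac32)_{k-l}\,(k+\mu+\frac12)},\qquad D_k^{\mu+1/2}(\xi;x,y)=\sum_{l,\varepsilon}\lambda_{l,k}^\mu\,P_{l,\varepsilon}^k(\cos\xi,\sin\xi)\,P_{l,\varepsilon}^k(x,y)$$ (sum over all admissible pairs $(l,\varepsilon)$). *)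

theory Defs
  imports "HOL-Analysis.Analysis"
begin

text \<open>
  All integrals are Lebesgue integrals with respect to the completed measure \<open>lebesgue\<close>, since
  a representative of a class in \<open>L\<^sup>2\<close> need not be Borel measurable. Powers \<open>b powr a\<close> with
  \<open>b = 0\<close> have the value \<open>0\<close>; in the weights below this only concerns null sets.
\<close>

definition disk :: "(real \<times> real) set" where
  "disk = cball 0 1"

definition disk_weight :: "real \<Rightarrow> real \<times> real \<Rightarrow> real" where
  "disk_weight \<mu> = (\<lambda>(x, y). (1 - x\<^sup>2 - y\<^sup>2) powr (\<mu> - 1/2))"

definition norm_const :: "real \<Rightarrow> real" where
  "norm_const \<mu> = (\<mu> + 1/2) / pi"

definition disk_inner ::
    "real \<Rightarrow> (real \<times> real \<Rightarrow> real) \<Rightarrow> (real \<times> real \<Rightarrow> real) \<Rightarrow> real" where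
  "disk_inner \<mu> P Q = norm_const \<mu> * (LINT z:disk|lebesgue. P z * Q z * disk_weight \<mu> z)"

text \<open>Functions rather than classes; the values outside the disk are unconstrained.\<close>

definition L2_disk :: "real \<Rightarrow> (real \<times> real \<Rightarrow> real) set" where
  "L2_disk \<mu> = {f. set_borel_measurable lebesgue disk f \<and>
                   set_integrable lebesgue disk (\<lambda>z. (f z)\<^sup>2 * disk_weight \<mu> z)}"

text \<open>Polynomial functions in two variables of total degree at most \<open>d\<close>.\<close>

definition poly2 :: "nat \<Rightarrow> (real \<times> real \<Rightarrow> real) set" where
  "poly2 d = {P. \<exists>c :: nat \<Rightarrow> nat \<Rightarrow> real.
                   P = (\<lambda>(x, y). \<Sum>i\<le>d. \<Sum>j\<le>d - i. c i j * x ^ i * y ^ j)}"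

definition orth_space :: "real \<Rightarrow> nat \<Rightarrow> (real \<times> real \<Rightarrow> real) set" where
  "orth_space \<mu> k =
     {P. (P = (\<lambda>_. 0) \<or> P \<in> poly2 k \<and> (\<forall>d<k. P \<notin> poly2 d)) \<and>
         (\<forall>d<k. \<forall>Q\<in>poly2 d. disk_inner \<mu> P Q = 0)}"

text \<open>
  The unique polynomial \<open>P\<close> in the \<open>k\<close>-th space such that \<open>f - P\<close> is orthogonal to that space.
\<close>

definition disk_proj :: "real \<Rightarrow> nat \<Rightarrow> (real \<times> real \<Rightarrow> real) \<Rightarrow> real \<times> real \<Rightarrow> real" where
  "disk_proj \<mu> k f =
     (THE P. P \<in> orth_space \<mu> k \<and>
             (\<forall>Q\<in>orth_space \<mu> k. disk_inner \<mu> (\<lambda>z. f z - P z) Q = 0))"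

definition partial_sum :: "real \<Rightarrow> nat \<Rightarrow> (real \<times> real \<Rightarrow> real) \<Rightarrow> real \<times> real \<Rightarrow> real" where
  "partial_sum \<mu> n f z = (\<Sum>k=0..n. disk_proj \<mu> k f z)"

text \<open>Defined for almost every \<open>t\<close>; where the integral does not exist, the value is \<open>0\<close>.\<close>

definition radon :: "real \<Rightarrow> real \<Rightarrow> (real \<times> real \<Rightarrow> real) \<Rightarrow> real \<Rightarrow> real" where
  "radon \<mu> \<theta> f t =
     (LINT s:{- sqrt (1 - t\<^sup>2)..sqrt (1 - t\<^sup>2)}|lebesgue.
        f (t * cos \<theta> - s * sin \<theta>, t * sin \<theta> + s * cos \<theta>) * (1 - s\<^sup>2 - t\<^sup>2) powr (\<mu> - 1/2))"

definition gegenbauer :: "real \<Rightarrow> nat \<Rightarrow> real poly" where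
  "gegenbauer \<kappa> k =
     (THE p. degree p = k \<and>
             (\<forall>q. degree q < k \<longrightarrow>
                (LINT s:{-1..1}|lebesgue. poly p s * poly q s * (1 - s\<^sup>2) powr (\<kappa> - 1/2)) = 0) \<and>
             poly p 1 = pochhammer (2 * \<kappa>) k / fact k)"

definition jacobi_weight :: "real \<Rightarrow> real \<Rightarrow> real \<Rightarrow> real" where
  "jacobi_weight \<alpha> \<beta> t = (1 - t) powr \<alpha> * (1 + t) powr \<beta>"

definition jacobi_inner :: "real \<Rightarrow> real \<Rightarrow> real poly \<Rightarrow> real poly \<Rightarrow> real" where
  "jacobi_inner \<alpha> \<beta> p q =
     (LINT t:{-1..1}|lebesgue. poly p t * poly q t * jacobi_weight \<alpha> \<beta> t) /
     (LINT t:{-1..1}|lebesgue. jacobi_weight \<alpha> \<beta> t)"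

definition jacobi :: "real \<Rightarrow> real \<Rightarrow> nat \<Rightarrow> real poly" where
  "jacobi \<alpha> \<beta> l =
     (THE p. degree p = l \<and> lead_coeff p > 0 \<and> jacobi_inner \<alpha> \<beta> p p = 1 \<and>
             (\<forall>q. degree q < l \<longrightarrow> jacobi_inner \<alpha> \<beta> p q = 0))"

text \<open>
  The pairs \<open>(l, e)\<close> with \<open>0 \<le> 2l \<le> k\<close> if \<open>e = 0\<close> and \<open>0 \<le> 2l \<le> k - 1\<close> if \<open>e = 1\<close>, written
  without truncated subtraction.
\<close>

definition basis_index :: "nat \<Rightarrow> (nat \<times> nat) set" where
  "basis_index k = {(l, e). e \<in> {0, 1} \<and> 2 * l + e \<le> k}"

definition sph :: "nat \<Rightarrow> nat \<Rightarrow> real \<Rightarrow> real" where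
  "sph j e \<phi> = (if e = 0 then cos (real j * \<phi>) else sin (real j * \<phi>))"

definition d_coeff :: "nat \<Rightarrow> nat \<Rightarrow> real" where
  "d_coeff l k = (if 2 * l < k then 1/2 else 1)"

definition h_coeff :: "real \<Rightarrow> nat \<Rightarrow> nat \<Rightarrow> real" where
  "h_coeff \<mu> l k =
     sqrt (1 / d_coeff l k *
           (Gamma (real (k - 2 * l) + \<mu> + 3/2) /
            (Gamma (\<mu> + 3/2) * Gamma (real (k - 2 * l) + 1))))"

text \<open>
  Polar coordinates are those of the complex number \<open>Complex x y\<close>. At the origin, where \<open>\<phi>\<close> is
  arbitrary, the factor \<open>r ^ (k - 2 * l) * sph (k - 2 * l) e \<phi>\<close> does not depend on it.
\<close>

definition basis_poly :: "real \<Rightarrow> nat \<Rightarrow> nat \<Rightarrow> nat \<Rightarrow> real \<times> real \<Rightarrow> real" where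
  "basis_poly \<mu> k l e = (\<lambda>(x, y).
     let r = sqrt (x\<^sup>2 + y\<^sup>2); \<phi> = Arg (Complex x y) in
       h_coeff \<mu> l k * poly (jacobi (\<mu> - 1/2) (real (k - 2 * l)) l) (2 * r\<^sup>2 - 1) *
       r ^ (k - 2 * l) * sph (k - 2 * l) e \<phi>)"

definition lambda_coeff :: "real \<Rightarrow> nat \<Rightarrow> nat \<Rightarrow> real" where
  "lambda_coeff \<mu> l k =
     (fact l * fact (k - l) * (real (k - l) + \<mu> + 1/2)) /
     (pochhammer (\<mu> + 1/2) l * pochhammer (\<mu> + 3/2) (k - l) * (real k + \<mu> + 1/2))"

text \<open>
  The parameter is \<open>\<mu>\<close>, not \<open>\<mu> + 1/2\<close>: \<open>D_kernel \<mu> k\<close> is \<open>D\<close> with subscript \<open>k\<close> and superscript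
  \<open>\<mu> + 1/2\<close>.
\<close>

definition D_kernel :: "real \<Rightarrow> nat \<Rightarrow> real \<Rightarrow> real \<times> real \<Rightarrow> real" where
  "D_kernel \<mu> k \<xi> z =
     (\<Sum>(l, e)\<in>basis_index k.
        lambda_coeff \<mu> l k * basis_poly \<mu> k l e (cos \<xi>, sin \<xi>) * basis_poly \<mu> k l e z)"

definition Phi_kernel :: "real \<Rightarrow> nat \<Rightarrow> real \<Rightarrow> real \<Rightarrow> real \<times> real \<Rightarrow> real" where
  "Phi_kernel \<mu> n \<xi> t z =
     (\<Sum>k=0..n. (real k + \<mu> + 1/2) / (\<mu> + 1/2) *
        poly (gegenbauer (\<mu> + 1/2) k) t * D_kernel \<mu> k \<xi> z)"

definition view_angle :: "nat \<Rightarrow> nat \<Rightarrow> real" where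
  "view_angle n \<nu> = real \<nu> * pi / (real n + 1)"

end

(*
  Write xi for the point (cos xi, sin xi). By Fubini along the fibres of the projection onto xi,
  the integral of the Radon projection against a polynomial g is the weighted disk integral of f
  times the ridge function g(<., xi>). If P lies in the k-th orthogonal space, its Radon projection
  is (1 - t^2)^mu q(t) with deg q <= k, and q is orthogonal to all polynomials of lower degree, so
  q is a multiple of C_k; its value at t = 1 identifies the factor as a constant times P(xi). Hence
  (k + mu + 1/2) / (mu + 1/2) C_k(<w, xi>) is the sum of P_i(xi) P_i(w) over the basis. On the
  circle P_i is a multiple of cos or sin of j xi with j = k - 2l, and for k <= n these functions
  are orthogonal on the points xi_nu, with squared norms that lambda_{l,k} inverts, so summing over
  nu reproduces the orthogonal projection.

  No polar coordinates are needed: orthogonality of different angular frequencies follows from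
  rotation invariance, and radial integrals follow from the total masses of the weights with
  parameters mu + i, since (1 - r^2)^i W_mu = W_{mu + i}. The only explicit evaluation is the norm
  of the Jacobi polynomials, by the Chu-Vandermonde identity.
*)

theory Submission
  imports Defs
begin

section \<open>Jacobi and Gegenbauer polynomials\<close>

text \<open>Both formulas are one statement: the sum over c (n + 1) consecutive views, divided by c
  (n + 1), for c = 1 and c = 2. Half a turn suffices because only frequencies k - 2l with a common k
  are ever multiplied: the kernel pairs C_k with D_k, and the ridge polynomial of degree k expands
  in basis elements of degree k alone. Such frequencies have equal parity, so their sums and
  differences are even numbers 2m with |m| <= n, and exp(2 i m xi_nu) runs through the powers of an
  (n+1)-th root of unity that is 1 only for m = 0.

  Jacobi polynomials are scaled to the value 1 at t = 1, because t = 2 r^2 - 1 is 1 on the circle.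
  The circle values then consist of h, an inverse norm and a cosine or sine, and
  \<open>lambda_coeff\<close> is the inverse of their mean square.

  The polynomials and projections of the definitions are definite descriptions; each is identified
  with an explicit object by existence and uniqueness. As f is only Lebesgue measurable, Fubini and
  rotation invariance are transferred from a Borel function equal to f almost everywhere.\<close>

definition jacobi_int :: "real \<Rightarrow> real \<Rightarrow> real poly \<Rightarrow> real" where
  "jacobi_int \<alpha> \<beta> p = (LINT t:{-1..1}|lebesgue. poly p t * jacobi_weight \<alpha> \<beta> t)"

text \<open>The substitution t = 2x - 1 carries the Beta integral over [0, 1] to [-1, 1]. As the
  weight is nonnegative, its gauge integrability gives Lebesgue integrability.\<close>

lemma jacobi_weight_integral:
  assumes "\<alpha> > -1" "\<beta> > -1"
  shows "set_integrable lebesgue {-1..1} (jacobi_weight \<alpha> \<beta>)"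
    and "(LINT t:{-1..1}|lebesgue. jacobi_weight \<alpha> \<beta> t) = 2 powr (\<alpha> + \<beta> + 1) * Beta (\<alpha> + 1) (\<beta> + 1)"
proof -
  have "((\<lambda>t. t powr \<beta> * (1 - t) powr \<alpha>) has_integral Beta (\<beta> + 1) (\<alpha> + 1)) (cbox 0 1)"
    using has_integral_Beta_real[of "\<beta> + 1" "\<alpha> + 1"] assms by simp
  moreover have "(\<lambda>x::real. x * 2 - 1) ` {0..1} = {-1..1}"
    using image_affinity_atLeastAtMost[of 2 "-1::real" 0 1] by (simp add: mult.commute)
  ultimately
  have "((\<lambda>t. ((1 + t) / 2) powr \<beta> * ((1 - t) / 2) powr \<alpha>) has_integral 2 * Beta (\<beta> + 1) (\<alpha> + 1)) {-1..1}"
    using has_integral_affinity[of "\<lambda>t. t powr \<beta> * (1 - t) powr \<alpha>" "Beta (\<beta> + 1) (\<alpha> + 1)" 0 1 "1/2" "1/2"]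
    by (simp add: field_simps)
  from has_integral_mult_right[OF this, of "2 powr (\<alpha> + \<beta>)"]
  have "((\<lambda>t. 2 powr (\<alpha> + \<beta>) * (((1 + t) / 2) powr \<beta> * ((1 - t) / 2) powr \<alpha>))
          has_integral 2 powr (\<alpha> + \<beta> + 1) * Beta (\<alpha> + 1) (\<beta> + 1)) {-1..1}"
    by (simp add: powr_add Beta_commute mult_ac)
  also have "?this \<longleftrightarrow> (jacobi_weight \<alpha> \<beta> has_integral 2 powr (\<alpha> + \<beta> + 1) * Beta (\<alpha> + 1) (\<beta> + 1)) {-1..1}"
    by (intro has_integral_cong) (simp add: jacobi_weight_def powr_divide powr_add field_simps)
  finally have I: "(jacobi_weight \<alpha> \<beta> has_integral 2 powr (\<alpha> + \<beta> + 1) * Beta (\<alpha> + 1) (\<beta> + 1)) {-1..1}" .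
  then show *: "set_integrable lebesgue {-1..1} (jacobi_weight \<alpha> \<beta>)"
    by (intro nonnegative_absolutely_integrable_1) (auto simp: jacobi_weight_def)
  show "(LINT t:{-1..1}|lebesgue. jacobi_weight \<alpha> \<beta> t) = 2 powr (\<alpha> + \<beta> + 1) * Beta (\<alpha> + 1) (\<beta> + 1)"
    using set_lebesgue_integral_eq_integral(2)[OF *] I by (simp add: integral_unique)
qed

lemma jacobi_int_integrable:
  assumes "\<alpha> > -1" "\<beta> > -1"
  shows "set_integrable lebesgue {-1..1} (\<lambda>t. poly p t * jacobi_weight \<alpha> \<beta> t)"
proof (rule absolutely_integrable_bounded_measurable_product_real)
  show "bounded (poly p ` {-1..1})"
    by (intro compact_imp_bounded compact_continuous_image continuous_intros) auto
  show "poly p \<in> borel_measurable (lebesgue_on {-1..1})"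
    by (intro continuous_imp_measurable_on_sets_lebesgue continuous_intros) auto
qed (use assms jacobi_weight_integral in auto)

context
  fixes \<alpha> \<beta> :: real
  assumes ab: "\<alpha> > -1" "\<beta> > -1"
begin

lemma jacobi_int_add: "jacobi_int \<alpha> \<beta> (p + q) = jacobi_int \<alpha> \<beta> p + jacobi_int \<alpha> \<beta> q"
  unfolding jacobi_int_def by (simp add: distrib_right jacobi_int_integrable[OF ab] set_integral_add)

lemma jacobi_int_smult: "jacobi_int \<alpha> \<beta> (smult c p) = c * jacobi_int \<alpha> \<beta> p"
  unfolding jacobi_int_def by (simp add: mult.assoc)

lemma jacobi_int_0: "jacobi_int \<alpha> \<beta> 0 = 0"
  unfolding jacobi_int_def by simp

lemma jacobi_int_diff: "jacobi_int \<alpha> \<beta> (p - q) = jacobi_int \<alpha> \<beta> p - jacobi_int \<alpha> \<beta> q"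
  using jacobi_int_add[of p "smult (-1) q"] jacobi_int_smult[of "-1" q] by simp

lemma jacobi_int_sum: "jacobi_int \<alpha> \<beta> (\<Sum>i\<in>A. g i) = (\<Sum>i\<in>A. jacobi_int \<alpha> \<beta> (g i))"
  by (induction A rule: infinite_finite_induct) (auto simp: jacobi_int_0 jacobi_int_add)

text \<open>Factors 1 - t and 1 + t only shift the parameters of the weight, at the endpoints too,
  where both sides use \<open>0 powr a = 0\<close>.\<close>

lemma jacobi_int_moment:
  "jacobi_int \<alpha> \<beta> ([:1, -1:] ^ i * [:1, 1:] ^ m) =
     2 powr (\<alpha> + \<beta> + i + m + 1) * Beta (\<alpha> + i + 1) (\<beta> + m + 1)"
proof -
  have "x ^ k * x powr a = x powr (a + k)" if "x \<ge> 0" for x a :: real and k :: nat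
    using that by (cases "x = 0") (auto simp: powr_add powr_realpow)
  then have "jacobi_int \<alpha> \<beta> ([:1, -1:] ^ i * [:1, 1:] ^ m) =
      (LINT t:{-1..1}|lebesgue. jacobi_weight (\<alpha> + i) (\<beta> + m) t)"
    unfolding jacobi_int_def jacobi_weight_def
    by (intro set_lebesgue_integral_cong) (auto simp: poly_power mult_ac)
  also have "\<dots> = 2 powr (\<alpha> + \<beta> + i + m + 1) * Beta (\<alpha> + i + 1) (\<beta> + m + 1)"
    using ab by (subst jacobi_weight_integral) (auto simp: add_ac)
  finally show ?thesis .
qed

lemma jacobi_int_1: "jacobi_int \<alpha> \<beta> 1 = 2 powr (\<alpha> + \<beta> + 1) * Beta (\<alpha> + 1) (\<beta> + 1)"
  using jacobi_int_moment[of 0 0] by simp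

lemma jacobi_int_1_pos: "jacobi_int \<alpha> \<beta> 1 > 0"
  using ab by (auto simp: jacobi_int_1 Beta_def)

end

section \<open>Beta function values and the Chu-Vandermonde sum\<close>

lemma Beta_plus_nat_left:
  fixes a b :: real
  assumes "a > 0" "b > 0"
  shows "Beta (a + real n) b = pochhammer a n / pochhammer (a + b) n * Beta a b"
proof -
  have *: "Gamma (x + real n) = pochhammer x n * Gamma x \<and> Gamma x \<noteq> 0 \<and> pochhammer x n \<noteq> 0" if "x > 0" for x :: real
  proof -
    have "x \<notin> \<int>\<^sub>\<le>\<^sub>0" using that by (auto simp: nonpos_Ints_def)
    then show ?thesis
      using pochhammer_Gamma[of x n] Gamma_real_pos[OF that] pochhammer_pos[OF that, of n] by auto
  qed
  have "a + real n + b = a + b + real n" by simp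
  then show ?thesis
    using *[of a] *[of "a + b"] assms unfolding Beta_def by (simp only: mult_ac add_pos_pos) (simp add: mult_ac)
qed

lemma Beta_1_right:
  fixes x :: real
  assumes "x > 0"
  shows "Beta x 1 = 1 / x"
proof -
  have "Gamma (x + 1) = x * Gamma x"
    using assms by (intro Gamma_plus1) (auto simp: nonpos_Ints_def)
  moreover have "Gamma x \<noteq> 0"
    using Gamma_real_pos[OF assms] by linarith
  ultimately show ?thesis by (simp add: Beta_def)
qed

text \<open>The left side is the terminating series F(-l, b; c; 1). Up to the common factor l! /
  (c)_l its terms are products of the generalised binomials of -b over i and c + l - 1 over l - i,
  so Vandermonde convolution sums them.\<close>

lemma Chu_Vandermonde:
  fixes b c :: real
  assumes "c > 0"
  shows "(\<Sum>i\<le>l. pochhammer (- real l) i * pochhammer b i / (pochhammer c i * fact i)) =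
           pochhammer (c - b) l / pochhammer c l"
proof -
  have "pochhammer (- real l) i * pochhammer b i / (pochhammer c i * fact i) =
        fact l / pochhammer c l * ((- b gchoose i) * ((c + l - 1) gchoose (l - i)))"
    if "i \<le> l" for i
  proof -
    have c: "pochhammer c l = pochhammer c i * pochhammer (c + i) (l - i)"
      using that by (simp add: pochhammer_product)
    have p: "pochhammer c i > 0" "pochhammer (c + i) (l - i) > 0"
      using assms by (auto intro!: pochhammer_pos)
    have "pochhammer (- real l) i = (- 1) ^ i * fact l / fact (l - i)"
    proof -
      have "real l gchoose i = fact l / (fact i * fact (l - i))"
        using that by (metis binomial_fact binomial_gbinomial)
      then show ?thesis
        using pochhammer_minus[of "real l" i] gbinomial_pochhammer[of "real l" i]
        by (cases "even i") (auto simp: field_simps)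
    qed
    moreover have "(c + l - 1) gchoose (l - i) = pochhammer (c + i) (l - i) / fact (l - i)"
      using that by (simp add: gbinomial_pochhammer' of_nat_diff algebra_simps)
    ultimately show ?thesis
      using p by (simp add: c gbinomial_pochhammer field_simps)
  qed
  then have "(\<Sum>i\<le>l. pochhammer (- real l) i * pochhammer b i / (pochhammer c i * fact i)) =
        fact l / pochhammer c l * (\<Sum>i\<le>l. (- b gchoose i) * ((c + l - 1) gchoose (l - i)))"
    by (simp add: sum_distrib_left)
  also have "(\<Sum>i\<le>l. (- b gchoose i) * ((c + l - 1) gchoose (l - i))) = (- b + (c + l - 1)) gchoose l"
    using gbinomial_Vandermonde[of "- b" "c + l - 1" l] by (simp add: atLeast0AtMost)
  also have "\<dots> = pochhammer (c - b) l / fact l"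
    by (simp add: gbinomial_pochhammer' algebra_simps)
  finally show ?thesis by simp
qed

section \<open>Jacobi polynomials as terminating hypergeometric sums\<close>

definition jacobi_coef :: "real \<Rightarrow> real \<Rightarrow> nat \<Rightarrow> nat \<Rightarrow> real" where
  "jacobi_coef \<alpha> \<beta> l i = pochhammer (- real l) i * pochhammer (l + \<alpha> + \<beta> + 1) i / (pochhammer (\<alpha> + 1) i * fact i)"

text \<open>
  The Jacobi polynomial scaled to the value \<open>1\<close> at \<open>t = 1\<close>, that is
  \<open>F(-l, l + \<alpha> + \<beta> + 1; \<alpha> + 1; (1 - t) / 2)\<close> with the hypergeometric function \<open>F\<close>. The value of
  the orthonormal polynomial at \<open>1\<close> is then the inverse of the norm of this one.
\<close>

definition jacobi_unit :: "real \<Rightarrow> real \<Rightarrow> nat \<Rightarrow> real poly" where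
  "jacobi_unit \<alpha> \<beta> l = (\<Sum>i\<le>l. smult (jacobi_coef \<alpha> \<beta> l i / 2 ^ i) ([:1, -1:] ^ i))"

text \<open>The squared norm of \<open>jacobi_unit\<close> for the weight normalised to mass 1. Up
  to powers of 2 that cancel, (l + \<alpha> + \<beta> + 1)_l / (\<alpha> + 1)_l is the leading
  coefficient, (\<beta> + 1)_l / (\<alpha> + \<beta> + 2)_l the quotient of the Beta values for
  \<beta> + l and \<beta>, and l! / (\<alpha> + \<beta> + l + 2)_l comes from
  Chu-Vandermonde.\<close>

definition jacobi_unit_norm :: "real \<Rightarrow> real \<Rightarrow> nat \<Rightarrow> real" where
  "jacobi_unit_norm \<alpha> \<beta> l = pochhammer (l + \<alpha> + \<beta> + 1) l * pochhammer (\<beta> + 1) l * fact l /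
     (pochhammer (\<alpha> + 1) l * pochhammer (\<alpha> + \<beta> + 2) l * pochhammer (\<alpha> + \<beta> + l + 2) l)"

lemma degree_jacobi_unit_le: "degree (jacobi_unit \<alpha> \<beta> l) \<le> l"
  unfolding jacobi_unit_def
proof (rule degree_sum_le)
  fix i assume "i \<in> {..l}"
  have "degree ([:1, -1:] ^ i :: real poly) \<le> i"
    using degree_power_le[of "[:1, -1:] :: real poly" i] by simp
  then show "degree (smult (jacobi_coef \<alpha> \<beta> l i / 2 ^ i) ([:1, -1:] ^ i)) \<le> l"
    using \<open>i \<in> {..l}\<close> degree_smult_le[of "jacobi_coef \<alpha> \<beta> l i / 2 ^ i" "[:1, -1:] ^ i"] by auto
qed simp

lemma poly_jacobi_unit_1: "poly (jacobi_unit \<alpha> \<beta> l) 1 = 1"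
proof -
  have "poly (jacobi_unit \<alpha> \<beta> l) 1 = (\<Sum>i\<le>l. if i = 0 then 1 else 0)"
    unfolding jacobi_unit_def poly_sum by (intro sum.cong) (auto simp: poly_power jacobi_coef_def)
  then show ?thesis by simp
qed

lemma coeff_neg_linear_power: "coeff ([:1, -1:] ^ i :: real poly) i = (- 1) ^ i"
proof -
  have "degree ([:1, -1:] ^ i :: real poly) = i"
    by (simp add: degree_power_eq)
  then show ?thesis
    using lead_coeff_power[of "[:1, -1:] :: real poly" i] by simp
qed

context
  fixes \<alpha> \<beta> :: real
  assumes ab: "\<alpha> > -1" "\<beta> > -1"
begin

text \<open>For l = 0 the base \<alpha> + \<beta> + 1 may be negative, but the product is empty; for
  l >= 1 the base is positive because \<alpha> + \<beta> > -2.\<close>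

lemma pochhammer_jacobi_pos: "pochhammer (l + \<alpha> + \<beta> + 1) l > 0"
proof (cases "l = 0")
  case False
  then have "real l \<ge> 1" by simp
  then show ?thesis using ab by (intro pochhammer_pos) simp
qed simp

lemma coeff_jacobi_unit: "coeff (jacobi_unit \<alpha> \<beta> l) l = pochhammer (l + \<alpha> + \<beta> + 1) l / (pochhammer (\<alpha> + 1) l * 2 ^ l)"
proof -
  have "coeff (jacobi_unit \<alpha> \<beta> l) l = (\<Sum>i\<le>l. jacobi_coef \<alpha> \<beta> l i / 2 ^ i * coeff ([:1, -1:] ^ i) l)"
    by (simp add: jacobi_unit_def coeff_sum)
  also have "\<dots> = (\<Sum>i\<le>l. if i = l then jacobi_coef \<alpha> \<beta> l l / 2 ^ l * (- 1) ^ l else 0)"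
  proof (intro sum.cong refl)
    fix i assume "i \<in> {..l}"
    have "coeff ([:1, -1:] ^ i :: real poly) l = 0" if "i < l"
      using that by (intro coeff_eq_0) (simp add: degree_power_eq)
    then show "jacobi_coef \<alpha> \<beta> l i / 2 ^ i * coeff ([:1, -1:] ^ i) l =
        (if i = l then jacobi_coef \<alpha> \<beta> l l / 2 ^ l * (- 1) ^ l else 0)"
      using \<open>i \<in> {..l}\<close> by (auto simp: coeff_neg_linear_power)
  qed
  also have "\<dots> = jacobi_coef \<alpha> \<beta> l l / 2 ^ l * (- 1) ^ l" by simp
  also have "pochhammer (- real l) l = (- 1) ^ l * fact l"
    by (simp add: pochhammer_same)
  then have "jacobi_coef \<alpha> \<beta> l l / 2 ^ l * (- 1) ^ l = pochhammer (l + \<alpha> + \<beta> + 1) l / (pochhammer (\<alpha> + 1) l * 2 ^ l)"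
    by (simp add: jacobi_coef_def field_simps flip: power_mult_distrib)
  finally show ?thesis .
qed

lemma coeff_jacobi_unit_pos: "coeff (jacobi_unit \<alpha> \<beta> l) l > 0"
  using ab pochhammer_jacobi_pos by (simp add: coeff_jacobi_unit pochhammer_pos)

lemma degree_jacobi_unit: "degree (jacobi_unit \<alpha> \<beta> l) = l"
  using coeff_jacobi_unit_pos[of l] by (intro antisym degree_jacobi_unit_le le_degree) simp

text \<open>Expanding in powers of 1 - t but testing with powers of 1 + t makes every term a Beta
  value, and the sum is F(-l, l + \<alpha> + \<beta> + 1; \<alpha> + \<beta> + m + 2; 1). The
  resulting (m + 1 - l)_l contains the factor 0 exactly when m < l.\<close>

lemma jacobi_int_jacobi_unit_moment:
  "jacobi_int \<alpha> \<beta> (jacobi_unit \<alpha> \<beta> l * [:1, 1:] ^ m) = 2 powr (\<alpha> + \<beta> + m + 1) * Beta (\<alpha> + 1) (\<beta> + m + 1) *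
     (pochhammer (real m + 1 - real l) l / pochhammer (\<alpha> + \<beta> + m + 2) l)"
proof -
  have "jacobi_int \<alpha> \<beta> (jacobi_unit \<alpha> \<beta> l * [:1, 1:] ^ m) =
      (\<Sum>i\<le>l. jacobi_coef \<alpha> \<beta> l i / 2 ^ i * (2 powr (\<alpha> + \<beta> + i + m + 1) * Beta (\<alpha> + i + 1) (\<beta> + m + 1)))"
    by (simp add: jacobi_unit_def sum_distrib_right jacobi_int_sum[OF ab] jacobi_int_smult[OF ab] jacobi_int_moment[OF ab])
  also have "\<dots> = (\<Sum>i\<le>l. 2 powr (\<alpha> + \<beta> + m + 1) * Beta (\<alpha> + 1) (\<beta> + m + 1) *
       (pochhammer (- real l) i * pochhammer (l + \<alpha> + \<beta> + 1) i / (pochhammer (\<alpha> + \<beta> + m + 2) i * fact i)))"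
  proof (intro sum.cong refl)
    fix i assume "i \<in> {..l}"
    have "Beta (\<alpha> + i + 1) (\<beta> + m + 1) =
        pochhammer (\<alpha> + 1) i / pochhammer (\<alpha> + \<beta> + m + 2) i * Beta (\<alpha> + 1) (\<beta> + m + 1)"
      using Beta_plus_nat_left[of "\<alpha> + 1" "\<beta> + m + 1" i] ab by (simp add: add_ac)
    moreover have "2 powr (\<alpha> + \<beta> + i + m + 1) = 2 powr (\<alpha> + \<beta> + m + 1) * 2 ^ i"
      by (simp add: powr_add powr_realpow)
    moreover have "pochhammer (\<alpha> + 1) i > 0"
      using ab by (auto intro!: pochhammer_pos)
    ultimately show "jacobi_coef \<alpha> \<beta> l i / 2 ^ i * (2 powr (\<alpha> + \<beta> + i + m + 1) * Beta (\<alpha> + i + 1) (\<beta> + m + 1)) =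
        2 powr (\<alpha> + \<beta> + m + 1) * Beta (\<alpha> + 1) (\<beta> + m + 1) *
       (pochhammer (- real l) i * pochhammer (l + \<alpha> + \<beta> + 1) i / (pochhammer (\<alpha> + \<beta> + m + 2) i * fact i))"
      unfolding jacobi_coef_def by (simp add: mult_ac)
  qed
  also have "\<dots> = 2 powr (\<alpha> + \<beta> + m + 1) * Beta (\<alpha> + 1) (\<beta> + m + 1) *
     (pochhammer (\<alpha> + \<beta> + m + 2 - (l + \<alpha> + \<beta> + 1)) l / pochhammer (\<alpha> + \<beta> + m + 2) l)"
    using ab by (subst Chu_Vandermonde[symmetric]) (auto simp: sum_distrib_left)
  also have "\<alpha> + \<beta> + m + 2 - (l + \<alpha> + \<beta> + 1) = real m + 1 - real l" by simp
  finally show ?thesis .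
qed

text \<open>The moments against (1 + t)^m vanish for m < l, and any \<open>q\<close> is reduced to
  them by splitting off its leading term as a multiple of such a power.\<close>

lemma jacobi_unit_orthogonal:
  assumes "degree q < l"
  shows "jacobi_int \<alpha> \<beta> (jacobi_unit \<alpha> \<beta> l * q) = 0"
proof -
  have *: "jacobi_int \<alpha> \<beta> (jacobi_unit \<alpha> \<beta> l * [:1, 1:] ^ m) = 0" if "m < l" for m
  proof -
    have "pochhammer (real m + 1 - real l) l = 0"
    proof -
      have "real m + 1 - real l = - real (l - 1 - m)"
        using that by (simp add: of_nat_diff)
      then show ?thesis
        using that by (simp only: pochhammer_of_nat_eq_0_lemma)
    qed
    then show ?thesis by (simp add: jacobi_int_jacobi_unit_moment)
  qed
  have "degree q < l \<Longrightarrow> jacobi_int \<alpha> \<beta> (jacobi_unit \<alpha> \<beta> l * q) = 0"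
  proof (induction "degree q" arbitrary: q rule: less_induct)
    case less
    define r where "r = q - smult (lead_coeff q) ([:1, 1:] ^ degree q)"
    have deg: "degree (smult (lead_coeff q) ([:1, 1:] ^ degree q)) = degree q"
      by (cases "q = 0") (simp_all add: degree_power_eq)
    have "coeff ([:1, 1:] ^ degree q) (degree q) = (1::real)"
      using lead_coeff_power[of "[:1, 1:] :: real poly" "degree q"] by (simp add: degree_power_eq)
    then have c0: "coeff r (degree q) = 0"
      by (simp add: r_def)
    have "degree r \<le> degree q"
      unfolding r_def using deg by (metis degree_diff_le order_refl)
    have "jacobi_int \<alpha> \<beta> (jacobi_unit \<alpha> \<beta> l * r) = 0"
    \<comment> \<open>A constant \<open>q\<close> leaves r = 0, whose degree is not smaller than
      that of \<open>q\<close>, so the induction hypothesis does not reach this case.\<close>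
    proof (cases "r = 0")
      case True
      then show ?thesis by (simp add: jacobi_int_0[OF ab])
    next
      case False
      then have "degree r < degree q"
        using c0 \<open>degree r \<le> degree q\<close> by (metis leading_coeff_0_iff order_less_le)
      then show ?thesis using less by auto
    qed
    moreover have "q = r + smult (lead_coeff q) ([:1, 1:] ^ degree q)"
      by (simp add: r_def)
    then have "jacobi_int \<alpha> \<beta> (jacobi_unit \<alpha> \<beta> l * q) = jacobi_int \<alpha> \<beta> (jacobi_unit \<alpha> \<beta> l * r) +
       lead_coeff q * jacobi_int \<alpha> \<beta> (jacobi_unit \<alpha> \<beta> l * [:1, 1:] ^ degree q)"
      by (metis distrib_left jacobi_int_add[OF ab] jacobi_int_smult[OF ab] mult_smult_right)
    ultimately show ?case using * less by simp
  qed
  then show ?thesis using assms .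
qed

text \<open>Subtracting a multiple of (1 + t)^l lowers the degree of \<open>q\<close> below l, where
  orthogonality applies. The squared norm thereby reduces to a leading coefficient times one
  explicit moment.\<close>

lemma jacobi_int_mult_jacobi_unit:
  assumes "degree q \<le> l"
  shows "jacobi_int \<alpha> \<beta> (jacobi_unit \<alpha> \<beta> l * q) = coeff q l * jacobi_int \<alpha> \<beta> (jacobi_unit \<alpha> \<beta> l * [:1, 1:] ^ l)"
proof -
  define r where "r = q - smult (coeff q l) ([:1, 1:] ^ l)"
  have "coeff ([:1, 1:] ^ l) l = (1::real)"
    using lead_coeff_power[of "[:1, 1:] :: real poly" l] by (simp add: degree_power_eq)
  then have c0: "coeff r l = 0" by (simp add: r_def)
  have "degree (smult (coeff q l) ([:1, 1:] ^ l)) \<le> l"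
    using degree_smult_le[of "coeff q l" "[:1, 1:] ^ l"] by (simp add: degree_power_eq)
  then have "degree r \<le> l"
    unfolding r_def using assms by (intro degree_diff_le)
  have "jacobi_int \<alpha> \<beta> (jacobi_unit \<alpha> \<beta> l * r) = 0"
  proof (cases "r = 0")
    case True
    then show ?thesis by (simp add: jacobi_int_0[OF ab])
  next
    case False
    then have "degree r < l"
      using c0 \<open>degree r \<le> l\<close> by (metis leading_coeff_0_iff order_less_le)
    then show ?thesis by (rule jacobi_unit_orthogonal)
  qed
  moreover have "q = r + smult (coeff q l) ([:1, 1:] ^ l)"
    by (simp add: r_def)
  ultimately show ?thesis
    by (metis add_0 distrib_left jacobi_int_add[OF ab] jacobi_int_smult[OF ab] mult_smult_right)
qed

lemma jacobi_unit_norm_pos: "jacobi_unit_norm \<alpha> \<beta> l > 0"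
proof -
  have "pochhammer (\<beta> + 1) l > 0" "pochhammer (\<alpha> + 1) l > 0" "pochhammer (\<alpha> + \<beta> + 2) l > 0"
      "pochhammer (\<alpha> + \<beta> + l + 2) l > 0"
    using ab by (auto intro!: pochhammer_pos)
  then show ?thesis
    unfolding jacobi_unit_norm_def using pochhammer_jacobi_pos[of l] by simp
qed

lemma jacobi_int_jacobi_unit_square: "jacobi_int \<alpha> \<beta> (jacobi_unit \<alpha> \<beta> l * jacobi_unit \<alpha> \<beta> l) = jacobi_unit_norm \<alpha> \<beta> l * jacobi_int \<alpha> \<beta> 1"
proof -
  have P: "pochhammer (\<alpha> + 1) l > 0" "pochhammer (\<alpha> + \<beta> + 2) l > 0" "pochhammer (\<alpha> + \<beta> + l + 2) l > 0"
    using ab by (auto intro!: pochhammer_pos)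
  have "Beta (\<alpha> + 1) (\<beta> + l + 1) =
      pochhammer (\<beta> + 1) l / pochhammer (\<alpha> + \<beta> + 2) l * Beta (\<alpha> + 1) (\<beta> + 1)"
    using Beta_plus_nat_left[of "\<beta> + 1" "\<alpha> + 1" l] ab
    by (simp add: add_ac Beta_commute[of "1 + \<alpha>"])
  moreover have "pochhammer (real l + 1 - real l) l = fact l"
    by (simp add: pochhammer_fact)
  moreover have "2 powr (\<alpha> + \<beta> + l + 1) = 2 powr (\<alpha> + \<beta> + 1) * 2 ^ l"
    by (simp add: powr_add powr_realpow)
  ultimately show ?thesis
    unfolding jacobi_int_mult_jacobi_unit[OF degree_jacobi_unit_le] coeff_jacobi_unit jacobi_int_jacobi_unit_moment jacobi_int_1[OF ab] jacobi_unit_norm_def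
    using P by (simp add: mult_ac)
qed

lemma orthogonal_poly_unique:
  assumes "degree q \<le> l" and orth: "\<And>r. degree r < l \<Longrightarrow> jacobi_int \<alpha> \<beta> (q * r) = 0"
  shows "q = smult (coeff q l / coeff (jacobi_unit \<alpha> \<beta> l) l) (jacobi_unit \<alpha> \<beta> l)"
proof (rule ccontr)
  define e where "e = q - smult (coeff q l / coeff (jacobi_unit \<alpha> \<beta> l) l) (jacobi_unit \<alpha> \<beta> l)"
  assume "\<not> ?thesis"
  then have "e \<noteq> 0" by (simp add: e_def)
  have "coeff e l = 0"
    using coeff_jacobi_unit_pos[of l] by (simp add: e_def)
  moreover have "degree e \<le> l"
    unfolding e_def using assms degree_jacobi_unit_le
    by (metis degree_diff_le degree_smult_le order_trans)
  ultimately have "degree e < l"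
    using \<open>e \<noteq> 0\<close> by (metis leading_coeff_0_iff order_less_le)
  have 0: "jacobi_int \<alpha> \<beta> (e * r) = 0" if "degree r < l" for r
    using orth[OF that] jacobi_unit_orthogonal[OF that]
    by (simp add: e_def left_diff_distrib jacobi_int_diff[OF ab] jacobi_int_smult[OF ab])
  \<comment> \<open>Pairing \<open>e\<close> with the Jacobi polynomial of its own degree isolates
    its leading coefficient; the moment multiplying that coefficient is nonzero because the squared
    norm is.\<close>
  define i where "i = degree e"
  have s: "jacobi_int \<alpha> \<beta> (jacobi_unit \<alpha> \<beta> i * jacobi_unit \<alpha> \<beta> i) > 0"
    using jacobi_unit_norm_pos jacobi_int_1_pos[OF ab] by (simp add: jacobi_int_jacobi_unit_square)
  have "jacobi_int \<alpha> \<beta> (jacobi_unit \<alpha> \<beta> i * e) = 0"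
    using 0[of "jacobi_unit \<alpha> \<beta> i"] \<open>degree e < l\<close> by (simp add: i_def degree_jacobi_unit mult.commute)
  moreover have "jacobi_int \<alpha> \<beta> (jacobi_unit \<alpha> \<beta> i * e) = coeff e i * jacobi_int \<alpha> \<beta> (jacobi_unit \<alpha> \<beta> i * [:1, 1:] ^ i)"
    by (intro jacobi_int_mult_jacobi_unit) (simp add: i_def)
  moreover have "jacobi_int \<alpha> \<beta> (jacobi_unit \<alpha> \<beta> i * [:1, 1:] ^ i) \<noteq> 0"
    using s jacobi_int_mult_jacobi_unit[OF degree_jacobi_unit_le, of i] by auto
  ultimately show False
    using \<open>e \<noteq> 0\<close> by (simp add: i_def)
qed

lemma jacobi_inner_eq: "jacobi_inner \<alpha> \<beta> p q = jacobi_int \<alpha> \<beta> (p * q) / jacobi_int \<alpha> \<beta> 1"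
  unfolding jacobi_inner_def jacobi_int_def by simp

text \<open>Uniqueness up to a factor leaves a constant c with c^2 times the squared norm equal to
  1; positivity of the leading coefficient selects the positive root.\<close>

lemma jacobi_eq: "jacobi \<alpha> \<beta> l = smult (1 / sqrt (jacobi_unit_norm \<alpha> \<beta> l)) (jacobi_unit \<alpha> \<beta> l)"
  unfolding jacobi_def
proof (rule the_equality)
  let ?F = "jacobi_unit \<alpha> \<beta> l" and ?N = "jacobi_unit_norm \<alpha> \<beta> l"
  have J: "jacobi_int \<alpha> \<beta> 1 > 0" by (rule jacobi_int_1_pos[OF ab])
  have N: "?N > 0" by (rule jacobi_unit_norm_pos)
  show "degree (smult (1 / sqrt ?N) ?F) = l \<and> lead_coeff (smult (1 / sqrt ?N) ?F) > 0 \<and>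
      jacobi_inner \<alpha> \<beta> (smult (1 / sqrt ?N) ?F) (smult (1 / sqrt ?N) ?F) = 1 \<and>
      (\<forall>q. degree q < l \<longrightarrow> jacobi_inner \<alpha> \<beta> (smult (1 / sqrt ?N) ?F) q = 0)"
    using J N coeff_jacobi_unit_pos[of l]
    by (auto simp: degree_jacobi_unit jacobi_inner_eq jacobi_int_smult[OF ab] jacobi_int_jacobi_unit_square jacobi_unit_orthogonal)
  fix p
  assume p: "degree p = l \<and> 0 < lead_coeff p \<and> jacobi_inner \<alpha> \<beta> p p = 1 \<and>
    (\<forall>q. degree q < l \<longrightarrow> jacobi_inner \<alpha> \<beta> p q = 0)"
  define c where "c = coeff p l / coeff ?F l"
  have "c > 0" unfolding c_def using p coeff_jacobi_unit_pos[of l] by (intro divide_pos_pos) auto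
  have pc: "p = smult c ?F"
    unfolding c_def using p J by (intro orthogonal_poly_unique) (auto simp: jacobi_inner_eq)
  have "c * c * ?N = 1"
    using p J by (subst (asm) (1 2 3 4 5) pc) (simp add: jacobi_inner_eq jacobi_int_smult[OF ab] jacobi_int_jacobi_unit_square mult.assoc)
  then have "(c * sqrt ?N)\<^sup>2 = 1"
    using N by (simp add: power2_eq_square mult_ac)
  then have "c * sqrt ?N = 1"
    using N \<open>c > 0\<close> by (simp add: power2_eq_1_iff) (smt (verit) mult_pos_pos real_sqrt_gt_zero)
  then have "c = 1 / sqrt ?N"
    using N by (simp add: field_simps)
  then show "p = smult (1 / sqrt ?N) ?F" using pc by simp
qed

end

text \<open>For superscript \<mu> + 1/2 the weight is (1 - s^2)^\<mu> = (1 - s)^\<mu> (1 + s)^\<mu>,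
  the Jacobi weight with equal parameters. Since \<open>jacobi_unit\<close> is 1 at s = 1, the
  factor is the prescribed endpoint value.\<close>

lemma gegenbauer_eq:
  assumes "\<mu> \<ge> 0"
  shows "gegenbauer (\<mu> + 1/2) k = smult (pochhammer (2 * \<mu> + 1) k / fact k) (jacobi_unit \<mu> \<mu> k)"
proof -
  have w: "(LINT s:{-1..1}|lebesgue. poly p s * poly q s * (1 - s\<^sup>2) powr (\<mu> + 1/2 - 1/2)) = jacobi_int \<mu> \<mu> (p * q)" for p q
    unfolding jacobi_int_def jacobi_weight_def
  proof (intro set_lebesgue_integral_cong ballI allI impI)
    fix x :: real assume "x \<in> {-1..1}"
    then have "(1 - x) powr \<mu> * (1 + x) powr \<mu> = ((1 - x) * (1 + x)) powr \<mu>"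
      by (simp add: powr_mult)
    also have "(1 - x) * (1 + x) = 1 - x\<^sup>2"
      by (simp add: power2_eq_square algebra_simps)
    finally show "poly p x * poly q x * (1 - x\<^sup>2) powr (\<mu> + 1/2 - 1/2) =
        poly (p * q) x * ((1 - x) powr \<mu> * (1 + x) powr \<mu>)" by simp
  qed simp
  have \<mu>: "\<mu> > -1" using assms by simp
  have e: "2 * (\<mu> + 1/2) = 2 * \<mu> + 1" by simp
  show ?thesis
    unfolding gegenbauer_def w e
  proof (rule the_equality)
    let ?c = "pochhammer (2 * \<mu> + 1) k / fact k :: real"
    have "?c > 0" using assms by (simp add: pochhammer_pos)
    show "degree (smult ?c (jacobi_unit \<mu> \<mu> k)) = k \<and> (\<forall>q. degree q < k \<longrightarrow> jacobi_int \<mu> \<mu> (smult ?c (jacobi_unit \<mu> \<mu> k) * q) = 0) \<and>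
        poly (smult ?c (jacobi_unit \<mu> \<mu> k)) 1 = ?c"
      using \<open>?c > 0\<close> by (auto simp: degree_jacobi_unit[OF \<mu> \<mu>] jacobi_int_smult[OF \<mu> \<mu>] jacobi_unit_orthogonal[OF \<mu> \<mu>] poly_jacobi_unit_1)
    fix p
    assume p: "degree p = k \<and> (\<forall>q. degree q < k \<longrightarrow> jacobi_int \<mu> \<mu> (p * q) = 0) \<and> poly p 1 = ?c"
    then have "p = smult (coeff p k / coeff (jacobi_unit \<mu> \<mu> k) k) (jacobi_unit \<mu> \<mu> k)"
      by (intro orthogonal_poly_unique[OF \<mu> \<mu>]) auto
    then show "p = smult ?c (jacobi_unit \<mu> \<mu> k)"
      using p poly_jacobi_unit_1 by (metis mult.right_neutral poly_smult)
  qed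
qed

section \<open>Fubini and rotations for Lebesgue measure\<close>

text \<open>Chosen to match the argument of f in \<open>radon\<close>: t is the coordinate along
  (cos \<theta>, sin \<theta>) and s the one along the line of integration.\<close>

definition rot :: "real \<Rightarrow> real \<times> real \<Rightarrow> real \<times> real" where
  "rot \<theta> = (\<lambda>(t, s). (t * cos \<theta> - s * sin \<theta>, t * sin \<theta> + s * cos \<theta>))"

lemma lebesgue_AE_eq:
  fixes f g :: "'a::euclidean_space \<Rightarrow> real"
  assumes g: "g \<in> borel_measurable lborel" and ae: "AE x in lborel. f x = g x"
  shows "f \<in> borel_measurable lebesgue"
    and "integrable lebesgue f \<longleftrightarrow> integrable lborel g"
    and "integral\<^sup>L lebesgue f = integral\<^sup>L lborel g"
proof -
  have g': "g \<in> borel_measurable lebesgue" using g by (rule measurable_completion)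
  have aeL: "AE x in lebesgue. f x = g x" using ae by (rule AE_completion)
  have "AE x in lebesgue. g x = f x" using aeL by eventually_elim simp
  with g' show f: "f \<in> borel_measurable lebesgue" by (rule borel_measurable_AE)
  show "integrable lebesgue f \<longleftrightarrow> integrable lborel g"
    using integrable_cong_AE[OF f g' aeL] g by (simp add: integrable_completion)
  show "integral\<^sup>L lebesgue f = integral\<^sup>L lborel g"
    using integral_cong_AE[OF f g' aeL] g by (simp add: integral_completion)
qed

text \<open>Lebesgue measure on the plane is the completion of a product measure, not a product
  itself. Fubini is therefore applied to a Borel function \<open>g\<close> equal to \<open>f\<close>
  almost everywhere; for almost every t the two also agree for almost every s.\<close>

lemma lebesgue_Fubini:
  fixes f :: "real \<times> real \<Rightarrow> real"
  assumes "integrable lebesgue f"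
  shows "integral\<^sup>L lebesgue f = (LINT t|lebesgue. LINT s|lebesgue. f (t, s))"
    and "integrable lebesgue (\<lambda>t. LINT s|lebesgue. f (t, s))"
proof -
  obtain g where g[measurable]: "g \<in> borel_measurable lborel" and ae: "AE x in lborel. f x = g x"
    using completion_ex_borel_measurable_real[OF borel_measurable_integrable[OF assms]] by auto
  have "integrable lborel g" using assms lebesgue_AE_eq(2)[OF g ae] by simp
  then have ig: "integrable (lborel \<Otimes>\<^sub>M lborel) g"
    by (simp add: lborel_prod)
  have "AE x in lborel \<Otimes>\<^sub>M lborel. f x = g x" using ae unfolding lborel_prod .
  then have AA: "AE t in lborel. AE s in lborel. f (t, s) = g (t, s)"
    by (rule lborel_pair.AE_pair)
  have [measurable]: "(\<lambda>s. g (t, s)) \<in> borel_measurable lborel" for t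
    using g by (simp add: borel_prod[symmetric]) measurable
  have m: "(\<lambda>t. LINT s|lborel. g (t, s)) \<in> borel_measurable lborel"
    using lborel_pair.integrable_fst'[OF ig] by auto
  have eq: "AE t in lborel. (LINT s|lebesgue. f (t, s)) = (LINT s|lborel. g (t, s))"
    using AA by eventually_elim (intro lebesgue_AE_eq, measurable)
  show "integral\<^sup>L lebesgue f = (LINT t|lebesgue. LINT s|lebesgue. f (t, s))"
    unfolding lebesgue_AE_eq(3)[OF g ae] lebesgue_AE_eq(3)[OF m eq]
    using lborel_pair.integral_fst'[OF ig] by (simp add: lborel_prod)
  show "integrable lebesgue (\<lambda>t. LINT s|lebesgue. f (t, s))"
    unfolding lebesgue_AE_eq(2)[OF m eq] by (rule lborel_pair.integrable_fst'[OF ig])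
qed

section \<open>Rotation invariance of Lebesgue measure in the plane\<close>

lemma lborel_distr_shear_fst:
  "distr lborel borel (\<lambda>z. (fst z + a * snd z, snd z)) = (lborel :: (real \<times> real) measure)"
proof (rule measure_eqI)
  fix A :: "(real \<times> real) set" assume "A \<in> sets (distr lborel borel (\<lambda>z. (fst z + a * snd z, snd z)))"
  then have A: "A \<in> sets borel" by simp
  have A'[measurable]: "A \<in> sets (borel \<Otimes>\<^sub>M borel)" using A unfolding borel_prod .
  have m: "(\<lambda>z. (fst z + a * snd z, snd z)) \<in> borel_measurable (borel :: (real \<times> real) measure)"
    by (intro borel_measurable_continuous_onI continuous_intros)
  have "emeasure (distr lborel borel (\<lambda>z. (fst z + a * snd z, snd z))) A =
      (\<integral>\<^sup>+z. indicator A z \<partial>distr lborel borel (\<lambda>z. (fst z + a * snd z, snd z)))"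
    using A by simp
  also have "\<dots> = (\<integral>\<^sup>+z. indicator A (fst z + a * snd z, snd z) \<partial>(lborel \<Otimes>\<^sub>M lborel))"
    using A m by (subst nn_integral_distr) (auto simp: lborel_prod)
  also have "\<dots> = (\<integral>\<^sup>+y. \<integral>\<^sup>+x. indicator A (x + a * y, y) \<partial>lborel \<partial>lborel)"
    by (subst lborel_pair.nn_integral_snd[symmetric]) simp_all
  also have "\<dots> = (\<integral>\<^sup>+y. \<integral>\<^sup>+x. indicator A (x, y) \<partial>lborel \<partial>lborel)"
  \<comment> \<open>On each horizontal line the shear is a translation.\<close>
  proof (rule nn_integral_cong)
    fix y :: real
    have "(\<lambda>x. indicator A (x, y) :: ennreal) \<in> borel_measurable borel" by measurable
    from nn_integral_real_affine[OF this, of 1 "a * y"]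
    show "(\<integral>\<^sup>+x. indicator A (x + a * y, y) \<partial>lborel) = (\<integral>\<^sup>+x. indicator A (x, y) \<partial>lborel)"
      by (simp add: add.commute)
  qed
  also have "\<dots> = (\<integral>\<^sup>+z. indicator A z \<partial>(lborel \<Otimes>\<^sub>M lborel))"
    by (subst lborel_pair.nn_integral_snd) simp_all
  also have "\<dots> = emeasure lborel A" using A by (simp add: lborel_prod)
  finally show "emeasure (distr lborel borel (\<lambda>z. (fst z + a * snd z, snd z))) A = emeasure lborel A" .
qed simp

lemma lborel_distr_shear_snd:
  "distr lborel borel (\<lambda>z. (fst z, a * fst z + snd z)) = (lborel :: (real \<times> real) measure)"
proof (rule measure_eqI)
  fix A :: "(real \<times> real) set" assume "A \<in> sets (distr lborel borel (\<lambda>z. (fst z, a * fst z + snd z)))"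
  then have A: "A \<in> sets borel" by simp
  have A'[measurable]: "A \<in> sets (borel \<Otimes>\<^sub>M borel)" using A unfolding borel_prod .
  have m: "(\<lambda>z. (fst z, a * fst z + snd z)) \<in> borel_measurable (borel :: (real \<times> real) measure)"
    by (intro borel_measurable_continuous_onI continuous_intros)
  have "emeasure (distr lborel borel (\<lambda>z. (fst z, a * fst z + snd z))) A =
      (\<integral>\<^sup>+z. indicator A z \<partial>distr lborel borel (\<lambda>z. (fst z, a * fst z + snd z)))"
    using A by simp
  also have "\<dots> = (\<integral>\<^sup>+z. indicator A (fst z, a * fst z + snd z) \<partial>(lborel \<Otimes>\<^sub>M lborel))"
    using A m by (subst nn_integral_distr) (auto simp: lborel_prod)
  also have "\<dots> = (\<integral>\<^sup>+x. \<integral>\<^sup>+y. indicator A (x, a * x + y) \<partial>lborel \<partial>lborel)"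
    by (subst lborel.nn_integral_fst[symmetric]) simp_all
  also have "\<dots> = (\<integral>\<^sup>+x. \<integral>\<^sup>+y. indicator A (x, y) \<partial>lborel \<partial>lborel)"
  proof (rule nn_integral_cong)
    fix x :: real
    have "(\<lambda>y. indicator A (x, y) :: ennreal) \<in> borel_measurable borel" by measurable
    from nn_integral_real_affine[OF this, of 1 "a * x"]
    show "(\<integral>\<^sup>+y. indicator A (x, a * x + y) \<partial>lborel) = (\<integral>\<^sup>+y. indicator A (x, y) \<partial>lborel)"
      by simp
  qed
  also have "\<dots> = (\<integral>\<^sup>+z. indicator A z \<partial>(lborel \<Otimes>\<^sub>M lborel))"
    by (subst lborel.nn_integral_fst) simp_all
  also have "\<dots> = emeasure lborel A" using A by (simp add: lborel_prod)
  finally show "emeasure (distr lborel borel (\<lambda>z. (fst z, a * fst z + snd z))) A = emeasure lborel A" .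
qed simp

lemma rot_add: "rot (\<theta> + \<eta>) z = rot \<theta> (rot \<eta> z)"
  by (cases z) (simp add: rot_def cos_add sin_add algebra_simps)

lemma continuous_on_rot [continuous_intros]: "continuous_on A (rot \<theta>)"
  unfolding rot_def split_beta by (intro continuous_intros)

lemma measurable_rot: "rot \<theta> \<in> borel_measurable borel"
  by (intro borel_measurable_continuous_onI continuous_intros)

text \<open>A rotation is a product of three shears, with parameters -tan(\<theta>/2), sin \<theta>,
  -tan(\<theta>/2). The assumption makes the tangent finite.\<close>

lemma lborel_distr_rot_half:
  assumes "cos (\<theta> / 2) \<noteq> 0"
  shows "distr lborel borel (rot \<theta>) = lborel"
proof -
  define a where "a = - (sin (\<theta> / 2) / cos (\<theta> / 2))"
  let ?f = "\<lambda>z::real \<times> real. (fst z + a * snd z, snd z)"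
  let ?g = "\<lambda>z::real \<times> real. (fst z, sin \<theta> * fst z + snd z)"
  have s: "sin \<theta> = 2 * sin (\<theta> / 2) * cos (\<theta> / 2)" using sin_double[of "\<theta> / 2"] by simp
  have c: "cos \<theta> = 1 - 2 * (sin (\<theta> / 2))\<^sup>2" using cos_double_sin[of "\<theta> / 2"] by simp
  have a1: "1 + a * sin \<theta> = cos \<theta>" using assms by (simp add: a_def s c power2_eq_square)
  have a2: "a * (1 + cos \<theta>) = - sin \<theta>"
    using assms cos_double_cos[of "\<theta> / 2"] by (simp add: a_def s power2_eq_square)
  have r: "rot \<theta> = ?f \<circ> (?g \<circ> ?f)"
  proof
    fix z :: "real \<times> real"
    obtain t u where z: "z = (t, u)" by (cases z)
    have "t + a * u + a * (sin \<theta> * (t + a * u) + u) = t * (1 + a * sin \<theta>) + u * (a * (1 + (1 + a * sin \<theta>)))"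
      by (simp add: algebra_simps)
    also have "\<dots> = t * cos \<theta> - u * sin \<theta>" unfolding a1 a2 by simp
    finally have 1: "t + a * u + a * (sin \<theta> * (t + a * u) + u) = t * cos \<theta> - u * sin \<theta>" .
    have "sin \<theta> * (t + a * u) + u = t * sin \<theta> + u * (1 + a * sin \<theta>)"
      by algebra
    then have "sin \<theta> * (t + a * u) + u = t * sin \<theta> + u * cos \<theta>" by (simp only: a1)
    with 1 show "rot \<theta> z = (?f \<circ> (?g \<circ> ?f)) z" by (simp add: z rot_def)
  qed
  have m: "?f \<in> lborel \<rightarrow>\<^sub>M borel" "?g \<in> lborel \<rightarrow>\<^sub>M borel" "?f \<in> borel \<rightarrow>\<^sub>M borel" "?g \<in> borel \<rightarrow>\<^sub>M borel"
    by (auto intro!: borel_measurable_continuous_onI continuous_intros)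
  have "distr lborel borel (?g \<circ> ?f) = distr (distr lborel borel ?f) borel ?g"
    using m by (simp add: distr_distr)
  also have "\<dots> = lborel" by (simp only: lborel_distr_shear_fst lborel_distr_shear_snd)
  finally have gf: "distr lborel borel (?g \<circ> ?f) = lborel" .
  have "distr lborel borel (?f \<circ> (?g \<circ> ?f)) = distr (distr lborel borel (?g \<circ> ?f)) borel ?f"
    using m by (intro distr_distr[symmetric]) (auto intro: measurable_comp)
  also have "\<dots> = lborel" by (simp only: gf lborel_distr_shear_fst)
  finally show ?thesis by (simp only: r)
qed

lemma lborel_distr_rot: "distr lborel borel (rot \<theta>) = lborel"
proof (cases "cos (\<theta> / 2) = 0")
  case True
  \<comment> \<open>cos(\<theta>/4) = 0 would force cos(\<theta>/2) = -1. So the shear decomposition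
    is available for half the angle, and that rotation is applied twice.\<close>
  then have "cos (\<theta> / 2 / 2) \<noteq> 0"
    using cos_double_cos[of "\<theta> / 2 / 2"] by auto
  from lborel_distr_rot_half[OF this] have h: "distr lborel borel (rot (\<theta> / 2)) = lborel" .
  have "rot \<theta> = rot (\<theta> / 2) \<circ> rot (\<theta> / 2)"
    using rot_add[of "\<theta> / 2" "\<theta> / 2"] by auto
  then have "distr lborel borel (rot \<theta>) = distr (distr lborel borel (rot (\<theta> / 2))) borel (rot (\<theta> / 2))"
    using measurable_rot by (simp add: distr_distr)
  then show ?thesis by (simp only: h)
qed (rule lborel_distr_rot_half)

lemma lebesgue_rot:
  fixes f :: "real \<times> real \<Rightarrow> real"
  assumes "integrable lebesgue f"
  shows "integrable lebesgue (\<lambda>z. f (rot \<theta> z))"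
    and "(LINT z|lebesgue. f (rot \<theta> z)) = integral\<^sup>L lebesgue f"
proof -
  obtain g where g: "g \<in> borel_measurable lborel" and ae: "AE x in lborel. f x = g x"
    using completion_ex_borel_measurable_real[OF borel_measurable_integrable[OF assms]] by auto
  have r: "rot \<theta> \<in> lborel \<rightarrow>\<^sub>M borel" using measurable_rot by simp
  have g': "g \<in> borel_measurable borel" using g by simp
  have gr: "(\<lambda>z. g (rot \<theta> z)) \<in> borel_measurable lborel"
    using measurable_compose[OF r g'] .
  have "AE x in distr lborel borel (rot \<theta>). f x = g x" using ae by (simp only: lborel_distr_rot)
  then have ae': "AE x in lborel. f (rot \<theta> x) = g (rot \<theta> x)" by (rule AE_distrD[OF r])
  have i: "integrable lborel g" using assms lebesgue_AE_eq(2)[OF g ae] by simp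
  then show "integrable lebesgue (\<lambda>z. f (rot \<theta> z))"
    using integrable_distr_eq[OF r g'] lebesgue_AE_eq(2)[OF gr ae'] by (simp add: lborel_distr_rot)
  show "(LINT z|lebesgue. f (rot \<theta> z)) = integral\<^sup>L lebesgue f"
    using integral_distr[OF r g'] lebesgue_AE_eq(3)[OF gr ae'] lebesgue_AE_eq(3)[OF g ae]
    by (simp add: lborel_distr_rot)
qed

section \<open>Polynomials in two variables and their fibre integrals\<close>

text \<open>Linear span, built by adding one multiple of a generator at a time, so that rule
  induction reduces a linear claim to single generators.\<close>

inductive_set fun_span :: "('a \<Rightarrow> real) set \<Rightarrow> ('a \<Rightarrow> real) set" for B where
  fun_span_zero: "(\<lambda>_. 0) \<in> fun_span B"
| fun_span_step: "P \<in> fun_span B \<Longrightarrow> Q \<in> B \<Longrightarrow> (\<lambda>z. P z + c * Q z) \<in> fun_span B"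

lemma fun_span_scale: "P \<in> fun_span B \<Longrightarrow> (\<lambda>z. c * P z) \<in> fun_span B"
proof (induction rule: fun_span.induct)
  case fun_span_zero
  then show ?case by (simp add: fun_span.fun_span_zero)
next
  case (fun_span_step P Q a)
  then have "(\<lambda>z. c * P z + (c * a) * Q z) \<in> fun_span B" by (intro fun_span.fun_span_step)
  then show ?case by (simp add: algebra_simps)
qed

lemma fun_span_add: "Q \<in> fun_span B \<Longrightarrow> P \<in> fun_span B \<Longrightarrow> (\<lambda>z. P z + Q z) \<in> fun_span B"
proof (induction rule: fun_span.induct)
  case (fun_span_step Q R c)
  then have "(\<lambda>z. (P z + Q z) + c * R z) \<in> fun_span B" by (intro fun_span.fun_span_step)
  then show ?case by (simp add: algebra_simps)
qed simp

lemma fun_span_base: "P \<in> B \<Longrightarrow> P \<in> fun_span B"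
  using fun_span_step[OF fun_span_zero, of P B 1] by simp

lemma fun_span_sum: "(\<And>i. i \<in> A \<Longrightarrow> g i \<in> fun_span B) \<Longrightarrow> (\<lambda>z. \<Sum>i\<in>A. g i z) \<in> fun_span B"
  by (induction A rule: infinite_finite_induct) (auto intro: fun_span_zero fun_span_add)

lemma fun_span_subset: "P \<in> fun_span B \<Longrightarrow> B \<subseteq> fun_span B' \<Longrightarrow> P \<in> fun_span B'"
  by (induction rule: fun_span.induct) (auto intro!: fun_span_zero fun_span_add fun_span_scale)

definition monomials :: "nat \<Rightarrow> (real \<times> real \<Rightarrow> real) set" where
  "monomials d = {\<lambda>z. fst z ^ i * snd z ^ j |i j. i + j \<le> d}"

lemma monomialI: "i + j \<le> d \<Longrightarrow> (\<lambda>z. fst z ^ i * snd z ^ j) \<in> monomials d"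
  by (auto simp: monomials_def)

text \<open>Adding a multiple of a monomial changes one entry of the coefficient array. From here
  on, closure properties of \<open>poly2\<close> are proved on monomials instead of on double
  sums.\<close>

lemma poly2_eq_fun_span: "poly2 d = fun_span (monomials d)"
proof (intro equalityI subsetI)
  fix P assume "P \<in> poly2 d"
  then obtain c where "P = (\<lambda>(x, y). \<Sum>i\<le>d. \<Sum>j\<le>d - i. c i j * x ^ i * y ^ j)"
    by (auto simp: poly2_def)
  then have P: "P = (\<lambda>z. \<Sum>i\<le>d. \<Sum>j\<le>d - i. c i j * (fst z ^ i * snd z ^ j))"
    by (simp add: fun_eq_iff mult.assoc)
  show "P \<in> fun_span (monomials d)"
    unfolding P by (intro fun_span_sum fun_span_scale fun_span_base monomialI) auto
next
  fix P assume "P \<in> fun_span (monomials d)"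
  then show "P \<in> poly2 d"
  proof induction
    case fun_span_zero
    show ?case by (auto simp: poly2_def intro!: exI[of _ "\<lambda>_ _. 0"])
  next
    case (fun_span_step P Q a)
    obtain i j where ij: "Q = (\<lambda>z. fst z ^ i * snd z ^ j)" "i + j \<le> d"
      using fun_span_step by (auto simp: monomials_def)
    obtain c where P: "P = (\<lambda>(x, y). \<Sum>i\<le>d. \<Sum>j\<le>d - i. c i j * x ^ i * y ^ j)"
      using fun_span_step by (auto simp: poly2_def)
    have "P z + a * Q z = (\<Sum>i'\<le>d. \<Sum>j'\<le>d - i'. (c i' j' + (if i' = i then if j' = j then a else 0 else 0))
        * fst z ^ i' * snd z ^ j')" for z
    proof -
      have "(\<Sum>i'\<le>d. \<Sum>j'\<le>d - i'. (if i' = i then if j' = j then a else 0 else 0) * fst z ^ i' * snd z ^ j') =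
          (\<Sum>i'\<le>d. if i' = i then (\<Sum>j'\<le>d - i. if j' = j then a * fst z ^ i * snd z ^ j else 0) else 0)"
        by (intro sum.cong refl) (auto intro!: sum.cong simp del: sum.delta sum.delta')
      also have "\<dots> = a * Q z" using ij by auto
      finally show ?thesis
        by (simp add: P split_beta distrib_right sum.distrib)
    qed
    then show ?case
      unfolding poly2_def
      by (intro CollectI exI[of _ "\<lambda>i' j'. c i' j' + (if i' = i then if j' = j then a else 0 else 0)"])
         (simp add: fun_eq_iff)
  qed
qed

lemma poly2_mono: "P \<in> poly2 d \<Longrightarrow> d \<le> d' \<Longrightarrow> P \<in> poly2 d'"
  unfolding poly2_eq_fun_span
  by (erule fun_span_subset) (force simp: monomials_def[of d] intro!: fun_span_base monomialI)

lemma poly2_add: "P \<in> poly2 d \<Longrightarrow> Q \<in> poly2 d \<Longrightarrow> (\<lambda>z. P z + Q z) \<in> poly2 d"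
  unfolding poly2_eq_fun_span by (rule fun_span_add)

lemma poly2_scale: "P \<in> poly2 d \<Longrightarrow> (\<lambda>z. c * P z) \<in> poly2 d"
  unfolding poly2_eq_fun_span by (rule fun_span_scale)

lemma poly2_diff: "P \<in> poly2 d \<Longrightarrow> Q \<in> poly2 d \<Longrightarrow> (\<lambda>z. P z - Q z) \<in> poly2 d"
  using poly2_add[OF _ poly2_scale[of Q d "-1"], of P] by simp

lemma poly2_sum: "(\<And>i. i \<in> A \<Longrightarrow> g i \<in> poly2 d) \<Longrightarrow> (\<lambda>z. \<Sum>i\<in>A. g i z) \<in> poly2 d"
  unfolding poly2_eq_fun_span by (rule fun_span_sum)

lemma poly2_const: "(\<lambda>_. c) \<in> poly2 d"
proof -
  have "(\<lambda>z. fst z ^ 0 * snd z ^ 0) \<in> monomials d" by (intro monomialI) simp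
  then have "(\<lambda>z. c * (fst z ^ 0 * snd z ^ 0)) \<in> fun_span (monomials d)"
    by (intro fun_span_scale fun_span_base)
  then show ?thesis by (simp add: poly2_eq_fun_span)
qed

lemma poly2_fst: "fst \<in> poly2 1" and poly2_snd: "snd \<in> poly2 1"
proof -
  have "(\<lambda>z. fst z ^ 1 * snd z ^ 0) \<in> monomials 1" "(\<lambda>z. fst z ^ 0 * snd z ^ 1) \<in> monomials 1"
    by (intro monomialI; simp)+
  from this[THEN fun_span_base] show "fst \<in> poly2 1" "snd \<in> poly2 1" by (simp_all add: poly2_eq_fun_span)
qed

lemma poly2_mult: "P \<in> poly2 a \<Longrightarrow> Q \<in> poly2 b \<Longrightarrow> (\<lambda>z. P z * Q z) \<in> poly2 (a + b)"
proof -
  assume P: "P \<in> poly2 a" and Q: "Q \<in> poly2 b"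
  have mono: "(\<lambda>z. R z * Q z) \<in> poly2 (a + b)" if R: "R \<in> monomials a" for R
  proof -
    obtain i j where R: "R = (\<lambda>z. fst z ^ i * snd z ^ j)" "i + j \<le> a"
      using R by (auto simp: monomials_def)
    show ?thesis
      using Q unfolding poly2_eq_fun_span
    proof induction
      case fun_span_zero
      then show ?case by (simp add: fun_span.fun_span_zero)
    next
      case (fun_span_step Q M c)
      obtain i' j' where M: "M = (\<lambda>z. fst z ^ i' * snd z ^ j')" "i' + j' \<le> b"
        using fun_span_step by (auto simp: monomials_def)
      have "(\<lambda>z. fst z ^ (i + i') * snd z ^ (j + j')) \<in> monomials (a + b)"
        using M R by (intro monomialI) simp
      then have "(\<lambda>z. R z * Q z + c * (fst z ^ (i + i') * snd z ^ (j + j'))) \<in> fun_span (monomials (a + b))"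
        using fun_span_step by (intro fun_span.fun_span_step)
      then show ?case by (simp add: M R power_add algebra_simps)
    qed
  qed
  show ?thesis
    using P unfolding poly2_eq_fun_span[of a]
  proof induction
    case fun_span_zero
    then show ?case using poly2_const[of 0] by simp
  next
    case (fun_span_step P M c)
    have "(\<lambda>z. P z * Q z + c * (M z * Q z)) \<in> poly2 (a + b)"
      using fun_span_step mono by (intro poly2_add poly2_scale)
    then show ?case by (simp add: algebra_simps)
  qed
qed

lemma poly2_power: "P \<in> poly2 a \<Longrightarrow> (\<lambda>z. P z ^ n) \<in> poly2 (n * a)"
proof (induction n)
  case 0
  then show ?case using poly2_const[of 1] by simp
next
  case (Suc n)
  then show ?case using poly2_mult[of P a "\<lambda>z. P z ^ n" "n * a"] by simp
qed

lemma poly2_poly: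
  assumes "P \<in> poly2 a" "degree p * a \<le> d"
  shows "(\<lambda>z. poly p (P z)) \<in> poly2 d"
proof -
  have "(\<lambda>z. \<Sum>i\<le>degree p. coeff p i * P z ^ i) \<in> poly2 d"
  proof (intro poly2_sum poly2_scale)
    fix i assume "i \<in> {..degree p}"
    then have "i * a \<le> d" using assms(2) by (meson atMost_iff mult_le_mono1 order_trans)
    then show "(\<lambda>z. P z ^ i) \<in> poly2 d" using poly2_mono[OF poly2_power[OF assms(1)]] by blast
  qed
  then show ?thesis by (simp add: poly_altdef)
qed

lemma poly2_linear: "(\<lambda>z. a * fst z + b * snd z) \<in> poly2 1"
  by (intro poly2_add poly2_scale poly2_fst poly2_snd)

lemma poly2_rot:
  assumes "P \<in> poly2 d"
  shows "(\<lambda>z. P (rot \<theta> z)) \<in> poly2 d"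
  using assms unfolding poly2_eq_fun_span[of d]
proof induction
  case fun_span_zero
  then show ?case by (rule fun_span.fun_span_zero)
next
  case (fun_span_step P M c)
  obtain i j where M: "M = (\<lambda>z. fst z ^ i * snd z ^ j)" "i + j \<le> d"
    using fun_span_step by (auto simp: monomials_def)
  have "(\<lambda>z. (cos \<theta> * fst z + (- sin \<theta>) * snd z) ^ i * (sin \<theta> * fst z + cos \<theta> * snd z) ^ j) \<in> poly2 (i * 1 + j * 1)"
    by (intro poly2_mult poly2_power poly2_linear)
  moreover have "(\<lambda>z. (cos \<theta> * fst z + (- sin \<theta>) * snd z) ^ i * (sin \<theta> * fst z + cos \<theta> * snd z) ^ j) = (\<lambda>z. M (rot \<theta> z))"
    by (simp add: M rot_def split_beta mult.commute)
  ultimately have "(\<lambda>z. M (rot \<theta> z)) \<in> poly2 d"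
    using M by (auto intro: poly2_mono)
  then show ?case
    using fun_span_step by (auto intro!: fun_span_add fun_span_scale simp: poly2_eq_fun_span)
qed

lemma continuous_poly2: "P \<in> poly2 d \<Longrightarrow> continuous_on A P"
  unfolding poly2_def split_beta by (auto intro!: continuous_intros)

section \<open>Integrals along the chords of the disk\<close>

lemma jacobi_int_reflect: "jacobi_int \<alpha> \<alpha> (p \<circ>\<^sub>p [:0, -1:]) = jacobi_int \<alpha> \<alpha> p"
  unfolding jacobi_int_def set_lebesgue_integral_def
  by (subst (2) lebesgue_integral_real_affine[of "-1" _ 0])
     (auto intro!: Bochner_Integration.integral_cong simp: poly_pcompose jacobi_weight_def indicator_def mult_ac)

lemma jacobi_int_odd:
  assumes "\<alpha> > -1" "odd j"
  shows "jacobi_int \<alpha> \<alpha> (monom 1 j) = 0"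
proof -
  have "(monom 1 j :: real poly) \<circ>\<^sub>p [:0, -1:] = smult (-1) (monom 1 j)"
    using assms(2) by (subst poly_eq_poly_eq_iff[symmetric]) (simp add: fun_eq_iff poly_pcompose poly_monom)
  then show ?thesis
    using jacobi_int_reflect[of \<alpha> "monom 1 j"] jacobi_int_smult[OF assms(1) assms(1), of "-1" "monom 1 j"] by simp
qed

abbreviation fibre :: "real \<Rightarrow> real set" where
  "fibre t \<equiv> {- sqrt (1 - t\<^sup>2)..sqrt (1 - t\<^sup>2)}"

text \<open>The substitution s = c u reduces the chord of half-length c to [-1, 1]; the factors c,
  c^j and (c^2)^\<alpha> come from ds, s^j and the weight.\<close>

lemma slice_moment:
  fixes c \<alpha> :: real
  assumes "c > 0" "\<alpha> > -1"
  shows "set_integrable lebesgue {-c..c} (\<lambda>s. s ^ j * (c\<^sup>2 - s\<^sup>2) powr \<alpha>)"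
    and "(LINT s:{-c..c}|lebesgue. s ^ j * (c\<^sup>2 - s\<^sup>2) powr \<alpha>) = c * c ^ j * (c\<^sup>2) powr \<alpha> * jacobi_int \<alpha> \<alpha> (monom 1 j)"
proof -
  let ?f = "\<lambda>s. indicator {-c..c} s *\<^sub>R (s ^ j * (c\<^sup>2 - s\<^sup>2) powr \<alpha>)"
  let ?g = "\<lambda>u. indicator {-1..1} u *\<^sub>R (poly (monom 1 j) u * jacobi_weight \<alpha> \<alpha> u)"
  have eq: "?f (0 + c * u) = (c ^ j * (c\<^sup>2) powr \<alpha>) * ?g u" for u
  proof (cases "u \<in> {-1..1}")
    case True
    then have "c * u \<in> {-c..c}"
      using assms mult_le_cancel_left_pos[of c u 1] mult_le_cancel_left_pos[of c "-1" u] by simp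
    moreover have "c\<^sup>2 - (c * u)\<^sup>2 = c\<^sup>2 * ((1 - u) * (1 + u))"
      by (simp add: power2_eq_square algebra_simps)
    then have "(c\<^sup>2 - (c * u)\<^sup>2) powr \<alpha> = (c\<^sup>2) powr \<alpha> * ((1 - u) powr \<alpha> * (1 + u) powr \<alpha>)"
      using True by (simp add: powr_mult)
    ultimately show ?thesis using True by (simp add: poly_monom power_mult_distrib jacobi_weight_def)
  next
    case False
    then have "c * u \<notin> {-c..c}"
      using assms mult_le_cancel_left_pos[of c u 1] mult_le_cancel_left_pos[of c "-1" u] by simp
    with False show ?thesis by simp
  qed
  have ig: "integrable lebesgue ?g"
    using jacobi_int_integrable[OF assms(2) assms(2), of "monom 1 j"] by (simp add: set_integrable_def)
  have "integrable lebesgue (\<lambda>u. ?f (0 + c * u))"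
    unfolding eq using ig by (rule integrable_mult_right)
  then show "set_integrable lebesgue {-c..c} (\<lambda>s. s ^ j * (c\<^sup>2 - s\<^sup>2) powr \<alpha>)"
    using assms unfolding set_integrable_def by (subst (asm) lebesgue_integrable_real_affine_iff) auto
  have "integral\<^sup>L lebesgue ?f = \<bar>c\<bar> *\<^sub>R (LINT u|lebesgue. ?f (0 + c * u))"
    using assms by (intro lebesgue_integral_real_affine) auto
  also have "\<dots> = c * c ^ j * (c\<^sup>2) powr \<alpha> * integral\<^sup>L lebesgue ?g"
    using assms unfolding eq by simp
  finally show "(LINT s:{-c..c}|lebesgue. s ^ j * (c\<^sup>2 - s\<^sup>2) powr \<alpha>) = c * c ^ j * (c\<^sup>2) powr \<alpha> * jacobi_int \<alpha> \<alpha> (monom 1 j)"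
    unfolding jacobi_int_def set_lebesgue_integral_def .
qed

text \<open>On the chord of half-length c = sqrt(1 - t^2) the monomial t^i s^j integrates to a
  constant times t^i c^(j+1) (c^2)^(\<mu> - 1/2), that is t^i (1 - t^2)^(\<mu> + j/2). Odd j give 0,
  so what remains beside (1 - t^2)^\<mu> is a polynomial of degree at most i + j.\<close>

lemma fibre_integral_poly2:
  assumes mu: "\<mu> \<ge> 0" and P: "P \<in> poly2 d"
  shows "\<exists>q. degree q \<le> d \<and> poly q 1 = jacobi_int (\<mu> - 1/2) (\<mu> - 1/2) 1 * P (1, 0) \<and> (\<forall>t. \<bar>t\<bar> < 1 \<longrightarrow>
      set_integrable lebesgue (fibre t) (\<lambda>s. P (t, s) * (1 - s\<^sup>2 - t\<^sup>2) powr (\<mu> - 1/2)) \<and>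
      (LINT s:fibre t|lebesgue. P (t, s) * (1 - s\<^sup>2 - t\<^sup>2) powr (\<mu> - 1/2)) = (1 - t\<^sup>2) powr \<mu> * poly q t)"
proof -
  let ?\<alpha> = "\<mu> - 1/2"
  have \<alpha>: "?\<alpha> > -1" using mu by simp
  show ?thesis
    using P unfolding poly2_eq_fun_span
  proof induction
    case fun_span_zero
    show ?case by (intro exI[of _ 0]) (simp add: set_integrable_def)
  next
    case (fun_span_step P M a)
    obtain i j where M: "M = (\<lambda>z. fst z ^ i * snd z ^ j)" "i + j \<le> d"
      using fun_span_step by (auto simp: monomials_def)
    obtain q where q: "degree q \<le> d" "poly q 1 = jacobi_int ?\<alpha> ?\<alpha> 1 * P (1, 0)"
      "\<And>t. \<bar>t\<bar> < 1 \<Longrightarrow> set_integrable lebesgue (fibre t) (\<lambda>s. P (t, s) * (1 - s\<^sup>2 - t\<^sup>2) powr ?\<alpha>)"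
      "\<And>t. \<bar>t\<bar> < 1 \<Longrightarrow> (LINT s:fibre t|lebesgue. P (t, s) * (1 - s\<^sup>2 - t\<^sup>2) powr ?\<alpha>) = (1 - t\<^sup>2) powr \<mu> * poly q t"
      using fun_span_step.IH by blast
    define r :: "real poly" where "r = (if odd j then 0 else smult (jacobi_int ?\<alpha> ?\<alpha> (monom 1 j)) (monom 1 i * [:1, 0, -1:] ^ (j div 2)))"
    have "degree r \<le> i + j"
    proof (cases "odd j")
      case False
      have "degree (monom 1 i * [:1, 0, -1:] ^ (j div 2) :: real poly) \<le> i + 2 * (j div 2)"
        using degree_mult_le[of "monom 1 i :: real poly" "[:1, 0, -1:] ^ (j div 2)"]
          degree_power_le[of "[:1, 0, -1:] :: real poly" "j div 2"] by (simp add: degree_monom_eq)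
      with False show ?thesis
        using degree_smult_le[of "jacobi_int ?\<alpha> ?\<alpha> (monom 1 j)" "monom 1 i * [:1, 0, -1:] ^ (j div 2)"]
        by (simp add: r_def)
    qed (simp add: r_def)
    then have deg: "degree r \<le> d" using M by simp
    \<comment> \<open>At t = 1 only j = 0 survives: for even j > 0 a factor 1 - t^2 vanishes in
      \<open>r\<close>, and for every j > 0 so does the second coordinate of (1, 0) in
      \<open>M\<close>.\<close>
    have r1: "poly r 1 = jacobi_int ?\<alpha> ?\<alpha> 1 * M (1, 0)"
    proof (cases "j = 0 \<or> odd j")
      case False
      then have "j > 0" "j div 2 > 0" by auto
      then show ?thesis by (simp add: r_def M poly_power zero_power)
    qed (auto simp: r_def M poly_monom)
    have Mt: "set_integrable lebesgue (fibre t) (\<lambda>s. M (t, s) * (1 - s\<^sup>2 - t\<^sup>2) powr ?\<alpha>) \<and>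
       (LINT s:fibre t|lebesgue. M (t, s) * (1 - s\<^sup>2 - t\<^sup>2) powr ?\<alpha>) = (1 - t\<^sup>2) powr \<mu> * poly r t"
      if t: "\<bar>t\<bar> < 1" for t
    proof -
      define c where "c = sqrt (1 - t\<^sup>2)"
      have t2: "1 - t\<^sup>2 > 0" using t by (simp add: abs_square_less_1)
      then have c: "c > 0" "c\<^sup>2 = 1 - t\<^sup>2" by (auto simp: c_def)
      have e: "M (t, s) * (1 - s\<^sup>2 - t\<^sup>2) powr ?\<alpha> = t ^ i * (s ^ j * (c\<^sup>2 - s\<^sup>2) powr ?\<alpha>)" for s
        by (simp add: M c algebra_simps)
      have "c * c ^ j * (c\<^sup>2) powr ?\<alpha> * jacobi_int ?\<alpha> ?\<alpha> (monom 1 j) * t ^ i = (1 - t\<^sup>2) powr \<mu> * poly r t"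
      proof (cases "odd j")
        case True
        then show ?thesis using jacobi_int_odd[OF \<alpha>] by (simp add: r_def)
      next
        case False
        then obtain m where m: "j = 2 * m" by auto
        have "c * (c\<^sup>2) powr ?\<alpha> = (1 - t\<^sup>2) powr (1/2) * (1 - t\<^sup>2) powr ?\<alpha>"
          using t2 by (simp add: c_def powr_half_sqrt)
        also have "\<dots> = (1 - t\<^sup>2) powr \<mu>" by (simp add: powr_add[symmetric])
        finally have "c * (c\<^sup>2) powr ?\<alpha> = (1 - t\<^sup>2) powr \<mu>" .
        moreover have "c ^ j = (1 - t\<^sup>2) ^ m" using c by (simp add: m power_mult)
        moreover have "poly r t = jacobi_int ?\<alpha> ?\<alpha> (monom 1 j) * (t ^ i * (1 - t\<^sup>2) ^ m)"
          by (simp add: r_def m poly_monom poly_power power2_eq_square algebra_simps)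
        ultimately show ?thesis by (simp add: mult_ac)
      qed
      moreover have "(LINT s:{-c..c}|lebesgue. t ^ i * (s ^ j * (c\<^sup>2 - s\<^sup>2) powr ?\<alpha>)) =
          t ^ i * (c * c ^ j * (c\<^sup>2) powr ?\<alpha> * jacobi_int ?\<alpha> ?\<alpha> (monom 1 j))"
        using slice_moment(2)[OF c(1) \<alpha>, of j] by simp
      ultimately show ?thesis
        unfolding e c_def[symmetric] using slice_moment(1)[OF c(1) \<alpha>, of j]
        by (auto intro: set_integrable_mult_right simp: mult.commute)
    qed
    show ?case
    proof (intro exI[of _ "q + smult a r"] conjI allI impI)
      show "degree (q + smult a r) \<le> d"
        using q(1) deg by (meson degree_add_le degree_smult_le order_trans)
      show "poly (q + smult a r) 1 = jacobi_int ?\<alpha> ?\<alpha> 1 * (P (1, 0) + a * M (1, 0))"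
        using q(2) r1 by (simp add: algebra_simps)
    qed (use q(3,4) Mt in \<open>auto simp: distrib_right mult.assoc set_integral_add algebra_simps\<close>)
  qed
qed

section \<open>Weighted integrals over the disk\<close>

lemma mem_disk_iff: "(t, s) \<in> disk \<longleftrightarrow> t\<^sup>2 + s\<^sup>2 \<le> 1"
  by (simp add: disk_def norm_Pair real_sqrt_le_iff')

lemma mem_disk_iff_fibre: "(t, s) \<in> disk \<longleftrightarrow> s \<in> fibre t"
proof -
  have "s \<in> fibre t \<longleftrightarrow> sqrt (s\<^sup>2) \<le> sqrt (1 - t\<^sup>2)" by auto
  then show ?thesis unfolding mem_disk_iff real_sqrt_le_iff by auto
qed

lemma mem_disk_abs_le: "(t, s) \<in> disk \<Longrightarrow> \<bar>t\<bar> \<le> 1"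
  using abs_square_le_1[of t] zero_le_power2[of s] unfolding mem_disk_iff by linarith

lemma disk_weight_Pair: "disk_weight \<mu> (t, s) = (1 - s\<^sup>2 - t\<^sup>2) powr (\<mu> - 1/2)"
  by (simp add: disk_weight_def algebra_simps)

lemma disk_weight_measurable: "disk_weight \<mu> \<in> borel_measurable borel"
proof -
  have "(\<lambda>z::real \<times> real. 1 - (fst z)\<^sup>2 - (snd z)\<^sup>2) \<in> borel_measurable borel"
    by (intro borel_measurable_continuous_onI continuous_intros)
  then show ?thesis
    unfolding disk_weight_def split_beta by measurable
qed

lemma disk_measurable: "disk \<in> sets borel" "disk \<in> sets lebesgue"
  by (auto simp: disk_def)

text \<open>By iterated integration this product is the mass of the weight over the disk, the
  reciprocal of \<open>norm_const\<close>. Two quotients of Gamma values collapse by Legendre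
  duplication at \<mu> + 1/2.\<close>

lemma beta_product:
  assumes "\<mu> \<ge> 0"
  shows "jacobi_int (\<mu> - 1/2) (\<mu> - 1/2) 1 * jacobi_int \<mu> \<mu> 1 = pi / (\<mu> + 1/2)"
proof -
  have G: "Gamma (\<mu> + 1/2) > 0" "Gamma (\<mu> + 1) > 0" "Gamma (2 * \<mu> + 1) > 0"
    using assms by (auto intro!: Gamma_real_pos)
  have d: "Gamma (\<mu> + 1/2) * Gamma (\<mu> + 1) = 2 powr (- (2 * \<mu>)) * sqrt pi * Gamma (2 * \<mu> + 1)"
  proof -
    \<comment> \<open>The duplication formula is applied to complex arguments and read back through
      the embedding of the reals.\<close>
    let ?x = "\<mu> + 1/2" and ?c = complex_of_real
    have e: "?c ?x + 1/2 = ?c (\<mu> + 1)" "2 * ?c ?x = ?c (2 * \<mu> + 1)" "(1 - ?c (2 * \<mu> + 1)) * ?c (ln 2) = ?c (- (2 * \<mu>) * ln 2)"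
      by simp_all
    have "?c ?x \<notin> \<int>\<^sub>\<le>\<^sub>0" "?c ?x + 1/2 \<notin> \<int>\<^sub>\<le>\<^sub>0"
      unfolding e of_real_in_nonpos_Ints_iff using assms by (auto simp: nonpos_Ints_def)
    from Gamma_legendre_duplication[OF this]
    have "?c (Gamma ?x * Gamma (\<mu> + 1)) = ?c (exp (- (2 * \<mu>) * ln 2) * sqrt pi * Gamma (2 * \<mu> + 1))"
      unfolding e Gamma_complex_of_real exp_of_real unfolding of_real_mult .
    then show ?thesis
      unfolding of_real_eq_iff by (simp add: powr_def)
  qed
  have "Gamma (2 * \<mu> + 1 + 1) = (2 * \<mu> + 1) * Gamma (2 * \<mu> + 1)"
    using assms by (intro Gamma_plus1) (auto simp: nonpos_Ints_def)
  then have "Gamma (2 * \<mu> + 2) = (2 * \<mu> + 1) * Gamma (2 * \<mu> + 1)" by (simp add: add.commute)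
  moreover have "jacobi_int (\<mu> - 1/2) (\<mu> - 1/2) 1 = 2 powr (2 * \<mu>) * (Gamma (\<mu> + 1/2) * Gamma (\<mu> + 1/2) / Gamma (2 * \<mu> + 1))"
    using assms by (subst jacobi_int_1) (auto simp: Beta_def algebra_simps)
  moreover have "jacobi_int \<mu> \<mu> 1 = 2 powr (2 * \<mu> + 1) * (Gamma (\<mu> + 1) * Gamma (\<mu> + 1) / Gamma (2 * \<mu> + 2))"
    using assms by (subst jacobi_int_1) (auto simp: Beta_def algebra_simps)
  ultimately have "jacobi_int (\<mu> - 1/2) (\<mu> - 1/2) 1 * jacobi_int \<mu> \<mu> 1 =
     2 powr (2 * \<mu>) * 2 powr (2 * \<mu> + 1) * (Gamma (\<mu> + 1/2) * Gamma (\<mu> + 1))\<^sup>2 / ((2 * \<mu> + 1) * (Gamma (2 * \<mu> + 1))\<^sup>2)"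
    by (simp add: power2_eq_square mult_ac)
  also have "\<dots> = (2 powr (2 * \<mu>) * 2 powr (2 * \<mu> + 1) * (2 powr (- (2 * \<mu>)))\<^sup>2) * pi / (2 * \<mu> + 1)"
    using G unfolding d by (simp add: power_mult_distrib)
  also have "2 powr (2 * \<mu>) * 2 powr (2 * \<mu> + 1) * (2 powr (- (2 * \<mu>)))\<^sup>2 = (2::real)"
    by (simp add: power2_eq_square powr_add[symmetric])
  finally show ?thesis using assms by (simp add: field_simps)
qed

text \<open>Integrability is part of the claim, so the iterated integral is first taken as a
  nonnegative extended integral, which is finite and then gives both parts.\<close>

lemma disk_weight_integral:
  assumes mu: "\<mu> \<ge> 0"
  shows "set_integrable lebesgue disk (disk_weight \<mu>)"
    and "(LINT z:disk|lebesgue. disk_weight \<mu> z) = pi / (\<mu> + 1/2)"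
proof -
  let ?b = "jacobi_int (\<mu> - 1/2) (\<mu> - 1/2) 1"
  let ?H = "\<lambda>z. indicator disk z * disk_weight \<mu> z"
  have b: "?b > 0" using mu by (intro jacobi_int_1_pos) auto
  have m[measurable]: "?H \<in> borel_measurable borel"
    using disk_measurable disk_weight_measurable by measurable
  have inner: "(\<integral>\<^sup>+s. ennreal (?H (t, s)) \<partial>lborel) = ennreal (?b * (indicator {-1..1} t * jacobi_weight \<mu> \<mu> t))" for t
  proof (cases "\<bar>t\<bar> < 1")
    case True
    define c where "c = sqrt (1 - t\<^sup>2)"
    have "1 - t\<^sup>2 > 0" using True by (simp add: abs_square_less_1)
    then have c: "c > 0" "c\<^sup>2 = 1 - t\<^sup>2" by (auto simp: c_def)
    \<comment> \<open>For the constant 1 the degree bound is 0, so \<open>q\<close> is constant and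
      equals its value at 1.\<close>
    obtain q where deg: "degree q \<le> 0" and q1: "poly q 1 = ?b * 1" and
      
      "\<forall>t. \<bar>t\<bar> < 1 \<longrightarrow> set_integrable lebesgue (fibre t) (\<lambda>s. 1 * (1 - s\<^sup>2 - t\<^sup>2) powr (\<mu> - 1/2)) \<and>
       (LINT s:fibre t|lebesgue. 1 * (1 - s\<^sup>2 - t\<^sup>2) powr (\<mu> - 1/2)) = (1 - t\<^sup>2) powr \<mu> * poly q t"
      using fibre_integral_poly2[OF mu poly2_const[of 1 0]] by blast
    note q = this(3)[rule_format, OF True]
    have "poly q t = ?b" using deg q1 by (auto elim: degree_eq_zeroE)
    have e: "indicator (fibre t) s *\<^sub>R (1 * (1 - s\<^sup>2 - t\<^sup>2) powr (\<mu> - 1/2)) = ?H (t, s)" for s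
      using True by (auto simp: indicator_def mem_disk_iff_fibre disk_weight_Pair)
    have i: "integrable lebesgue (\<lambda>s. ?H (t, s))"
      using q unfolding set_integrable_def e by simp
    have "(LINT s|lebesgue. ?H (t, s)) = (1 - t\<^sup>2) powr \<mu> * ?b"
      using q \<open>poly q t = ?b\<close> unfolding set_lebesgue_integral_def e by simp
    moreover have "(1 - t\<^sup>2) powr \<mu> = jacobi_weight \<mu> \<mu> t"
    proof -
      have "1 - t\<^sup>2 = (1 - t) * (1 + t)" by (simp add: power2_eq_square algebra_simps)
      then show ?thesis using True by (simp add: jacobi_weight_def powr_mult)
    qed
    moreover have "(\<integral>\<^sup>+s. ennreal (?H (t, s)) \<partial>lebesgue) = ennreal (LINT s|lebesgue. ?H (t, s))"
      using i by (intro nn_integral_eq_integral) (auto simp: disk_weight_Pair)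
    ultimately show ?thesis
      using True by (simp add: nn_integral_completion mult.commute indicator_def abs_less_iff)
  next
    case False
    \<comment> \<open>For |t| > 1 the chord is empty. For |t| = 1 it is the single point s = 0,
      where the weight has the default value \<open>0 powr a = 0\<close>; the Jacobi weight vanishes
      there for the same reason, even if \<mu> = 0.\<close>
    have h0: "?H (t, s) = 0" for s
    proof (cases "(t, s) \<in> disk")
      case True
      then have "\<bar>t\<bar> = 1" using False mem_disk_abs_le by force
      then have "t\<^sup>2 = 1" by (simp add: abs_square_eq_1)
      then have "s\<^sup>2 = 0" using True by (simp add: mem_disk_iff) 
      then show ?thesis using \<open>t\<^sup>2 = 1\<close> by (simp add: disk_weight_Pair)
    qed simp
    have j0: "indicator {-1..1} t * jacobi_weight \<mu> \<mu> t = 0"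
      using False by (auto simp: indicator_def jacobi_weight_def)
    show ?thesis unfolding h0 j0 by simp
  qed
  have J: "set_integrable lebesgue {-1..1} (jacobi_weight \<mu> \<mu>)"
    using mu by (intro jacobi_weight_integral) auto
  have "(\<integral>\<^sup>+z. ennreal (?H z) \<partial>lborel) = (\<integral>\<^sup>+t. \<integral>\<^sup>+s. ennreal (?H (t, s)) \<partial>lborel \<partial>lborel)"
    using lborel.nn_integral_fst[of "\<lambda>z. ennreal (?H z)" lborel] m
    by (simp add: lborel_prod)
  also have "\<dots> = (\<integral>\<^sup>+t. ennreal (?b * (indicator {-1..1} t * jacobi_weight \<mu> \<mu> t)) \<partial>lebesgue)"
    unfolding inner by (simp add: nn_integral_completion)
  also have "\<dots> = ennreal (LINT t|lebesgue. ?b * (indicator {-1..1} t * jacobi_weight \<mu> \<mu> t))"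
    using J b by (intro nn_integral_eq_integral)
      (auto simp: set_integrable_def jacobi_weight_def)
  also have "(LINT t|lebesgue. ?b * (indicator {-1..1} t * jacobi_weight \<mu> \<mu> t)) = ?b * jacobi_int \<mu> \<mu> 1"
    by (simp add: jacobi_int_def set_lebesgue_integral_def)
  also have "\<dots> = pi / (\<mu> + 1/2)" by (rule beta_product[OF mu])
  finally have N: "(\<integral>\<^sup>+z. ennreal (?H z) \<partial>lborel) = ennreal (pi / (\<mu> + 1/2))" .
  have nn: "?H z \<ge> 0" for z by (cases z) (simp add: disk_weight_Pair)
  have "integrable lborel ?H"
    using N m nn by (intro integrableI_nonneg) auto
  then show "set_integrable lebesgue disk (disk_weight \<mu>)"
    using m by (simp add: set_integrable_def integrable_completion)
  have "integral\<^sup>L lborel ?H = pi / (\<mu> + 1/2)"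
    using N nn m mu by (intro integral_eq_nn_integral[THEN trans]) auto
  then show "(LINT z:disk|lebesgue. disk_weight \<mu> z) = pi / (\<mu> + 1/2)"
    using m by (simp add: set_lebesgue_integral_def integral_completion)
qed

lemma set_integrable_weight_mult:
  assumes "set_integrable lebesgue disk (\<lambda>z. f z * disk_weight \<mu> z)" "continuous_on disk P"
  shows "set_integrable lebesgue disk (\<lambda>z. f z * P z * disk_weight \<mu> z)"
proof -
  have "set_integrable lebesgue disk (\<lambda>z. P z * (f z * disk_weight \<mu> z))"
  proof (rule absolutely_integrable_bounded_measurable_product[OF bilinear_times])
    show "bounded (P ` disk)"
      using assms(2) by (intro compact_imp_bounded compact_continuous_image) (auto simp: disk_def)
    show "P \<in> borel_measurable (lebesgue_on disk)"
      using assms(2) disk_measurable by (intro continuous_imp_measurable_on_sets_lebesgue)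
  qed (use assms(1) disk_measurable in auto)
  then show ?thesis by (simp add: mult_ac)
qed

lemma set_integrable_weight_continuous:
  assumes "\<mu> \<ge> 0" "continuous_on disk P"
  shows "set_integrable lebesgue disk (\<lambda>z. P z * disk_weight \<mu> z)"
  using set_integrable_weight_mult[of "\<lambda>_. 1" \<mu> P] disk_weight_integral(1)[OF assms(1)] assms by simp

lemma rot_mem_disk_iff: "rot \<theta> z \<in> disk \<longleftrightarrow> z \<in> disk"
  and disk_weight_rot: "disk_weight \<mu> (rot \<theta> z) = disk_weight \<mu> z"
proof -
  obtain t s where z: "z = (t, s)" by (cases z)
  have "(t * cos \<theta> - s * sin \<theta>)\<^sup>2 + (t * sin \<theta> + s * cos \<theta>)\<^sup>2 = (t\<^sup>2 + s\<^sup>2) * ((sin \<theta>)\<^sup>2 + (cos \<theta>)\<^sup>2)"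
    by algebra
  then have *: "(t * cos \<theta> - s * sin \<theta>)\<^sup>2 + (t * sin \<theta> + s * cos \<theta>)\<^sup>2 = t\<^sup>2 + s\<^sup>2"
    by simp
  then show "rot \<theta> z \<in> disk \<longleftrightarrow> z \<in> disk"
    by (simp add: z rot_def mem_disk_iff)
  have "1 - (t * cos \<theta> - s * sin \<theta>)\<^sup>2 - (t * sin \<theta> + s * cos \<theta>)\<^sup>2 = 1 - t\<^sup>2 - s\<^sup>2"
    using * by linarith
  then show "disk_weight \<mu> (rot \<theta> z) = disk_weight \<mu> z"
    by (simp only: z rot_def disk_weight_def prod.case)
qed

lemma disk_integral_rot:
  assumes "set_integrable lebesgue disk (\<lambda>z. F z * disk_weight \<mu> z)"
  shows "(LINT z:disk|lebesgue. F (rot \<theta> z) * disk_weight \<mu> z) = (LINT z:disk|lebesgue. F z * disk_weight \<mu> z)"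
  using lebesgue_rot(2)[OF assms[unfolded set_integrable_def], of \<theta>]
  by (simp add: set_lebesgue_integral_def rot_mem_disk_iff disk_weight_rot indicator_def)

text \<open>After rotation by \<theta> the ridge variable is the first coordinate t, so
  \<open>poly g t\<close> leaves the inner integral. The inner identity holds at every t, also where
  the Radon integral does not exist, since both sides then take the default 0 of the
  integral.\<close>

lemma radon_Fubini:
  assumes mu: "\<mu> \<ge> 0" and f: "set_integrable lebesgue disk (\<lambda>z. f z * disk_weight \<mu> z)"
  shows "set_integrable lebesgue {-1..1} (\<lambda>t. radon \<mu> \<theta> f t * poly g t)"
    and "(LINT z:disk|lebesgue. f z * poly g (fst z * cos \<theta> + snd z * sin \<theta>) * disk_weight \<mu> z) =
         (LINT t:{-1..1}|lebesgue. radon \<mu> \<theta> f t * poly g t)"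
proof -
  let ?H = "\<lambda>z. indicator disk z *\<^sub>R (f z * poly g (fst z * cos \<theta> + snd z * sin \<theta>) * disk_weight \<mu> z)"
  have H: "integrable lebesgue ?H"
    using set_integrable_weight_mult[OF f, of "\<lambda>z. poly g (fst z * cos \<theta> + snd z * sin \<theta>)"]
    by (simp add: set_integrable_def continuous_intros)
  have inner: "(LINT s|lebesgue. ?H (rot \<theta> (t, s))) = indicator {-1..1} t *\<^sub>R (radon \<mu> \<theta> f t * poly g t)" for t
  proof (cases "\<bar>t\<bar> \<le> 1")
    case True
    have "?H (rot \<theta> (t, s)) = poly g t *
        (indicator (fibre t) s *\<^sub>R (f (t * cos \<theta> - s * sin \<theta>, t * sin \<theta> + s * cos \<theta>) * (1 - s\<^sup>2 - t\<^sup>2) powr (\<mu> - 1/2)))" for s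
    proof -
      have "(t * cos \<theta> - s * sin \<theta>) * cos \<theta> + (t * sin \<theta> + s * cos \<theta>) * sin \<theta> = t * ((sin \<theta>)\<^sup>2 + (cos \<theta>)\<^sup>2)"
        by algebra
      then have "fst (rot \<theta> (t, s)) * cos \<theta> + snd (rot \<theta> (t, s)) * sin \<theta> = t"
        by (simp add: rot_def)
      then show ?thesis
        unfolding disk_weight_rot disk_weight_Pair
        by (simp add: indicator_def rot_mem_disk_iff mem_disk_iff_fibre) (simp add: rot_def)
    qed
    then have "(LINT s|lebesgue. ?H (rot \<theta> (t, s))) = poly g t * radon \<mu> \<theta> f t"
      by (simp add: radon_def set_lebesgue_integral_def)
    then show ?thesis using True by (simp add: indicator_def abs_le_iff)
  next
    case False
    then have h0: "?H (rot \<theta> (t, s)) = 0" for s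
      using mem_disk_abs_le[of t s] by (auto simp: indicator_def rot_mem_disk_iff)
    show ?thesis unfolding h0 using False by (auto simp: indicator_def)
  qed
  note R = lebesgue_rot[OF H, of \<theta>]
  show "set_integrable lebesgue {-1..1} (\<lambda>t. radon \<mu> \<theta> f t * poly g t)"
    using lebesgue_Fubini(2)[OF R(1)] unfolding inner set_integrable_def .
  show "(LINT z:disk|lebesgue. f z * poly g (fst z * cos \<theta> + snd z * sin \<theta>) * disk_weight \<mu> z) =
         (LINT t:{-1..1}|lebesgue. radon \<mu> \<theta> f t * poly g t)"
    using lebesgue_Fubini(1)[OF R(1)] R(2) unfolding inner set_lebesgue_integral_def by simp
qed

text \<open>The weight has finite mass and |f| <= f^2 + 1.\<close>

lemma L2_disk_integrable:
  assumes mu: "\<mu> \<ge> 0" and f: "f \<in> L2_disk \<mu>"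
  shows "set_integrable lebesgue disk (\<lambda>z. f z * disk_weight \<mu> z)"
proof -
  have W: "disk_weight \<mu> z \<ge> 0" for z by (cases z) (simp add: disk_weight_Pair)
  have "set_integrable lebesgue disk (\<lambda>z. (f z)\<^sup>2 * disk_weight \<mu> z + disk_weight \<mu> z)"
    using f disk_weight_integral(1)[OF mu] by (intro set_integral_add) (auto simp: L2_disk_def)
  then show ?thesis
    unfolding set_integrable_def
  proof (rule Bochner_Integration.integrable_bound)
    have "(\<lambda>z. indicator disk z *\<^sub>R f z) \<in> borel_measurable lebesgue"
      using f by (simp add: L2_disk_def set_borel_measurable_def)
    moreover have "disk_weight \<mu> \<in> borel_measurable lebesgue"
      using disk_weight_measurable by (intro measurable_completion) simp
    ultimately have "(\<lambda>z. (indicator disk z *\<^sub>R f z) * disk_weight \<mu> z) \<in> borel_measurable lebesgue"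
      by (rule borel_measurable_times)
    then show "(\<lambda>z. indicator disk z *\<^sub>R (f z * disk_weight \<mu> z)) \<in> borel_measurable lebesgue"
      by (simp add: mult.assoc)
    have "\<bar>f z\<bar> * disk_weight \<mu> z \<le> ((f z)\<^sup>2 + 1) * disk_weight \<mu> z" for z
    proof (rule mult_right_mono[OF _ W])
      have "2 * \<bar>f z\<bar> \<le> (f z)\<^sup>2 + 1"
        using zero_le_power2[of "\<bar>f z\<bar> - 1"] by (simp add: power2_diff)
      then show "\<bar>f z\<bar> \<le> (f z)\<^sup>2 + 1" by linarith
    qed
    then show "AE z in lebesgue. norm (indicator disk z *\<^sub>R (f z * disk_weight \<mu> z)) \<le>
        norm (indicator disk z *\<^sub>R ((f z)\<^sup>2 * disk_weight \<mu> z + disk_weight \<mu> z))"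
      using W by (auto simp: indicator_def abs_mult distrib_right)
  qed
qed

text \<open>Expectation under the weight normalised to mass 1. Inner products become values of one
  linear functional at a product of functions.\<close>

definition disk_mean :: "real \<Rightarrow> (real \<times> real \<Rightarrow> real) \<Rightarrow> real" where
  "disk_mean \<mu> P = norm_const \<mu> * (LINT z:disk|lebesgue. P z * disk_weight \<mu> z)"

lemma disk_inner_eq_disk_mean: "disk_inner \<mu> P Q = disk_mean \<mu> (\<lambda>z. P z * Q z)"
  by (simp add: disk_inner_def disk_mean_def)

definition disk_integrable :: "real \<Rightarrow> (real \<times> real \<Rightarrow> real) \<Rightarrow> bool" where
  "disk_integrable \<mu> P \<longleftrightarrow> set_integrable lebesgue disk (\<lambda>z. P z * disk_weight \<mu> z)"

lemma disk_mean_add: "disk_integrable \<mu> P \<Longrightarrow> disk_integrable \<mu> Q \<Longrightarrow> disk_mean \<mu> (\<lambda>z. P z + Q z) = disk_mean \<mu> P + disk_mean \<mu> Q"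
  by (simp add: disk_mean_def disk_integrable_def distrib_left distrib_right)

lemma disk_mean_scale: "disk_mean \<mu> (\<lambda>z. c * P z) = c * disk_mean \<mu> P"
  by (simp add: disk_mean_def mult.assoc)

lemma disk_mean_zero [simp]: "disk_mean \<mu> (\<lambda>z. 0) = 0"
  by (simp add: disk_mean_def)

lemma disk_integrable_zero: "disk_integrable \<mu> (\<lambda>z. 0)"
  by (simp add: disk_integrable_def set_integrable_def)

lemma disk_integrable_add: "disk_integrable \<mu> P \<Longrightarrow> disk_integrable \<mu> Q \<Longrightarrow> disk_integrable \<mu> (\<lambda>z. P z + Q z)"
  by (simp add: disk_integrable_def distrib_right)

lemma disk_integrable_scale: "disk_integrable \<mu> P \<Longrightarrow> disk_integrable \<mu> (\<lambda>z. c * P z)"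
  by (simp add: disk_integrable_def mult.assoc)

lemma disk_integrable_sum: "(\<And>i. i \<in> A \<Longrightarrow> disk_integrable \<mu> (g i)) \<Longrightarrow> disk_integrable \<mu> (\<lambda>z. \<Sum>i\<in>A. g i z)"
  by (induction A rule: infinite_finite_induct) (auto intro: disk_integrable_zero disk_integrable_add)

lemma disk_mean_sum:
  "(\<And>i. i \<in> A \<Longrightarrow> disk_integrable \<mu> (g i)) \<Longrightarrow> disk_mean \<mu> (\<lambda>z. \<Sum>i\<in>A. g i z) = (\<Sum>i\<in>A. disk_mean \<mu> (g i))"
  by (induction A rule: infinite_finite_induct) (auto simp: disk_mean_add disk_integrable_sum)

lemma disk_integrable_continuous: "\<mu> \<ge> 0 \<Longrightarrow> continuous_on disk P \<Longrightarrow> disk_integrable \<mu> P"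
  unfolding disk_integrable_def by (rule set_integrable_weight_continuous)

lemma disk_integrable_poly2: "\<mu> \<ge> 0 \<Longrightarrow> P \<in> poly2 d \<Longrightarrow> disk_integrable \<mu> P"
  by (intro disk_integrable_continuous continuous_poly2)

lemma disk_mean_rot: "disk_integrable \<mu> P \<Longrightarrow> disk_mean \<mu> (\<lambda>z. P (rot \<theta> z)) = disk_mean \<mu> P"
  unfolding disk_mean_def disk_integrable_def by (simp add: disk_integral_rot)

text \<open>The powers of a nonconstant linear polynomial span all polynomials, since p is the
  composition of p(L^(-1)) with L for L = [:a, b:].\<close>

lemma poly_induct_linear_power:
  fixes a b :: real
  assumes "b \<noteq> 0"
    and zero: "Q 0" and add: "\<And>p q. Q p \<Longrightarrow> Q q \<Longrightarrow> Q (p + q)" and scale: "\<And>c p. Q p \<Longrightarrow> Q (smult c p)"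
    and power: "\<And>i. Q ([:a, b:] ^ i)"
  shows "Q p"
proof -
  \<comment> \<open>The prefactor generalises the claim: removing the constant coefficient of
    \<open>r\<close> moves one factor L into the power.\<close>
  have "Q ([:a, b:] ^ i * (r \<circ>\<^sub>p [:a, b:]))" for i r
  proof (induction r arbitrary: i)
    case 0
    then show ?case by (simp add: zero)
  next
    case (pCons c r)
    have "Q (smult c ([:a, b:] ^ i) + [:a, b:] ^ Suc i * (r \<circ>\<^sub>p [:a, b:]))"
      by (intro add scale power pCons.IH)
    also have "smult c ([:a, b:] ^ i) + [:a, b:] ^ Suc i * (r \<circ>\<^sub>p [:a, b:]) = [:a, b:] ^ i * (pCons c r \<circ>\<^sub>p [:a, b:])"
      by (simp only: pcompose_pCons) (simp add: algebra_simps)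
    finally show ?case .
  qed
  from this[of 0 "p \<circ>\<^sub>p [:- a / b, 1 / b:]"]
  have "Q ((p \<circ>\<^sub>p [:- a / b, 1 / b:]) \<circ>\<^sub>p [:a, b:])" by simp
  also have "(p \<circ>\<^sub>p [:- a / b, 1 / b:]) \<circ>\<^sub>p [:a, b:] = p"
    using assms(1) by (subst poly_eq_poly_eq_iff[symmetric]) (simp add: fun_eq_iff poly_pcompose field_simps)
  finally show ?thesis .
qed

definition sqnorm :: "real \<times> real \<Rightarrow> real" where
  "sqnorm z = (fst z)\<^sup>2 + (snd z)\<^sup>2"

lemma continuous_on_sqnorm [continuous_intros]: "continuous_on A sqnorm"
  unfolding sqnorm_def by (intro continuous_intros)

text \<open>The map t = 2 r^2 - 1 carries the disk weight to a multiple of the Jacobi weight with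
  parameters \<mu> - 1/2 and 0. The constant is the reciprocal of the mass of the latter, so both
  sides are 1 at u = 1. Powers of 1 - t = 2 (1 - r^2) are the test functions because they only raise
  \<mu>.\<close>

lemma disk_mean_radial:
  assumes mu: "\<mu> \<ge> 0"
  shows "disk_mean \<mu> (\<lambda>z. poly u (2 * sqnorm z - 1)) = (\<mu> + 1/2) / 2 powr (\<mu> + 1/2) * jacobi_int (\<mu> - 1/2) 0 u"
proof -
  have ab: "\<mu> - 1/2 > -1" "(0::real) > -1" using mu by auto
  have di: "disk_integrable \<mu> (\<lambda>z. poly u (2 * sqnorm z - 1))" for u
    using mu by (intro disk_integrable_continuous continuous_intros)
  show ?thesis
  proof (rule poly_induct_linear_power[of "-1" _ 1])
    fix i
    have "(LINT z:disk|lebesgue. poly ([:1, -1:] ^ i) (2 * sqnorm z - 1) * disk_weight \<mu> z) =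
        (LINT z:disk|lebesgue. 2 ^ i * disk_weight (\<mu> + i) z)"
    proof (intro set_lebesgue_integral_cong ballI allI impI)
      fix z assume z: "z \<in> disk"
      obtain t s where ts: "z = (t, s)" by (cases z)
      have n: "1 - t\<^sup>2 - s\<^sup>2 \<ge> 0" using z by (simp add: ts mem_disk_iff)
      have "(1 - t\<^sup>2 - s\<^sup>2) ^ i * (1 - t\<^sup>2 - s\<^sup>2) powr (\<mu> - 1/2) = (1 - t\<^sup>2 - s\<^sup>2) powr (\<mu> + i - 1/2)"
        using n powr_add[of "1 - t\<^sup>2 - s\<^sup>2" "\<mu> - 1/2" i]
        by (cases "1 - t\<^sup>2 - s\<^sup>2 = 0") (auto simp: powr_realpow diff_add_eq mult.commute)
      moreover have "poly [:1, -1:] (2 * sqnorm z - 1) = 2 * (1 - t\<^sup>2 - s\<^sup>2)"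
        by (simp add: ts sqnorm_def algebra_simps)
      then have "poly ([:1, -1:] ^ i) (2 * sqnorm z - 1) = 2 ^ i * (1 - t\<^sup>2 - s\<^sup>2) ^ i"
        by (simp only: poly_power power_mult_distrib)
      ultimately show "poly ([:1, -1:] ^ i) (2 * sqnorm z - 1) * disk_weight \<mu> z = 2 ^ i * disk_weight (\<mu> + i) z"
        by (simp only: ts disk_weight_def prod.case mult.assoc)
    qed (rule disk_measurable)
    also have "\<dots> = 2 ^ i * (pi / (\<mu> + i + 1/2))"
      using disk_weight_integral(2)[of "\<mu> + i"] mu by simp
    finally have L: "disk_mean \<mu> (\<lambda>z. poly ([:1, -1:] ^ i) (2 * sqnorm z - 1)) = (\<mu> + 1/2) * 2 ^ i / (\<mu> + i + 1/2)"
      using mu by (simp add: disk_mean_def norm_const_def)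
    have "Beta (\<mu> + i + 1/2) 1 = 1 / (\<mu> + i + 1/2)"
      using mu by (intro Beta_1_right) simp
    moreover have "jacobi_int (\<mu> - 1/2) 0 ([:1, -1:] ^ i) = 2 powr (\<mu> + 1/2 + real i) * Beta (\<mu> + i + 1/2) 1"
      using jacobi_int_moment[OF ab, of i 0] by (simp add: add_ac)
    moreover have "2 powr (\<mu> + 1/2 + real i) = 2 powr (\<mu> + 1/2) * 2 ^ i"
      by (simp add: powr_add powr_realpow)
    ultimately have "jacobi_int (\<mu> - 1/2) 0 ([:1, -1:] ^ i) = 2 powr (\<mu> + 1/2) * 2 ^ i / (\<mu> + i + 1/2)"
      by simp
    then show "disk_mean \<mu> (\<lambda>z. poly ([:1, -1:] ^ i) (2 * sqnorm z - 1)) =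
        (\<mu> + 1/2) / 2 powr (\<mu> + 1/2) * jacobi_int (\<mu> - 1/2) 0 ([:1, -1:] ^ i)"
      unfolding L by simp
  qed (simp_all add: jacobi_int_0[OF ab] jacobi_int_add[OF ab] jacobi_int_smult[OF ab] disk_mean_add[OF di di] disk_mean_scale distrib_left)
qed

section \<open>The orthonormal basis\<close>

definition complex_of_pair :: "real \<times> real \<Rightarrow> complex" where
  "complex_of_pair z = Complex (fst z) (snd z)"

text \<open>The functions r^j cos(j \<phi>) and r^j sin(j \<phi>) as parts of (x + iy)^j: visibly
  polynomial, and a rotation multiplies the complex power by a phase.\<close>

definition solid_solid_harm :: "nat \<Rightarrow> nat \<Rightarrow> real \<times> real \<Rightarrow> real" where
  "solid_solid_harm j e z = (if e = 0 then Re (complex_of_pair z ^ j) else Im (complex_of_pair z ^ j))"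

lemma Re_complex_of_pair [simp]: "Re (complex_of_pair z) = fst z" and Im_complex_of_pair [simp]: "Im (complex_of_pair z) = snd z"
  by (simp_all add: complex_of_pair_def)

lemma complex_of_pair_mult_cnj: "complex_of_pair z * cnj (complex_of_pair z) = of_real (sqnorm z)"
  by (simp add: complex_mult_cnj sqnorm_def)

lemma complex_of_pair_rot: "complex_of_pair (rot \<theta> z) = cis \<theta> * complex_of_pair z"
  by (simp add: complex_eq_iff rot_def split_beta mult.commute)

text \<open>De Moivre removes the angle. The origin needs no exception, since the polar form with
  modulus 0 holds for every argument.\<close>

lemma basis_poly_eq:
  "basis_poly \<mu> k l e = (\<lambda>z. h_coeff \<mu> l k * poly (jacobi (\<mu> - 1/2) (real (k - 2 * l)) l) (2 * sqnorm z - 1) * solid_solid_harm (k - 2 * l) e z)"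
proof
  fix z
  let ?j = "k - 2 * l"
  let ?r = "sqrt (sqnorm z)" and ?\<phi> = "Arg (complex_of_pair z)"
  have "cmod (complex_of_pair z) = ?r" by (simp add: cmod_def sqnorm_def)
  then have "complex_of_pair z = rcis ?r ?\<phi>" by (metis rcis_cmod_Arg)
  then have "complex_of_pair z ^ ?j = rcis (?r ^ ?j) (?j * ?\<phi>)"
    by (metis DeMoivre2)
  then have "?r ^ ?j * sph ?j e ?\<phi> = solid_solid_harm ?j e z"
    by (simp add: solid_solid_harm_def sph_def)
  then show "basis_poly \<mu> k l e z = h_coeff \<mu> l k * poly (jacobi (\<mu> - 1/2) (real (k - 2 * l)) l) (2 * sqnorm z - 1) * solid_solid_harm (k - 2 * l) e z"
    by (simp add: basis_poly_def split_beta complex_of_pair_def sqnorm_def Let_def mult.assoc)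
qed

lemma poly2_solid_harm: "solid_solid_harm j e \<in> poly2 j"
proof -
  have "(\<lambda>z. Re (complex_of_pair z ^ j)) \<in> poly2 j \<and> (\<lambda>z. Im (complex_of_pair z ^ j)) \<in> poly2 j"
  proof (induction j)
    case 0
    then show ?case by (simp add: poly2_const)
  next
    case (Suc j)
    then show ?case
      using poly2_mult[OF poly2_fst, of _ j] poly2_mult[OF poly2_snd, of _ j]
      by (auto intro!: poly2_add poly2_diff)
  qed
  then show ?thesis by (cases "e = 0") (simp_all add: solid_solid_harm_def[abs_def])
qed

lemma poly2_sqnorm: "sqnorm \<in> poly2 2"
  using poly2_power[OF poly2_fst, of 2] poly2_power[OF poly2_snd, of 2]
  unfolding sqnorm_def by (intro poly2_add) simp_all

lemma poly2_radial: "(\<lambda>z. poly u (2 * sqnorm z - 1)) \<in> poly2 (2 * degree u)"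
proof (rule poly2_poly[of _ 2])
  show "(\<lambda>z. 2 * sqnorm z - 1) \<in> poly2 2"
    using poly2_sqnorm by (intro poly2_diff poly2_scale poly2_const)
qed simp

lemma poly2_basis_poly:
  assumes "\<mu> \<ge> 0" "(l, e) \<in> basis_index k"
  shows "basis_poly \<mu> k l e \<in> poly2 k"
proof -
  have ab: "\<mu> - 1/2 > -1" "real (k - 2 * l) > -1" using assms by auto
  have "degree (jacobi (\<mu> - 1/2) (real (k - 2 * l)) l) \<le> l"
    unfolding jacobi_eq[OF ab] using degree_smult_le degree_jacobi_unit_le order_trans by blast
  then have "(\<lambda>z. poly (jacobi (\<mu> - 1/2) (real (k - 2 * l)) l) (2 * sqnorm z - 1)) \<in> poly2 (2 * l)"
    by (intro poly2_mono[OF poly2_radial]) simp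
  then have "(\<lambda>z. poly (jacobi (\<mu> - 1/2) (real (k - 2 * l)) l) (2 * sqnorm z - 1) * solid_solid_harm (k - 2 * l) e z) \<in> poly2 (2 * l + (k - 2 * l))"
    by (intro poly2_mult poly2_solid_harm)
  moreover have "2 * l + (k - 2 * l) = k" using assms(2) by (auto simp: basis_index_def)
  ultimately show ?thesis
    using poly2_scale[of _ k "h_coeff \<mu> l k"] by (simp add: basis_poly_eq mult.assoc)
qed

text \<open>Rotating by \<open>\<pi> / n\<close> flips the sign of a function of angular frequency \<open>n\<close>.\<close>

lemma disk_mean_angular_zero:
  fixes n :: real
  assumes mu: "\<mu> \<ge> 0" and n: "n \<noteq> 0"
    and G: "\<And>\<theta> z. G (rot \<theta> z) = cis (n * \<theta>) * G z" and cont: "continuous_on UNIV G"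
  shows "disk_mean \<mu> (\<lambda>z. poly u (2 * sqnorm z - 1) * Re (G z)) = 0"
    and "disk_mean \<mu> (\<lambda>z. poly u (2 * sqnorm z - 1) * Im (G z)) = 0"
proof -
  have sq: "sqnorm (rot \<theta> z) = sqnorm z" for \<theta> z
  proof -
    have "complex_of_real (sqnorm (rot \<theta> z)) = of_real (sqnorm z)"
      using complex_mult_cnj[of "cis \<theta>"] by (simp only: complex_of_pair_mult_cnj[symmetric] complex_of_pair_rot) (simp add: mult_ac)
    then show ?thesis by (simp only: of_real_eq_iff)
  qed
  have neg: "G (rot (pi / n) z) = - G z" for z
    using n by (simp add: G)
  have c: "continuous_on disk (\<lambda>z. poly u (2 * sqnorm z - 1) * Re (G z))"
     "continuous_on disk (\<lambda>z. poly u (2 * sqnorm z - 1) * Im (G z))"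
    using continuous_on_subset[OF cont, of disk] by (auto intro!: continuous_intros)
  have zero: "disk_mean \<mu> F = 0" if "continuous_on disk F" "\<And>z. F (rot (pi / n) z) = - F z" for F
    using disk_mean_rot[OF disk_integrable_continuous[OF mu that(1)], of "pi / n"] disk_mean_scale[of \<mu> "-1" F] that(2) by simp
  show "disk_mean \<mu> (\<lambda>z. poly u (2 * sqnorm z - 1) * Re (G z)) = 0"
    by (intro zero c) (simp only: sq neg, simp)
  show "disk_mean \<mu> (\<lambda>z. poly u (2 * sqnorm z - 1) * Im (G z)) = 0"
    by (intro zero c) (simp only: sq neg, simp)
qed

text \<open>With w = x + iy the product of two harmonics combines w^j w^j' and w^j times the
  conjugate of w^j', of angular frequencies j + j' and j - j'. Nonzero frequencies have mean 0. For
  j = j' the second product is r^(2j), which is real.\<close>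

lemma disk_mean_solid_harm_mult:
  assumes mu: "\<mu> \<ge> 0" and e: "e \<in> {0, 1}" "e' \<in> {0, 1}" "e \<le> j" "e' \<le> j'"
  shows "disk_mean \<mu> (\<lambda>z. poly u (2 * sqnorm z - 1) * (solid_solid_harm j e z * solid_solid_harm j' e' z)) =
    (if j = j' \<and> e = e' then (if j = 0 then 1 else 1/2) * disk_mean \<mu> (\<lambda>z. poly u (2 * sqnorm z - 1) * sqnorm z ^ j) else 0)"
proof -
  define A where "A = (\<lambda>z. complex_of_pair z ^ j * complex_of_pair z ^ j')"
  define B where "B = (\<lambda>z. complex_of_pair z ^ j * cnj (complex_of_pair z) ^ j')"
  let ?u = "\<lambda>z. poly u (2 * sqnorm z - 1)"
  have cc: "continuous_on UNIV complex_of_pair"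
    unfolding complex_of_pair_def Complex_eq by (intro continuous_intros)
  have cA: "continuous_on UNIV A" and cB: "continuous_on UNIV B"
    unfolding A_def B_def using cc by (auto intro!: continuous_intros)
  have rA: "A (rot \<theta> z) = cis (real (j + j') * \<theta>) * A z" for \<theta> z
  proof -
    have "cis (real (j + j') * \<theta>) = cis \<theta> ^ j * cis \<theta> ^ j'"
      by (simp only: of_nat_add distrib_right cis_mult[symmetric] Complex.DeMoivre)
    then show ?thesis by (simp add: A_def complex_of_pair_rot power_mult_distrib mult_ac)
  qed
  have rB: "B (rot \<theta> z) = cis ((real j - real j') * \<theta>) * B z" for \<theta> z
  proof -
    have "(real j - real j') * \<theta> = real j * \<theta> + real j' * (- \<theta>)"
      by (simp add: algebra_simps)
    then have "cis ((real j - real j') * \<theta>) = cis \<theta> ^ j * cis (- \<theta>) ^ j'"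
      by (simp only: cis_mult[symmetric] Complex.DeMoivre)
    then show ?thesis by (simp add: B_def complex_of_pair_rot power_mult_distrib cis_cnj mult_ac)
  qed
  have iA: "disk_integrable \<mu> (\<lambda>z. ?u z * Re (A z))" "disk_integrable \<mu> (\<lambda>z. ?u z * Im (A z))"
    and iB: "disk_integrable \<mu> (\<lambda>z. ?u z * Re (B z))" "disk_integrable \<mu> (\<lambda>z. ?u z * Im (B z))"
    using continuous_on_subset[OF cA, of disk] continuous_on_subset[OF cB, of disk]
    by (auto intro!: disk_integrable_continuous[OF mu] continuous_intros)
  \<comment> \<open>\<open>s\<close> and \<open>s'\<close> are the signs in 2 Re a Re b = Re ab + Re
    ab', 2 Im a Im b = Re ab' - Re ab, 2 Re a Im b = Im ab - Im ab' and 2 Im a Re b = Im ab + Im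
    ab', where b' is the conjugate of b.\<close>
  define s where "s = (if e = 0 then 1 else if e' = 0 then 1 else -1 :: real)"
  define s' where "s' = (if e = 0 then if e' = 0 then 1 else -1 else 1 :: real)"
  define A' where "A' = (\<lambda>z. if e = e' then Re (A z) else Im (A z))"
  define B' where "B' = (\<lambda>z. if e = e' then Re (B z) else Im (B z))"
  have "solid_solid_harm j e z * solid_solid_harm j' e' z = (s/2) * A' z + (s'/2) * B' z" for z
    using e by (auto simp: solid_solid_harm_def A_def B_def A'_def B'_def s_def s'_def complex_cnj_power[symmetric] simp del: complex_cnj_power)
      (simp_all add: field_simps)
  then have "disk_mean \<mu> (\<lambda>z. ?u z * (solid_solid_harm j e z * solid_solid_harm j' e' z)) =
      disk_mean \<mu> (\<lambda>z. (s/2) * (?u z * A' z) + (s'/2) * (?u z * B' z))"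
    by (simp add: algebra_simps)
  also have "\<dots> = (s/2) * disk_mean \<mu> (\<lambda>z. ?u z * A' z) + (s'/2) * disk_mean \<mu> (\<lambda>z. ?u z * B' z)"
  proof -
    have "disk_integrable \<mu> (\<lambda>z. ?u z * A' z)" "disk_integrable \<mu> (\<lambda>z. ?u z * B' z)"
      using iA iB unfolding A'_def B'_def by (cases "e = e'"; simp)+
    then show ?thesis by (simp only: disk_mean_add disk_mean_scale disk_integrable_scale)
  qed
  finally have main: "disk_mean \<mu> (\<lambda>z. ?u z * (solid_solid_harm j e z * solid_solid_harm j' e' z)) =
      (s/2) * disk_mean \<mu> (\<lambda>z. ?u z * A' z) + (s'/2) * disk_mean \<mu> (\<lambda>z. ?u z * B' z)" .
  have A0: "disk_mean \<mu> (\<lambda>z. ?u z * A' z) = 0" if "j + j' \<noteq> 0"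
    using disk_mean_angular_zero[OF mu _ rA cA, of u] that unfolding A'_def by (cases "e = e'"; auto)
  have B0: "disk_mean \<mu> (\<lambda>z. ?u z * B' z) = 0" if "j \<noteq> j'"
    using disk_mean_angular_zero[OF mu _ rB cB, of u] that unfolding B'_def by (cases "e = e'"; auto)
  show ?thesis
  proof (cases "j = j'")
    case False
    then have "j + j' \<noteq> 0" by linarith
    then show ?thesis using main A0 B0[OF False] False by simp
  next
    case True
    have Bz: "B z = of_real (sqnorm z ^ j)" for z
      using True by (simp add: B_def power_mult_distrib[symmetric] complex_of_pair_mult_cnj)
    show ?thesis
    proof (cases "j = 0")
      case True
      \<comment> \<open>The bound e <= j excludes the vanishing sine of frequency 0; the remaining
        square is 1, hence the factor 1 instead of 1/2.\<close>
      then have "j' = 0" "e = 0" "e' = 0" using e \<open>j = j'\<close> by auto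
      then show ?thesis using True by (simp add: solid_solid_harm_def)
    next
      case False
      then have "disk_mean \<mu> (\<lambda>z. ?u z * A' z) = 0" using A0 by simp
      moreover have "(\<lambda>z. ?u z * B' z) = (if e = e' then (\<lambda>z. ?u z * sqnorm z ^ j) else (\<lambda>z. 0))"
        by (auto simp: B'_def Bz fun_eq_iff)
      ultimately show ?thesis
        using main e \<open>j = j'\<close> False by (auto simp: s'_def)
    qed
  qed
qed

text \<open>Since 1 + t = 2 r^2, the factor r^(2j) left by two harmonics of frequency j becomes the
  second Jacobi parameter.\<close>

lemma jacobi_int_shift: "jacobi_int \<alpha> 0 (p * [:1, 1:] ^ j) = jacobi_int \<alpha> (real j) p"
proof -
  have "x ^ j * x powr 0 = x powr real j" if "x \<ge> 0" for x :: real
    using that by (cases "x = 0") (auto simp: powr_realpow)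
  then show ?thesis
    unfolding jacobi_int_def jacobi_weight_def
    by (intro set_lebesgue_integral_cong) (auto simp: poly_power mult_ac)
qed

lemma jacobi_int_jacobi_mult:
  assumes "\<alpha> > -1" "\<beta> > -1"
  shows "jacobi_int \<alpha> \<beta> (jacobi \<alpha> \<beta> l * jacobi \<alpha> \<beta> l') = (if l = l' then jacobi_int \<alpha> \<beta> 1 else 0)"
proof -
  note J = jacobi_int_smult[OF assms] jacobi_unit_orthogonal[OF assms] jacobi_int_jacobi_unit_square[OF assms] jacobi_unit_norm_pos[OF assms]
  have "jacobi_int \<alpha> \<beta> (jacobi_unit \<alpha> \<beta> l * jacobi_unit \<alpha> \<beta> l') = 0" if "l \<noteq> l'"
    using that J(2)[of "jacobi_unit \<alpha> \<beta> l" l'] J(2)[of "jacobi_unit \<alpha> \<beta> l'" l]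
    by (cases "l < l'") (auto simp: degree_jacobi_unit[OF assms] mult.commute)
  then show ?thesis
    by (auto simp: jacobi_eq[OF assms] J(1-3) abs_of_pos[OF J(4)] less_imp_neq[OF J(4), symmetric])
qed

lemma h_coeff_square:
  assumes "\<mu> \<ge> 0"
  shows "(h_coeff \<mu> l k)\<^sup>2 = 1 / d_coeff l k * (pochhammer (\<mu> + 3/2) (k - 2 * l) / fact (k - 2 * l))"
    and "h_coeff \<mu> l k > 0"
proof -
  let ?j = "k - 2 * l"
  have G: "Gamma (\<mu> + 3/2) > 0" using assms by (intro Gamma_real_pos) simp
  have "\<mu> + 3/2 \<notin> \<int>\<^sub>\<le>\<^sub>0" using assms by (auto simp: nonpos_Ints_def)
  then have "Gamma (real ?j + \<mu> + 3/2) / Gamma (\<mu> + 3/2) = pochhammer (\<mu> + 3/2) ?j"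
    using pochhammer_Gamma[of "\<mu> + 3/2" ?j] by (simp add: add_ac)
  moreover have "Gamma (real ?j + 1) = fact ?j"
    using Gamma_fact[of ?j, where 'a = real] by (simp add: add.commute)
  ultimately have e: "Gamma (real ?j + \<mu> + 3/2) / (Gamma (\<mu> + 3/2) * Gamma (real ?j + 1)) = pochhammer (\<mu> + 3/2) ?j / fact ?j"
    by (metis divide_divide_eq_left)
  have p: "1 / d_coeff l k * (pochhammer (\<mu> + 3/2) ?j / fact ?j) > 0"
    using assms by (auto simp: d_coeff_def intro!: divide_pos_pos pochhammer_pos)
  show "(h_coeff \<mu> l k)\<^sup>2 = 1 / d_coeff l k * (pochhammer (\<mu> + 3/2) (k - 2 * l) / fact (k - 2 * l))"
    unfolding h_coeff_def e using p by (intro real_sqrt_pow2) (rule less_imp_le)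
  show "h_coeff \<mu> l k > 0"
    unfolding h_coeff_def e using p by simp
qed

text \<open>The angular part forces j = j' and e = e'. Then different degrees k mean different l for
  the same Jacobi parameters, so Jacobi orthogonality also separates degrees. On the diagonal h^2
  cancels the angular mean and the radial one.\<close>

lemma basis_poly_orthonormal:
  assumes mu: "\<mu> \<ge> 0" and i: "(l, e) \<in> basis_index k" "(l', e') \<in> basis_index k'"
  shows "disk_inner \<mu> (basis_poly \<mu> k l e) (basis_poly \<mu> k' l' e') = (if (k, l, e) = (k', l', e') then 1 else 0)"
proof -
  define j where "j = k - 2 * l"
  define j' where "j' = k' - 2 * l'"
  define \<alpha> where "\<alpha> = \<mu> - 1/2"
  have k: "k = 2 * l + j" "k' = 2 * l' + j'" and e: "e \<in> {0, 1}" "e' \<in> {0, 1}" "e \<le> j" "e' \<le> j'"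
    using i by (auto simp: j_def j'_def basis_index_def)
  define u where "u = jacobi \<alpha> (real j) l * jacobi \<alpha> (real j') l'"
  have ab: "\<alpha> > -1" "real n > -1" for n using mu by (auto simp: \<alpha>_def)
  have "disk_inner \<mu> (basis_poly \<mu> k l e) (basis_poly \<mu> k' l' e') =
      disk_mean \<mu> (\<lambda>z. (h_coeff \<mu> l k * h_coeff \<mu> l' k') * (poly u (2 * sqnorm z - 1) * (solid_solid_harm j e z * solid_solid_harm j' e' z)))"
    unfolding disk_inner_eq_disk_mean basis_poly_eq j_def[symmetric] j'_def[symmetric] \<alpha>_def[symmetric]
    by (simp add: u_def mult_ac)
  also have "\<dots> = h_coeff \<mu> l k * h_coeff \<mu> l' k' * (if j = j' \<and> e = e' then (if j = 0 then 1 else 1/2) *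
      disk_mean \<mu> (\<lambda>z. poly u (2 * sqnorm z - 1) * sqnorm z ^ j) else 0)"
    using disk_mean_solid_harm_mult[OF mu e, of u] by (simp only: disk_mean_scale)
  finally have main: "disk_inner \<mu> (basis_poly \<mu> k l e) (basis_poly \<mu> k' l' e') = \<dots>" .
  show ?thesis
  proof (cases "j = j' \<and> e = e'")
    case False
    then show ?thesis using main k by auto
  next
    case True
    have "poly u (2 * sqnorm z - 1) * sqnorm z ^ j = poly (smult (1 / 2 ^ j) (u * [:1, 1:] ^ j)) (2 * sqnorm z - 1)" for z
    proof -
      have "poly [:1, 1:] (2 * sqnorm z - 1) = 2 * sqnorm z" by simp
      then show ?thesis by (simp only: poly_smult poly_mult poly_power power_mult_distrib) simp
    qed
    then have "disk_mean \<mu> (\<lambda>z. poly u (2 * sqnorm z - 1) * sqnorm z ^ j) =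
        (\<mu> + 1/2) / 2 powr (\<mu> + 1/2) * (1 / 2 ^ j * jacobi_int \<alpha> (real j) u)"
      using disk_mean_radial[OF mu, of "smult (1 / 2 ^ j) (u * [:1, 1:] ^ j)"] jacobi_int_shift[of \<alpha> u j]
        jacobi_int_smult[OF ab(1) ab(2)[of 0], of "1 / 2 ^ j" "u * [:1, 1:] ^ j"]
      by (simp only: \<alpha>_def[symmetric] of_nat_0)
    also have "jacobi_int \<alpha> (real j) u = (if l = l' then jacobi_int \<alpha> (real j) 1 else 0)"
      using True jacobi_int_jacobi_mult[OF ab] by (simp add: u_def)
    \<comment> \<open>The mass is 2^(\<mu> + 1/2 + j) times the Beta value at \<mu> + 1/2 and j + 1;
      with the factors in front this leaves j! / (\<mu> + 3/2)_j, the inverse of the Gamma quotient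
      in h^2.\<close>
    also have "jacobi_int \<alpha> (real j) 1 = 2 powr (\<mu> + 1/2) * 2 ^ j * (fact j / (pochhammer (\<mu> + 3/2) j * (\<mu> + 1/2)))"
    proof -
      have "Beta (\<alpha> + 1) (real j + 1) = fact j / pochhammer (\<mu> + 3/2) j * (1 / (\<mu> + 1/2))"
      proof -
        have "Beta (1 + real j) (\<mu> + 1/2) = pochhammer 1 j / pochhammer (\<mu> + 3/2) j * Beta 1 (\<mu> + 1/2)"
          using Beta_plus_nat_left[of 1 "\<mu> + 1/2" j] mu by (simp add: add_ac)
        moreover have "Beta (\<mu> + 1/2) 1 = 1 / (\<mu> + 1/2)"
          using mu by (intro Beta_1_right) simp
        ultimately show ?thesis
          by (simp add: \<alpha>_def pochhammer_fact Beta_commute[of "\<mu> + 1/2"] add.commute)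
      qed
      moreover have "2 powr (\<alpha> + real j + 1) = 2 powr (\<mu> + 1/2) * 2 ^ j"
        by (simp add: \<alpha>_def powr_add[symmetric] powr_realpow[symmetric] algebra_simps)
      ultimately show ?thesis using jacobi_int_1[OF ab] by simp
    qed
    finally have D: "disk_mean \<mu> (\<lambda>z. poly u (2 * sqnorm z - 1) * sqnorm z ^ j) =
      (if l = l' then fact j / pochhammer (\<mu> + 3/2) j else 0)" using mu by simp
    show ?thesis
    proof (cases "l = l'")
      case False
      then show ?thesis unfolding main D by simp
    next
      case l: True
      have d: "(if j = 0 then 1 else 1/2) = d_coeff l k"
        by (auto simp: d_coeff_def k)
      have "pochhammer (\<mu> + 3/2) j > 0" using mu by (intro pochhammer_pos) simp
      moreover have "(h_coeff \<mu> l k)\<^sup>2 = 1 / d_coeff l k * (pochhammer (\<mu> + 3/2) j / fact j)"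
        using h_coeff_square(1)[OF mu, of l k] by (simp add: j_def)
      moreover have "d_coeff l k \<noteq> 0" by (simp add: d_coeff_def)
      ultimately have "(h_coeff \<mu> l k)\<^sup>2 * (d_coeff l k * (fact j / pochhammer (\<mu> + 3/2) j)) = 1"
        by simp
      moreover have "k = k'" using True l k by simp
      ultimately show ?thesis
        unfolding main D d using True l by (simp only: power2_eq_square if_True simp_thms)
    qed
  qed
qed

section \<open>Completeness of the basis in the polynomials of bounded degree\<close>

definition radial_harms :: "nat \<Rightarrow> (real \<times> real \<Rightarrow> real) set" where
  "radial_harms d = {\<lambda>z. sqnorm z ^ i * solid_solid_harm j e z |i j e. e \<in> {0, 1} \<and> 2 * i + j \<le> d}"

lemma radial_harmsI: "e \<in> {0, 1} \<Longrightarrow> 2 * i + j \<le> d \<Longrightarrow> (\<lambda>z. sqnorm z ^ i * solid_solid_harm j e z) \<in> radial_harms d"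
  unfolding radial_harms_def by blast

text \<open>With w = x + iy and conjugate w' these are the parts of x w^j = (w^(j+1) + w' w^j) / 2
  and y w^j = (w^(j+1) - w' w^j) / (2i). Here w' w^j is r^2 w^(j-1) for j > 0 and w' for j =
  0.\<close>

lemma solid_harm_Suc_plus:
  "fst z * solid_solid_harm j 0 z = (solid_solid_harm (Suc j) 0 z + (if j = 0 then solid_solid_harm 1 0 z else sqnorm z * solid_solid_harm (j - 1) 0 z)) / 2"
  "fst z * solid_solid_harm j 1 z = (solid_solid_harm (Suc j) 1 z + (if j = 0 then - solid_solid_harm 1 1 z else sqnorm z * solid_solid_harm (j - 1) 1 z)) / 2"
  "snd z * solid_solid_harm j 0 z = (solid_solid_harm (Suc j) 1 z - (if j = 0 then - solid_solid_harm 1 1 z else sqnorm z * solid_solid_harm (j - 1) 1 z)) / 2"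
  "snd z * solid_solid_harm j 1 z = ((if j = 0 then solid_solid_harm 1 0 z else sqnorm z * solid_solid_harm (j - 1) 0 z) - solid_solid_harm (Suc j) 0 z) / 2"
  by (cases j; simp add: solid_solid_harm_def sqnorm_def power2_eq_square algebra_simps)+

lemma radial_harms_mult:
  assumes "P \<in> fun_span (radial_harms d)"
  shows "(\<lambda>z. fst z * P z) \<in> fun_span (radial_harms (Suc d))" "(\<lambda>z. snd z * P z) \<in> fun_span (radial_harms (Suc d))"
proof -
  let ?V = "fun_span (radial_harms (Suc d))"
  have *: "(\<lambda>z. fst z * R z) \<in> ?V \<and> (\<lambda>z. snd z * R z) \<in> ?V" if Rd: "R \<in> radial_harms d" for R
  proof -
    obtain i j e where R: "R = (\<lambda>z. sqnorm z ^ i * solid_solid_harm j e z)" and e: "e \<in> {0, 1}" and le: "2 * i + j \<le> d"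
      using Rd unfolding radial_harms_def by blast
    \<comment> \<open>The real or imaginary part of (x - iy) (x + iy)^j. Lowering the frequency
      costs a factor r^2, so the degree still rises by exactly one.\<close>
    define low where "low e z = (if j = 0 then (if e = 0 then solid_solid_harm 1 0 z else - solid_solid_harm 1 1 z) else sqnorm z * solid_solid_harm (j - 1) e z)" for e z
    define lo where "lo e = (\<lambda>z. sqnorm z ^ i * low e z)" for e
    have hi: "(\<lambda>z. sqnorm z ^ i * solid_solid_harm (Suc j) e z) \<in> ?V" if "e \<in> {0, 1}" for e
      using that le by (intro fun_span_base radial_harmsI) auto
    have lo: "lo e \<in> ?V" if e: "e \<in> {0, 1}" for e
    proof (cases "j = 0")
      case True
      have "(\<lambda>z. (if e = 0 then 1 else -1) * (sqnorm z ^ i * solid_solid_harm 1 e z)) \<in> ?V"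
        using e le by (intro fun_span_scale fun_span_base radial_harmsI) auto
      also have "(\<lambda>z. (if e = 0 then 1 else -1) * (sqnorm z ^ i * solid_solid_harm 1 e z)) = lo e"
        using e True by (auto simp: lo_def low_def fun_eq_iff)
      finally show ?thesis .
    next
      case False
      have "(\<lambda>z. sqnorm z ^ Suc i * solid_solid_harm (j - 1) e z) \<in> ?V"
        using e le False by (intro fun_span_base radial_harmsI) auto
      also have "(\<lambda>z. sqnorm z ^ Suc i * solid_solid_harm (j - 1) e z) = lo e"
        using False by (simp add: lo_def low_def fun_eq_iff)
      finally show ?thesis .
    qed
    have comb: "(\<lambda>z. a * (sqnorm z ^ i * solid_solid_harm (Suc j) e z) + b * lo e z) \<in> ?V" if "e \<in> {0, 1}" for a b e
      using that hi lo by (intro fun_span_add fun_span_scale)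
    have "(\<lambda>z. fst z * R z) = (\<lambda>z. (1/2) * (sqnorm z ^ i * solid_solid_harm (Suc j) e z) + (1/2) * lo e z)"
    proof
      fix z
      have "fst z * R z = sqnorm z ^ i * (fst z * solid_solid_harm j e z)" by (simp add: R mult_ac)
      also have "\<dots> = (1/2) * (sqnorm z ^ i * solid_solid_harm (Suc j) e z) + (1/2) * lo e z"
      proof -
        have "fst z * solid_solid_harm j e z = (solid_solid_harm (Suc j) e z + low e z) / 2"
          using e solid_harm_Suc_plus(1,2)[of z j] by (auto simp: low_def)
        then show ?thesis by (simp add: lo_def distrib_left add_divide_distrib)
      qed
      finally show "fst z * R z = (1/2) * (sqnorm z ^ i * solid_solid_harm (Suc j) e z) + (1/2) * lo e z" .
    qed
    \<comment> \<open>The division by i exchanges cosine and sine, hence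
      \<open>1 - e\<close>.\<close>
    moreover have "(\<lambda>z. snd z * R z) = (\<lambda>z. (if e = 0 then 1/2 else -1/2) * (sqnorm z ^ i * solid_solid_harm (Suc j) (1 - e) z) + (if e = 0 then -1/2 else 1/2) * lo (1 - e) z)"
    proof
      fix z
      have "snd z * R z = sqnorm z ^ i * (snd z * solid_solid_harm j e z)" by (simp add: R mult_ac)
      also have "\<dots> = (if e = 0 then 1/2 else -1/2) * (sqnorm z ^ i * solid_solid_harm (Suc j) (1 - e) z) + (if e = 0 then -1/2 else 1/2) * lo (1 - e) z"
      proof -
        have "snd z * solid_solid_harm j e z = (if e = 0 then 1/2 else -1/2) * solid_solid_harm (Suc j) (1 - e) z + (if e = 0 then -1/2 else 1/2) * low (1 - e) z"
          using e solid_harm_Suc_plus(3,4)[of z j] by (auto simp: low_def diff_divide_distrib)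
        then show ?thesis by (simp add: lo_def distrib_left mult_ac)
      qed
      finally show "snd z * R z = \<dots>" .
    qed
    moreover have "1 - e \<in> {0, 1}" using e by auto
    ultimately show ?thesis using comb e by (simp only: simp_thms)
  qed
  show "(\<lambda>z. fst z * P z) \<in> ?V"
    using assms
  proof induction
    case (fun_span_step P Q c)
    then have "(\<lambda>z. fst z * P z + c * (fst z * Q z)) \<in> ?V" using * by (intro fun_span_add fun_span_scale) auto
    then show ?case by (simp add: algebra_simps)
  qed (simp add: fun_span_zero)
  show "(\<lambda>z. snd z * P z) \<in> ?V"
    using assms
  proof induction
    case (fun_span_step P Q c)
    then have "(\<lambda>z. snd z * P z + c * (snd z * Q z)) \<in> ?V" using * by (intro fun_span_add fun_span_scale) auto
    then show ?case by (simp add: algebra_simps)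
  qed (simp add: fun_span_zero)
qed

lemma monomials_radial_harms: "monomials d \<subseteq> fun_span (radial_harms d)"
proof -
  have "(\<lambda>z. fst z ^ i * snd z ^ j) \<in> fun_span (radial_harms (i + j))" for i j
  proof (induction i)
    case 0
    show ?case
    proof (induction j)
      case 0
      have "(\<lambda>z. sqnorm z ^ 0 * solid_solid_harm 0 0 z) \<in> fun_span (radial_harms 0)"
        by (intro fun_span_base radial_harmsI) auto
      then show ?case by (simp add: solid_solid_harm_def)
    next
      case (Suc j)
      then show ?case using radial_harms_mult(2)[OF Suc] by (simp add: mult_ac)
    qed
  next
    case (Suc i)
    then show ?case using radial_harms_mult(1)[OF Suc] by (simp add: mult_ac)
  qed
  moreover have "radial_harms d' \<subseteq> radial_harms d" if "d' \<le> d" for d'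
    using that unfolding radial_harms_def by (auto; metis le_trans)
  ultimately show ?thesis
    unfolding monomials_def by (blast intro: fun_span_subset fun_span_base)
qed

definition basis_upto :: "real \<Rightarrow> nat \<Rightarrow> (real \<times> real \<Rightarrow> real) set" where
  "basis_upto \<mu> d = {basis_poly \<mu> m l e |m l e. m \<le> d \<and> (l, e) \<in> basis_index m}"

text \<open>For fixed j and e, the Jacobi polynomials with second parameter j have one member of
  each degree in t = 2 r^2 - 1, so subtracting leading terms writes any radial factor through
  them.\<close>

lemma poly2_basis_upto:
  assumes mu: "\<mu> \<ge> 0" and P: "P \<in> poly2 d"
  shows "P \<in> fun_span (basis_upto \<mu> d)"
proof -
  have rad: "(\<lambda>z. poly u (2 * sqnorm z - 1) * solid_solid_harm j e z) \<in> fun_span (basis_upto \<mu> d)"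
    if e: "e \<in> {0, 1}" and le: "2 * degree u + j \<le> d" for u :: "real poly" and j e
    using le
  proof (induction "degree u" arbitrary: u rule: less_induct)
    case less
    show ?case
    \<comment> \<open>The sine of frequency 0 is the zero function and has no admissible index (l,
      1) in degree 2l.\<close>
    proof (cases "u = 0 \<or> (j = 0 \<and> e = 1)")
      case True
      then show ?thesis by (auto simp: solid_solid_harm_def fun_span_zero)
    next
      case False
      define l where "l = degree u"
      define k where "k = 2 * l + j"
      have ab: "\<mu> - 1/2 > -1" "real j > -1" using mu by auto
      define p where "p = jacobi (\<mu> - 1/2) (real j) l"
      have p: "degree p = l" "lead_coeff p \<noteq> 0"
        using degree_jacobi_unit[OF ab, of l] coeff_jacobi_unit_pos[OF ab, of l] jacobi_unit_norm_pos[OF ab, of l]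
        by (auto simp: p_def jacobi_eq[OF ab])
      define c where "c = lead_coeff u / lead_coeff p"
      define r where "r = u - smult c p"
      have c0: "coeff r l = 0" using p by (simp add: r_def c_def l_def)
      have rl: "degree r \<le> l" unfolding r_def l_def using p degree_smult_le[of c p] by (intro degree_diff_le) (auto simp: l_def)
      have r: "(\<lambda>z. poly r (2 * sqnorm z - 1) * solid_solid_harm j e z) \<in> fun_span (basis_upto \<mu> d)"
      proof (cases "r = 0")
        case True
        then show ?thesis by (simp add: fun_span_zero)
      next
        case False
        then have "degree r < degree u"
          using c0 rl by (metis l_def leading_coeff_0_iff order_less_le)
        then show ?thesis using less by (intro less) auto
      qed
      have h: "h_coeff \<mu> l k \<noteq> 0" using h_coeff_square(2)[OF mu, of l k] by simp
      have "basis_poly \<mu> k l e = (\<lambda>z. h_coeff \<mu> l k * poly p (2 * sqnorm z - 1) * solid_solid_harm j e z)"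
        by (simp add: basis_poly_eq p_def k_def)
      moreover have "k \<le> d" "(l, e) \<in> basis_index k"
        using less.prems False e by (auto simp: k_def l_def basis_index_def)
      ultimately have "(\<lambda>z. h_coeff \<mu> l k * poly p (2 * sqnorm z - 1) * solid_solid_harm j e z) \<in> fun_span (basis_upto \<mu> d)"
        unfolding basis_upto_def by (intro fun_span_base) force
      from fun_span_add[OF r fun_span_scale[OF this, of "c / h_coeff \<mu> l k"]]
      show ?thesis using h by (simp add: r_def algebra_simps)
    qed
  qed
  have "radial_harms d \<subseteq> fun_span (basis_upto \<mu> d)"
  proof
    fix R assume "R \<in> radial_harms d"
    then obtain i j e where R: "R = (\<lambda>z. sqnorm z ^ i * solid_solid_harm j e z)" "e \<in> {0, 1}" "2 * i + j \<le> d"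
      unfolding radial_harms_def by blast
    \<comment> \<open>At t = 2 r^2 - 1 the polynomial (1 + t) / 2 is r^2.\<close>
    have "degree ([:1/2, 1/2:] ^ i :: real poly) = i" by (simp add: degree_power_eq)
    then have "(\<lambda>z. poly ([:1/2, 1/2:] ^ i) (2 * sqnorm z - 1) * solid_solid_harm j e z) \<in> fun_span (basis_upto \<mu> d)"
      using R by (intro rad) auto
    also have "(\<lambda>z. poly ([:1/2, 1/2:] ^ i) (2 * sqnorm z - 1) * solid_solid_harm j e z) = R"
    proof -
      have "poly [:1/2, 1/2:] (2 * sqnorm z - 1) = sqnorm z" for z by (simp add: field_simps)
      then show ?thesis by (simp only: R poly_power)
    qed
    finally show "R \<in> fun_span (basis_upto \<mu> d)" .
  qed
  then show ?thesis
    using P monomials_radial_harms[of d] unfolding poly2_eq_fun_span by (blast intro: fun_span_subset)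
qed

section \<open>Orthogonal projections\<close>

definition basis_proj :: "real \<Rightarrow> nat \<Rightarrow> (real \<times> real \<Rightarrow> real) \<Rightarrow> real \<times> real \<Rightarrow> real" where
  "basis_proj \<mu> k f z = (\<Sum>(l, e)\<in>basis_index k. disk_inner \<mu> f (basis_poly \<mu> k l e) * basis_poly \<mu> k l e z)"

lemma finite_basis_index: "finite (basis_index k)"
  by (rule finite_subset[of _ "{..k} \<times> {0, 1}"]) (auto simp: basis_index_def)

context
  fixes \<mu> :: real
  assumes mu: "\<mu> \<ge> 0"
begin

lemma disk_integrable_mult_poly2: "disk_integrable \<mu> f \<Longrightarrow> P \<in> poly2 d \<Longrightarrow> disk_integrable \<mu> (\<lambda>z. f z * P z)"
  unfolding disk_integrable_def by (intro set_integrable_weight_mult continuous_poly2)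

lemma basis_proj_scale: "basis_proj \<mu> k (\<lambda>z. c * f z) z = c * basis_proj \<mu> k f z"
  by (simp add: basis_proj_def disk_inner_eq_disk_mean mult.assoc disk_mean_scale sum_distrib_left split_beta)

lemma basis_proj_add:
  assumes "disk_integrable \<mu> f" "disk_integrable \<mu> g"
  shows "basis_proj \<mu> k (\<lambda>z. f z + g z) z = basis_proj \<mu> k f z + basis_proj \<mu> k g z"
proof -
  have "disk_inner \<mu> (\<lambda>z. f z + g z) (basis_poly \<mu> k l e) =
      disk_inner \<mu> f (basis_poly \<mu> k l e) + disk_inner \<mu> g (basis_poly \<mu> k l e)" if "(l, e) \<in> basis_index k" for l e
    using assms disk_integrable_mult_poly2 poly2_basis_poly[OF mu that]
    by (simp add: disk_inner_eq_disk_mean distrib_right disk_mean_add)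
  then show ?thesis
    unfolding basis_proj_def sum.distrib[symmetric] by (intro sum.cong) (auto simp: distrib_right)
qed

lemma basis_proj_basis:
  assumes "(l, e) \<in> basis_index m"
  shows "basis_proj \<mu> k (basis_poly \<mu> m l e) z = (if k = m then basis_poly \<mu> m l e z else 0)"
proof -
  have "basis_proj \<mu> k (basis_poly \<mu> m l e) z = (\<Sum>i\<in>basis_index k. if i = (l, e) then (if k = m then basis_poly \<mu> m l e z else 0) else 0)"
    unfolding basis_proj_def using basis_poly_orthonormal[OF mu assms]
    by (intro sum.cong) (auto split: if_splits)
  then show ?thesis
    using assms by (simp add: finite_basis_index)
qed

lemma poly2_expansion:
  assumes "P \<in> poly2 d"
  shows "P z = (\<Sum>k\<le>d. basis_proj \<mu> k P z)"
proof -
  \<comment> \<open>Integrability is carried through the induction because \<open>basis_proj\<close>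
    is additive on integrable functions.\<close>
  have "(disk_integrable \<mu> P) \<and> (\<forall>z. P z = (\<Sum>k\<le>d. basis_proj \<mu> k P z))"
    using poly2_basis_upto[OF mu assms]
  proof induction
    case fun_span_zero
    show ?case by (simp add: disk_integrable_zero basis_proj_def disk_inner_eq_disk_mean)
  next
    case (fun_span_step P Q c)
    obtain m l e where Q: "Q = basis_poly \<mu> m l e" "m \<le> d" "(l, e) \<in> basis_index m"
      using fun_span_step.hyps by (auto simp: basis_upto_def)
    have iQ: "disk_integrable \<mu> Q"
      using Q disk_integrable_poly2[OF mu poly2_basis_poly[OF mu]] by blast
    have Qz: "Q z = (\<Sum>k\<le>d. basis_proj \<mu> k Q z)" for z
      using Q by (simp add: basis_proj_basis)
    have iP: "disk_integrable \<mu> P" and Pz: "P z = (\<Sum>k\<le>d. basis_proj \<mu> k P z)" for z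
      using fun_span_step.IH by blast+
    have "(\<Sum>k\<le>d. basis_proj \<mu> k (\<lambda>z. P z + c * Q z) z) = (\<Sum>k\<le>d. basis_proj \<mu> k P z) + c * (\<Sum>k\<le>d. basis_proj \<mu> k Q z)" for z
      by (simp add: basis_proj_add[OF iP disk_integrable_scale[OF iQ]] basis_proj_scale sum.distrib sum_distrib_left)
    then have "P z + c * Q z = (\<Sum>k\<le>d. basis_proj \<mu> k (\<lambda>z. P z + c * Q z) z)" for z
      using Pz[of z] Qz[of z] by (simp only:)
    then show ?case
      using disk_integrable_add[OF iP disk_integrable_scale[OF iQ, of c]] by blast
  qed
  then show ?thesis by blast
qed

lemma poly2_orthogonal_expansion:
  assumes "P \<in> poly2 k" and "\<And>d Q. d < k \<Longrightarrow> Q \<in> poly2 d \<Longrightarrow> disk_inner \<mu> P Q = 0"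
  shows "P = basis_proj \<mu> k P"
proof
  fix z
  have "basis_proj \<mu> m P z = 0" if "m < k" for m
    unfolding basis_proj_def using assms(2)[OF that poly2_basis_poly[OF mu]] by (intro sum.neutral) auto
  then have "(\<Sum>m\<le>k. basis_proj \<mu> m P z) = (\<Sum>m\<in>{k}. basis_proj \<mu> m P z)"
    by (intro sum.mono_neutral_right) auto
  then show "P z = basis_proj \<mu> k P z"
    using poly2_expansion[OF assms(1), of z] by simp
qed

lemma poly2_basis_proj: "basis_proj \<mu> k f \<in> poly2 k"
  unfolding basis_proj_def[abs_def] using poly2_basis_poly[OF mu]
  by (intro poly2_sum) (auto intro!: poly2_scale)

lemma disk_inner_sum_left:
  assumes "\<And>i. i \<in> A \<Longrightarrow> disk_integrable \<mu> (g i)" "Q \<in> poly2 d"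
  shows "disk_inner \<mu> (\<lambda>z. \<Sum>i\<in>A. g i z) Q = (\<Sum>i\<in>A. disk_inner \<mu> (g i) Q)"
  using assms by (simp add: disk_inner_eq_disk_mean sum_distrib_right disk_mean_sum disk_integrable_mult_poly2)

lemma disk_inner_basis_proj:
  assumes "(l, e) \<in> basis_index m"
  shows "disk_inner \<mu> (basis_proj \<mu> k f) (basis_poly \<mu> m l e) = (if k = m then disk_inner \<mu> f (basis_poly \<mu> m l e) else 0)"
proof -
  let ?c = "\<lambda>i. disk_inner \<mu> f (basis_poly \<mu> k (fst i) (snd i))"
  have "disk_inner \<mu> (basis_proj \<mu> k f) (basis_poly \<mu> m l e) =
      (\<Sum>i\<in>basis_index k. disk_inner \<mu> (\<lambda>z. ?c i * basis_poly \<mu> k (fst i) (snd i) z) (basis_poly \<mu> m l e))"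
    unfolding basis_proj_def[abs_def] split_beta
    by (intro disk_inner_sum_left[OF _ poly2_basis_poly[OF mu assms]] disk_integrable_scale disk_integrable_poly2[OF mu poly2_basis_poly[OF mu]]) auto
  also have "\<dots> = (\<Sum>i\<in>basis_index k. if i = (l, e) then (if k = m then disk_inner \<mu> f (basis_poly \<mu> m l e) else 0) else 0)"
  proof (intro sum.cong refl)
    fix i assume i: "i \<in> basis_index k"
    have "disk_inner \<mu> (\<lambda>z. ?c i * basis_poly \<mu> k (fst i) (snd i) z) (basis_poly \<mu> m l e) =
       ?c i * disk_inner \<mu> (basis_poly \<mu> k (fst i) (snd i)) (basis_poly \<mu> m l e)"
      by (simp add: disk_inner_eq_disk_mean mult.assoc disk_mean_scale)
    then show "disk_inner \<mu> (\<lambda>z. ?c i * basis_poly \<mu> k (fst i) (snd i) z) (basis_poly \<mu> m l e) =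
      (if i = (l, e) then (if k = m then disk_inner \<mu> f (basis_poly \<mu> m l e) else 0) else 0)"
      using basis_poly_orthonormal[OF mu _ assms, of "fst i" "snd i" k] i by auto
  qed
  also have "\<dots> = (if k = m then disk_inner \<mu> f (basis_poly \<mu> m l e) else 0)"
    using assms by (simp add: finite_basis_index)
  finally show ?thesis .
qed

lemma basis_proj_basis_proj: "basis_proj \<mu> m (basis_proj \<mu> k f) = (if k = m then basis_proj \<mu> k f else (\<lambda>_. 0))"
proof
  fix z
  have "basis_proj \<mu> m (basis_proj \<mu> k f) z = (\<Sum>(l, e)\<in>basis_index m. (if k = m then disk_inner \<mu> f (basis_poly \<mu> m l e) else 0) * basis_poly \<mu> m l e z)"
    unfolding basis_proj_def[of \<mu> m] by (intro sum.cong) (auto simp: disk_inner_basis_proj)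
  then show "basis_proj \<mu> m (basis_proj \<mu> k f) z = (if k = m then basis_proj \<mu> k f else (\<lambda>_. 0)) z"
    by (cases "k = m") (simp_all add: basis_proj_def[of \<mu> m f])
qed

text \<open>Only the polynomial \<open>Q\<close> is expanded; finite linearity does the rest for any
  integrable \<open>f\<close>.\<close>

lemma disk_inner_parseval:
  assumes f: "disk_integrable \<mu> f" and Q: "Q \<in> poly2 d"
  shows "disk_inner \<mu> f Q = (\<Sum>k\<le>d. \<Sum>(l, e)\<in>basis_index k. disk_inner \<mu> f (basis_poly \<mu> k l e) * disk_inner \<mu> Q (basis_poly \<mu> k l e))"
proof -
  let ?b = "\<lambda>k i. basis_poly \<mu> k (fst i) (snd i)"
  have i: "disk_integrable \<mu> (\<lambda>z. disk_inner \<mu> Q (?b k i) * (f z * ?b k i z))" if "i \<in> basis_index k" for k i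
    using disk_integrable_mult_poly2[OF f poly2_basis_poly[OF mu]] that by (intro disk_integrable_scale) auto
  have "f z * Q z = (\<Sum>k\<le>d. \<Sum>i\<in>basis_index k. disk_inner \<mu> Q (?b k i) * (f z * ?b k i z))" for z
    by (subst poly2_expansion[OF Q, of z]) (simp add: basis_proj_def split_beta sum_distrib_left mult_ac)
  then have "disk_inner \<mu> f Q = disk_mean \<mu> (\<lambda>z. \<Sum>k\<le>d. \<Sum>i\<in>basis_index k. disk_inner \<mu> Q (?b k i) * (f z * ?b k i z))"
    unfolding disk_inner_eq_disk_mean[of \<mu> f Q] by simp
  also have "\<dots> = (\<Sum>k\<le>d. \<Sum>i\<in>basis_index k. disk_inner \<mu> Q (?b k i) * disk_mean \<mu> (\<lambda>z. f z * ?b k i z))"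
    using i by (simp add: disk_mean_sum disk_integrable_sum disk_mean_scale)
  finally show ?thesis
    by (simp add: disk_inner_eq_disk_mean split_beta mult.commute)
qed

text \<open>Replaces the degree and orthogonality clauses by a fixed-point equation. A fixed point
  of lower degree d < k is zero, because its expansion up to d contains only vanishing
  components.\<close>

lemma orth_space_eq: "P \<in> orth_space \<mu> k \<longleftrightarrow> P = basis_proj \<mu> k P"
proof
  assume P: "P \<in> orth_space \<mu> k"
  show "P = basis_proj \<mu> k P"
  proof (cases "P = (\<lambda>_. 0)")
    case True
    then show ?thesis by (auto simp: basis_proj_def disk_inner_eq_disk_mean)
  next
    case False
    then show ?thesis using P by (intro poly2_orthogonal_expansion) (auto simp: orth_space_def)
  qed
next
  assume P: "P = basis_proj \<mu> k P"
  then have Pk: "P \<in> poly2 k" using poly2_basis_proj by metis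
  have zero: "basis_proj \<mu> m P = (\<lambda>_. 0)" if "m \<noteq> k" for m
    using basis_proj_basis_proj[of m k P] P that by auto
  have orth: "disk_inner \<mu> P Q = 0" if "d < k" "Q \<in> poly2 d" for d Q
  proof -
    have "disk_inner \<mu> P (basis_poly \<mu> m l e) = 0" if "m \<le> d" "(l, e) \<in> basis_index m" for m l e
      using disk_inner_basis_proj[OF that(2), of k P] P \<open>d < k\<close> that by auto
    then show ?thesis
      unfolding disk_inner_parseval[OF disk_integrable_poly2[OF mu Pk] that(2)]
      by (intro sum.neutral ballI) auto
  qed
  have "P = (\<lambda>_. 0)" if "d < k" "P \<in> poly2 d" for d
  proof
    fix z
    have "P z = (\<Sum>m\<le>d. basis_proj \<mu> m P z)" by (rule poly2_expansion[OF that(2)])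
    also have "\<dots> = 0" using zero that(1) by (intro sum.neutral) auto
    finally show "P z = 0" .
  qed
  then have "P = (\<lambda>_. 0) \<or> P \<in> poly2 k \<and> (\<forall>d<k. P \<notin> poly2 d)" using Pk by blast
  then show "P \<in> orth_space \<mu> k"
    unfolding orth_space_def using orth by simp
qed

text \<open>The Fourier sum satisfies the description. Conversely the basis elements lie in the k-th
  space, so testing against them fixes all coefficients of a candidate.\<close>

lemma disk_proj_eq:
  assumes f: "disk_integrable \<mu> f"
  shows "disk_proj \<mu> k f = basis_proj \<mu> k f"
  unfolding disk_proj_def
proof (rule the_equality)
  have diff: "disk_inner \<mu> (\<lambda>z. f z - P z) Q = disk_inner \<mu> f Q - disk_inner \<mu> P Q"
    if "P \<in> poly2 a" "Q \<in> poly2 b" for P Q a b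
  proof -
    have "disk_mean \<mu> (\<lambda>z. f z * Q z + (-1) * (P z * Q z)) = disk_mean \<mu> (\<lambda>z. f z * Q z) + (-1) * disk_mean \<mu> (\<lambda>z. P z * Q z)"
      using disk_integrable_mult_poly2[OF f that(2)] disk_integrable_mult_poly2[OF disk_integrable_poly2[OF mu that(1)] that(2)]
      by (simp only: disk_mean_add disk_mean_scale disk_integrable_scale)
    then show ?thesis by (simp add: disk_inner_eq_disk_mean left_diff_distrib)
  qed
  have basis: "basis_poly \<mu> k l e \<in> orth_space \<mu> k" if "(l, e) \<in> basis_index k" for l e
    unfolding orth_space_eq using basis_proj_basis[OF that, of k] by auto
  show "basis_proj \<mu> k f \<in> orth_space \<mu> k \<and> (\<forall>Q\<in>orth_space \<mu> k. disk_inner \<mu> (\<lambda>z. f z - basis_proj \<mu> k f z) Q = 0)"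
  proof (intro conjI ballI)
    show "basis_proj \<mu> k f \<in> orth_space \<mu> k" by (simp add: orth_space_eq basis_proj_basis_proj)
    fix Q assume "Q \<in> orth_space \<mu> k"
    then have Q: "Q = basis_proj \<mu> k Q" by (simp add: orth_space_eq)
    then have Qk: "Q \<in> poly2 k" using poly2_basis_proj by metis
    have "disk_inner \<mu> (\<lambda>z. f z - basis_proj \<mu> k f z) (basis_poly \<mu> m l e) * disk_inner \<mu> Q (basis_poly \<mu> m l e) = 0"
      if "(l, e) \<in> basis_index m" for m l e
    proof (cases "m = k")
      case True
      have "disk_inner \<mu> (\<lambda>z. f z - basis_proj \<mu> k f z) (basis_poly \<mu> m l e) = 0"
        using True diff[OF poly2_basis_proj[of k f] poly2_basis_poly[OF mu that]] disk_inner_basis_proj[OF that, of k f] by simp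
      then show ?thesis by simp
    next
      case False
      then have "disk_inner \<mu> Q (basis_poly \<mu> m l e) = 0"
        using disk_inner_basis_proj[OF that, of k Q] Q by simp
      then show ?thesis by simp
    qed
    moreover have "disk_integrable \<mu> (\<lambda>z. f z - basis_proj \<mu> k f z)"
      using disk_integrable_add[OF f disk_integrable_scale[OF disk_integrable_poly2[OF mu poly2_basis_proj], of "-1"]] by simp
    ultimately show "disk_inner \<mu> (\<lambda>z. f z - basis_proj \<mu> k f z) Q = 0"
      by (subst disk_inner_parseval[OF _ Qk]) (auto intro!: sum.neutral)
  qed
  fix P
  assume P: "P \<in> orth_space \<mu> k \<and> (\<forall>Q\<in>orth_space \<mu> k. disk_inner \<mu> (\<lambda>z. f z - P z) Q = 0)"
  then have Pe: "P = basis_proj \<mu> k P" by (simp add: orth_space_eq)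
  then have Pk: "P \<in> poly2 k" using poly2_basis_proj by metis
  have "disk_inner \<mu> P (basis_poly \<mu> k l e) = disk_inner \<mu> f (basis_poly \<mu> k l e)" if "(l, e) \<in> basis_index k" for l e
    using P basis[OF that] diff[OF Pk poly2_basis_poly[OF mu that]] by simp
  then have "basis_proj \<mu> k P = basis_proj \<mu> k f"
    unfolding basis_proj_def by (intro ext sum.cong) auto
  with Pe show "P = basis_proj \<mu> k f" by simp
qed

end

section \<open>Ridge polynomials and the discrete sum over views\<close>

text \<open>The product telescopes. The linear factors k + \<mu> + 1/2 and their kin in
  \<open>Phi_kernel\<close> and \<open>lambda_coeff\<close> arise this way.\<close>

lemma pochhammer_shift:
  fixes x :: real
  assumes "x > 0"
  shows "pochhammer x n / pochhammer (x + 1) n = x / (x + n)"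
proof -
  have "pochhammer x n * (x + n) = x * pochhammer (x + 1) n"
    using pochhammer_rec[of x n] pochhammer_Suc[of x n] by simp
  moreover have "pochhammer (x + 1) n > 0" using assms by (intro pochhammer_pos) simp
  ultimately show ?thesis using assms by (simp add: field_simps)
qed

text \<open>Chord integrals of the rotated polynomial give one \<open>q\<close> that serves every
  \<open>g\<close>: pairing with a ridge function becomes a pairing for the Jacobi weight with
  parameters \<mu>, \<mu>. It is used both with \<open>g\<close> of degree k and with
  \<open>g\<close> of lower degree.\<close>

lemma ridge_inner:
  assumes mu: "\<mu> \<ge> 0" and Q: "Q \<in> poly2 d"
  shows "\<exists>q. degree q \<le> d \<and> poly q 1 = jacobi_int (\<mu> - 1/2) (\<mu> - 1/2) 1 * Q (cos \<xi>, sin \<xi>) \<and>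
    (\<forall>g. disk_mean \<mu> (\<lambda>z. Q z * poly g (fst z * cos \<xi> + snd z * sin \<xi>)) = norm_const \<mu> * jacobi_int \<mu> \<mu> (q * g))"
proof -
  obtain q where q: "degree q \<le> d" "poly q 1 = jacobi_int (\<mu> - 1/2) (\<mu> - 1/2) 1 * Q (rot \<xi> (1, 0))"
    "\<forall>t. \<bar>t\<bar> < 1 \<longrightarrow> set_integrable lebesgue (fibre t) (\<lambda>s. Q (rot \<xi> (t, s)) * (1 - s\<^sup>2 - t\<^sup>2) powr (\<mu> - 1/2)) \<and>
      (LINT s:fibre t|lebesgue. Q (rot \<xi> (t, s)) * (1 - s\<^sup>2 - t\<^sup>2) powr (\<mu> - 1/2)) = (1 - t\<^sup>2) powr \<mu> * poly q t"
    using fibre_integral_poly2[OF mu poly2_rot[OF Q]] by blast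
  have R: "radon \<mu> \<xi> Q t = jacobi_weight \<mu> \<mu> t * poly q t" if "\<bar>t\<bar> < 1" for t
  proof -
    have "radon \<mu> \<xi> Q t = (1 - t\<^sup>2) powr \<mu> * poly q t"
      using q(3) that by (simp add: radon_def rot_def)
    also have "1 - t\<^sup>2 = (1 - t) * (1 + t)" by (simp add: power2_eq_square algebra_simps)
    finally show ?thesis using that by (simp add: jacobi_weight_def powr_mult)
  qed
  have "disk_mean \<mu> (\<lambda>z. Q z * poly g (fst z * cos \<xi> + snd z * sin \<xi>)) = norm_const \<mu> * jacobi_int \<mu> \<mu> (q * g)" for g
  proof -
    have i: "set_integrable lebesgue disk (\<lambda>z. Q z * disk_weight \<mu> z)"
      using disk_integrable_poly2[OF mu Q] by (simp add: disk_integrable_def)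
    have "(LINT t:{-1..1}|lebesgue. radon \<mu> \<xi> Q t * poly g t) = jacobi_int \<mu> \<mu> (q * g)"
      unfolding jacobi_int_def set_lebesgue_integral_def
    proof (rule integral_cong_AE)
      show "(\<lambda>t. indicator {-1..1} t *\<^sub>R (radon \<mu> \<xi> Q t * poly g t)) \<in> borel_measurable lebesgue"
        using radon_Fubini(1)[OF mu i, of \<xi> g] unfolding set_integrable_def by (rule borel_measurable_integrable)
      show "(\<lambda>t. indicator {-1..1} t *\<^sub>R (poly (q * g) t * jacobi_weight \<mu> \<mu> t)) \<in> borel_measurable lebesgue"
        using jacobi_int_integrable[of \<mu> \<mu> "q * g"] mu unfolding set_integrable_def by (intro borel_measurable_integrable) simp
      \<comment> \<open>The chord formula covers only |t| < 1; the two endpoints form a null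
        set.\<close>
      have "AE t in lborel. t \<noteq> 1 \<and> t \<noteq> (-1::real)"
        using AE_lborel_singleton[of 1] AE_lborel_singleton[of "-1::real"] by eventually_elim simp
      then have "AE t in lebesgue. t \<noteq> 1 \<and> t \<noteq> (-1::real)" by (rule AE_completion)
      then show "AE t in lebesgue. indicator {-1..1} t *\<^sub>R (radon \<mu> \<xi> Q t * poly g t) =
          indicator {-1..1} t *\<^sub>R (poly (q * g) t * jacobi_weight \<mu> \<mu> t)"
      proof eventually_elim
        case (elim t)
        show ?case
        proof (cases "t \<in> {-1..1}")
          case True
          then have "\<bar>t\<bar> < 1" using elim by auto
          from R[OF this] show ?thesis by simp
        qed simp
      qed
    qed
    then show ?thesis
      unfolding disk_mean_def radon_Fubini(2)[OF mu i] by simp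
  qed
  then show ?thesis using q by (auto simp: rot_def)
qed

text \<open>Origin of the factor (k + \<mu> + 1/2) / (\<mu> + 1/2) in \<open>Phi_kernel\<close>: for
  equal parameters the squared norm times the Gegenbauer endpoint value is two telescoping
  quotients.\<close>

lemma jacobi_unit_norm_gegenbauer:
  assumes "\<mu> \<ge> 0"
  shows "pochhammer (2 * \<mu> + 1) k / fact k * jacobi_unit_norm \<mu> \<mu> k = (\<mu> + 1/2) / (real k + \<mu> + 1/2)"
proof -
  have p: "pochhammer (\<mu> + 1) k > 0" using assms by (intro pochhammer_pos) simp
  have "pochhammer (2 * \<mu> + 1) k / fact k * jacobi_unit_norm \<mu> \<mu> k =
      (pochhammer (2 * \<mu> + 1) k / pochhammer (2 * \<mu> + 1 + 1) k) *
      (pochhammer (k + 2 * \<mu> + 1) k / pochhammer (k + 2 * \<mu> + 1 + 1) k)"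
    using p by (simp add: jacobi_unit_norm_def mult_ac add_ac mult_2)
  also have "\<dots> = (2 * \<mu> + 1) / (2 * \<mu> + 1 + k) * ((k + 2 * \<mu> + 1) / (k + 2 * \<mu> + 1 + k))"
    using pochhammer_shift[of "2 * \<mu> + 1" k] pochhammer_shift[of "k + 2 * \<mu> + 1" k] assms by (simp only:)
  also have "\<dots> = (2 * \<mu> + 1) / (2 * \<mu> + 1 + 2 * k)"
  proof -
    have e: "k + 2 * \<mu> + 1 = 2 * \<mu> + 1 + k" "2 * \<mu> + 1 + k + k = 2 * \<mu> + 1 + 2 * k"
      by auto
    have cancel: "a / b * (b / d) = a / d" if "b \<noteq> 0" for a b d :: real
      using that by simp
    show ?thesis unfolding e by (rule cancel) (use assms in simp)
  qed
  also have "\<dots> = (\<mu> + 1/2) / (real k + \<mu> + 1/2)"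
    using assms by (simp add: field_simps)
  finally show ?thesis .
qed

text \<open>An addition formula, obtained by expanding the ridge polynomial of
  \<open>jacobi_unit\<close> in the basis. Each coefficient is the squared norm times the basis
  polynomial at (cos \<xi>, sin \<xi>).\<close>

lemma gegenbauer_ridge:
  assumes mu: "\<mu> \<ge> 0"
  shows "(real k + \<mu> + 1/2) / (\<mu> + 1/2) * poly (gegenbauer (\<mu> + 1/2) k) (fst w * cos \<xi> + snd w * sin \<xi>) =
    (\<Sum>(l, e)\<in>basis_index k. basis_poly \<mu> k l e (cos \<xi>, sin \<xi>) * basis_poly \<mu> k l e w)"
proof -
  define F where "F = jacobi_unit \<mu> \<mu> k"
  define c where "c = pochhammer (2 * \<mu> + 1) k / fact k"
  define r where "r = (\<lambda>g z. poly g (fst z * cos \<xi> + snd z * sin \<xi>))"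
  have mu': "\<mu> > -1" using mu by simp
  have rp: "r g \<in> poly2 (degree g)" for g
    unfolding r_def using poly2_linear[of "cos \<xi>" "sin \<xi>"] by (intro poly2_poly[of _ 1]) (simp_all add: mult.commute)
  have comm: "disk_inner \<mu> (r g) Q = disk_mean \<mu> (\<lambda>z. Q z * poly g (fst z * cos \<xi> + snd z * sin \<xi>))" for g Q
    by (simp add: disk_inner_eq_disk_mean r_def mult.commute)
  \<comment> \<open>A polynomial \<open>Q\<close> of degree below k has \<open>q\<close> of degree
    below k, to which \<open>F\<close> is orthogonal. Hence the expansion has components of degree k
    only.\<close>
  have orth: "disk_inner \<mu> (r F) Q = 0" if dk: "d < k" and Qd: "Q \<in> poly2 d" for d Q
  proof -
    obtain q where "degree q \<le> d" "\<forall>g. disk_mean \<mu> (\<lambda>z. Q z * poly g (fst z * cos \<xi> + snd z * sin \<xi>)) = norm_const \<mu> * jacobi_int \<mu> \<mu> (q * g)"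
      using ridge_inner[OF mu Qd] by blast
    then show ?thesis
      using jacobi_unit_orthogonal[OF mu' mu', of q k] dk by (simp add: comm F_def mult.commute)
  qed
  have "degree F \<le> k" by (simp add: F_def degree_jacobi_unit_le)
  then have rF: "r F \<in> poly2 k" using rp poly2_mono by blast
  have coef: "disk_inner \<mu> (r F) (basis_poly \<mu> k l e) = jacobi_unit_norm \<mu> \<mu> k * basis_poly \<mu> k l e (cos \<xi>, sin \<xi>)"
    if le: "(l, e) \<in> basis_index k" for l e
  proof -
    let ?P = "basis_poly \<mu> k l e"
    have P: "?P \<in> poly2 k" by (rule poly2_basis_poly[OF mu le])
    obtain q where q: "degree q \<le> k" "poly q 1 = jacobi_int (\<mu> - 1/2) (\<mu> - 1/2) 1 * ?P (cos \<xi>, sin \<xi>)"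
      "\<forall>g. disk_mean \<mu> (\<lambda>z. ?P z * poly g (fst z * cos \<xi> + snd z * sin \<xi>)) = norm_const \<mu> * jacobi_int \<mu> \<mu> (q * g)"
      using ridge_inner[OF mu P] by blast
    have nc: "norm_const \<mu> > 0" using mu by (simp add: norm_const_def)
    \<comment> \<open>The ridge identity read backwards: a ridge polynomial of degree below k is
      orthogonal to the basis element.\<close>
    have "jacobi_int \<mu> \<mu> (q * g) = 0" if g: "degree g < k" for g
    proof -
      have "?P \<in> orth_space \<mu> k"
        unfolding orth_space_eq[OF mu] using basis_proj_basis[OF mu le, of k] by (simp add: fun_eq_iff)
      then have "disk_inner \<mu> ?P (r g) = 0"
        using g rp[of g] unfolding orth_space_def by blast
      then show ?thesis using q(3) nc by (simp add: disk_inner_eq_disk_mean r_def)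
    qed
    then obtain a where a: "q = smult a F"
      using orthogonal_poly_unique[OF mu' mu' q(1)] unfolding F_def by blast
    then have "a = poly q 1" by (simp add: F_def poly_jacobi_unit_1)
    have "disk_inner \<mu> (r F) ?P = norm_const \<mu> * (a * (jacobi_unit_norm \<mu> \<mu> k * jacobi_int \<mu> \<mu> 1))"
      using q(3) by (simp add: comm a jacobi_int_smult[OF mu' mu'] F_def jacobi_int_jacobi_unit_square[OF mu' mu'])
    also have "\<dots> = norm_const \<mu> * (jacobi_int (\<mu> - 1/2) (\<mu> - 1/2) 1 * jacobi_int \<mu> \<mu> 1) * (jacobi_unit_norm \<mu> \<mu> k * ?P (cos \<xi>, sin \<xi>))"
      by (simp add: \<open>a = poly q 1\<close> q(2) mult_ac)
    also have "norm_const \<mu> * (jacobi_int (\<mu> - 1/2) (\<mu> - 1/2) 1 * jacobi_int \<mu> \<mu> 1) = 1"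
      using mu by (simp add: beta_product norm_const_def)
    finally show ?thesis by simp
  qed
  have "r F w = basis_proj \<mu> k (r F) w"
    using poly2_orthogonal_expansion[OF mu rF orth] by (rule fun_cong)
  also have "\<dots> = jacobi_unit_norm \<mu> \<mu> k * (\<Sum>(l, e)\<in>basis_index k. basis_poly \<mu> k l e (cos \<xi>, sin \<xi>) * basis_poly \<mu> k l e w)"
    unfolding basis_proj_def sum_distrib_left by (intro sum.cong) (auto simp: coef mult.assoc)
  finally have "c * r F w = c * jacobi_unit_norm \<mu> \<mu> k * (\<Sum>(l, e)\<in>basis_index k. basis_poly \<mu> k l e (cos \<xi>, sin \<xi>) * basis_poly \<mu> k l e w)"
    by simp
  moreover have "c * jacobi_unit_norm \<mu> \<mu> k = (\<mu> + 1/2) / (real k + \<mu> + 1/2)"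
    unfolding c_def by (rule jacobi_unit_norm_gegenbauer[OF mu])
  moreover have "poly (gegenbauer (\<mu> + 1/2) k) (fst w * cos \<xi> + snd w * sin \<xi>) = c * r F w"
    by (simp add: gegenbauer_eq[OF mu] c_def F_def r_def)
  moreover have "\<mu> + 1/2 > 0" "real k + \<mu> + 1/2 > 0" using mu by auto
  ultimately show ?thesis by simp
qed

section \<open>Basis values on the circle and their discrete orthogonality\<close>

lemma basis_poly_circle:
  assumes "\<mu> \<ge> 0"
  shows "basis_poly \<mu> k l e (cos \<xi>, sin \<xi>) = h_coeff \<mu> l k / sqrt (jacobi_unit_norm (\<mu> - 1/2) (real (k - 2 * l)) l) * sph (k - 2 * l) e \<xi>"
proof -
  have ab: "\<mu> - 1/2 > -1" "real (k - 2 * l) > -1" using assms by auto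
  have "complex_of_pair (cos \<xi>, sin \<xi>) = cis \<xi>" by (simp add: complex_eq_iff)
  then have "solid_solid_harm j e (cos \<xi>, sin \<xi>) = sph j e \<xi>" for j
    by (simp add: solid_solid_harm_def sph_def Complex.DeMoivre)
  \<comment> \<open>The Jacobi argument is then 2 - 1 = 1, where \<open>jacobi_unit\<close> has the
    value 1.\<close>
  moreover have "sqnorm (cos \<xi>, sin \<xi>) = 1" by (simp add: sqnorm_def)
  ultimately show ?thesis
    by (simp add: basis_poly_eq jacobi_eq[OF ab] poly_jacobi_unit_1)
qed

text \<open>The factor in parentheses is the mean square of the basis polynomial on the circle: its
  squared amplitude times \<open>d_coeff\<close>, the mean of cos^2 or sin^2, which is 1 for the
  constant frequency 0.\<close>

lemma lambda_coeff_eq: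
  assumes mu: "\<mu> \<ge> 0" and k: "2 * l \<le> k"
  shows "lambda_coeff \<mu> l k * ((h_coeff \<mu> l k)\<^sup>2 / jacobi_unit_norm (\<mu> - 1/2) (real (k - 2 * l)) l * d_coeff l k) = 1"
proof -
  define j where "j = k - 2 * l"
  have kj: "k = j + 2 * l" "k - l = j + l" using k by (auto simp: j_def)
  \<comment> \<open>The numerator factor k - l + \<mu> + 1/2 of \<open>lambda_coeff\<close>; x + l
    is k + \<mu> + 1/2 in its denominator.\<close>
  define x where "x = real j + real l + \<mu> + 1/2"
  have x: "x > 0" using mu by (simp add: x_def)
  have P: "pochhammer (\<mu> + 1/2) l > 0" "pochhammer (\<mu> + 3/2) j > 0" "pochhammer (\<mu> + 3/2 + j) l > 0"
     "pochhammer x l > 0" "pochhammer (x + 1) l > 0" "pochhammer (1 + real j) l > 0"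
    using mu x by (auto intro!: pochhammer_pos)
  have 1: "fact (j + l) = (fact j * pochhammer (1 + real j) l :: real)"
    by (simp add: pochhammer_fact pochhammer_product'[of 1 j l])
  have 2: "pochhammer (\<mu> + 3/2) (j + l) = pochhammer (\<mu> + 3/2) j * pochhammer (\<mu> + 3/2 + j) l"
    by (rule pochhammer_product')
  have "jacobi_unit_norm (\<mu> - 1/2) (real j) l = pochhammer x l * pochhammer (1 + real j) l * fact l /
     (pochhammer (\<mu> + 1/2) l * pochhammer (\<mu> + 3/2 + j) l * pochhammer (x + 1) l)"
  proof -
    have "real l + (\<mu> - 1/2) + real j + 1 = x" "\<mu> - 1/2 + 1 = \<mu> + 1/2" "\<mu> - 1/2 + real j + 2 = \<mu> + 3/2 + j"
      "\<mu> - 1/2 + real j + real l + 2 = x + 1" "real j + 1 = 1 + real j"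
      by (simp_all add: x_def)
    then show ?thesis unfolding jacobi_unit_norm_def by (simp only:)
  qed
  also have "\<dots> = (pochhammer x l / pochhammer (x + 1) l) * (pochhammer (1 + real j) l * fact l /
     (pochhammer (\<mu> + 1/2) l * pochhammer (\<mu> + 3/2 + j) l))" by (simp add: mult_ac)
  also have "\<dots> = x / (x + l) * (pochhammer (1 + real j) l * fact l /
     (pochhammer (\<mu> + 1/2) l * pochhammer (\<mu> + 3/2 + j) l))"
    by (simp only: pochhammer_shift[OF x])
  finally have N: "jacobi_unit_norm (\<mu> - 1/2) (real j) l = x / (x + l) * (pochhammer (1 + real j) l * fact l /
     (pochhammer (\<mu> + 1/2) l * pochhammer (\<mu> + 3/2 + j) l))" .
  have L: "lambda_coeff \<mu> l k = fact l * (fact j * pochhammer (1 + real j) l) * x /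
      (pochhammer (\<mu> + 1/2) l * (pochhammer (\<mu> + 3/2) j * pochhammer (\<mu> + 3/2 + j) l) * (x + l))"
    unfolding lambda_coeff_def kj(2) 1 2 by (simp add: x_def kj(1) add_ac)
  have "d_coeff l k \<noteq> 0" by (simp add: d_coeff_def)
  then have "(h_coeff \<mu> l k)\<^sup>2 * d_coeff l k = pochhammer (\<mu> + 3/2) j / fact j"
    unfolding h_coeff_square(1)[OF mu] j_def[symmetric] by simp
  then have "lambda_coeff \<mu> l k * ((h_coeff \<mu> l k)\<^sup>2 / jacobi_unit_norm (\<mu> - 1/2) (real j) l * d_coeff l k) =
     lambda_coeff \<mu> l k * (pochhammer (\<mu> + 3/2) j / fact j) / jacobi_unit_norm (\<mu> - 1/2) (real j) l"
    by simp
  also have "\<dots> = 1"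
  proof -
    have cancel: "a * (b * c) * x / (u * (v * w) * y) * (v / b) / (x / y * (c * a / (u * w))) = 1"
      if "a \<noteq> 0" "b \<noteq> 0" "c \<noteq> 0" "x \<noteq> 0" "y \<noteq> 0" "u \<noteq> 0" "v \<noteq> 0" "w \<noteq> 0" for a b c x y u v w :: real
      using that by (simp add: divide_simps)
    show ?thesis unfolding L N using P x by (intro cancel) auto
  qed
  finally show ?thesis unfolding j_def .
qed

text \<open>A geometric sum in w = exp(2 pi i m / (n + 1)): w^(n+1) = 1, and |m| <= n excludes w = 1
  unless m = 0. The number \<open>c\<close> counts half turns.\<close>

lemma sum_cos_sin_view_angle:
  fixes m :: int
  assumes m: "\<bar>m\<bar> \<le> int n" and c: "c > 0"
  shows "(\<Sum>\<nu><c * (n + 1). cos (2 * real_of_int m * view_angle n \<nu>)) = (if m = 0 then real (c * (n + 1)) else 0)"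
    and "(\<Sum>\<nu><c * (n + 1). sin (2 * real_of_int m * view_angle n \<nu>)) = 0"
proof -
  define w where "w = cis (2 * pi * (of_int m / (real n + 1)))"
  have w: "cis (2 * real_of_int m * view_angle n \<nu>) = w ^ \<nu>" for \<nu>
    by (simp add: w_def Complex.DeMoivre view_angle_def mult_ac)
  have "(\<Sum>\<nu><c * (n + 1). w ^ \<nu>) = (if m = 0 then of_nat (c * (n + 1)) else 0)"
  proof (cases "m = 0")
    case True
    then show ?thesis by (simp add: w_def)
  next
    case False
    have "w \<noteq> 1"
    proof
      assume "w = 1"
      then have "cos (2 * pi * (of_int m / (real n + 1))) = 1"
        by (simp add: w_def complex_eq_iff)
      then obtain i :: int where "2 * pi * (of_int m / (real n + 1)) = of_int i * 2 * pi"
        by (auto simp: cos_one_2pi_int)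
      then have "2 * pi * (of_int m / (real n + 1)) = 2 * pi * of_int i" by (simp only: mult_ac)
      then have "of_int m / (real n + 1) = of_int i" by (subst (asm) mult_left_cancel) auto
      then have "of_int m = of_int i * (real n + 1)" by (simp add: field_simps)
      then have "real_of_int m = real_of_int (i * (int n + 1))" by simp
      then have mi: "m = i * (int n + 1)" by (simp only: of_int_eq_iff)
      then have "i \<noteq> 0" using False by auto
      then have "\<bar>m\<bar> \<ge> int n + 1" by (simp add: mi abs_mult)
      then show False using m by simp
    qed
    moreover have "w ^ (c * (n + 1)) = 1"
    proof -
      have "real c * (real n + 1) * (2 * pi * (of_int m / (real n + 1))) = 2 * pi * of_int (int c * m)"
        by (simp add: add_eq_0_iff)
      moreover have "real (c * (n + 1)) = real c * (real n + 1)" by (simp add: distrib_left)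
      ultimately have "w ^ (c * (n + 1)) = cis (2 * pi * of_int (int c * m))"
        by (simp only: w_def Complex.DeMoivre)
      then show ?thesis by (simp only: cis_multiple_2pi Ints_of_int)
    qed
    ultimately show ?thesis using False by (simp add: geometric_sum)
  qed
  then have *: "(\<Sum>\<nu><c * (n + 1). cis (2 * real_of_int m * view_angle n \<nu>)) = (if m = 0 then of_nat (c * (n + 1)) else 0)"
    by (simp only: w)
  from arg_cong[OF this, of Re] show "(\<Sum>\<nu><c * (n + 1). cos (2 * real_of_int m * view_angle n \<nu>)) = (if m = 0 then real (c * (n + 1)) else 0)"
    by (simp del: of_nat_mult of_nat_add)
  from arg_cong[OF *, of Im] show "(\<Sum>\<nu><c * (n + 1). sin (2 * real_of_int m * view_angle n \<nu>)) = 0"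
    by (simp del: of_nat_mult of_nat_add split: if_splits)
qed

text \<open>Equal parity makes j + j' and j - j' even, so half of each is an admissible m in the
  sums above. Over a single half turn an odd frequency would not cancel, since its phase changes by
  -1 after n + 1 views.\<close>

lemma sph_discrete_orthogonality:
  assumes c: "c > 0" and jn: "j \<le> n" "j' \<le> n" and par: "even (j + j')"
    and e: "e \<in> {0, 1}" "e' \<in> {0, 1}" "e \<le> j" "e' \<le> j'"
  shows "(\<Sum>\<nu><c * (n + 1). sph j e (view_angle n \<nu>) * sph j' e' (view_angle n \<nu>)) =
    (if j = j' \<and> e = e' then real (c * (n + 1)) * (if j = 0 then 1 else 1/2) else 0)"
proof -
  obtain q where "j + j' = 2 * q" using par by blast
  \<comment> \<open>p is half the difference of the frequencies and q half their sum; p may be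
    negative, hence integers.\<close>
  define p where "p = int j - int q"
  have p: "int j - int j' = 2 * p" and q: "int j + int j' = 2 * int q"
    using \<open>j + j' = 2 * q\<close> by (auto simp: p_def)
  have bounds: "\<bar>p\<bar> \<le> int n" "\<bar>int q\<bar> \<le> int n" using p q jn by auto
  define N where "N = real (c * (n + 1))"
  let ?x = "view_angle n"
  have rp: "real j - real j' = 2 * real_of_int p" "real j + real j' = 2 * real_of_int (int q)"
    using p q by linarith+
  have arg: "real j * x - real j' * x = 2 * real_of_int p * x" "real j * x + real j' * x = 2 * real_of_int (int q) * x" for x
    by (simp_all only: rp[symmetric] left_diff_distrib distrib_right)
  note S = sum_cos_sin_view_angle[OF bounds(1) c] sum_cos_sin_view_angle[OF bounds(2) c]
  have prods: "cos (real j * x) * cos (real j' * x) = (cos (2 * real_of_int p * x) + cos (2 * real_of_int (int q) * x)) / 2"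
     "sin (real j * x) * sin (real j' * x) = (cos (2 * real_of_int p * x) - cos (2 * real_of_int (int q) * x)) / 2"
     "cos (real j * x) * sin (real j' * x) = (sin (2 * real_of_int (int q) * x) - sin (2 * real_of_int p * x)) / 2"
     "sin (real j * x) * cos (real j' * x) = (sin (2 * real_of_int (int q) * x) + sin (2 * real_of_int p * x)) / 2" for x
    unfolding arg[symmetric] by (simp_all add: cos_add cos_diff sin_add sin_diff)
  have pz: "p = 0 \<longleftrightarrow> j = j'" and qz: "int q = 0 \<longleftrightarrow> j = 0 \<and> j' = 0" using p q by auto
  consider "e = 0" "e' = 0" | "e = 1" "e' = 1" | "e = 0" "e' = 1" | "e = 1" "e' = 0" using e by auto
  then show ?thesis
  proof cases
    case 1
    have "(\<Sum>\<nu><c * (n + 1). sph j e (?x \<nu>) * sph j' e' (?x \<nu>)) = ((if p = 0 then N else 0) + (if int q = 0 then N else 0)) / 2"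
      using 1 by (simp only: sph_def simp_thms if_True prods sum_divide_distrib[symmetric] sum.distrib S N_def)
    then show ?thesis using 1 unfolding pz qz N_def[symmetric] by auto
  next
    case 2
    have "(\<Sum>\<nu><c * (n + 1). sph j e (?x \<nu>) * sph j' e' (?x \<nu>)) = ((if p = 0 then N else 0) - (if int q = 0 then N else 0)) / 2"
      using 2 by (simp only: sph_def simp_thms one_neq_zero if_False prods sum_divide_distrib[symmetric] sum_subtractf S N_def)
    then show ?thesis using 2 e unfolding pz qz N_def[symmetric] by auto
  next
    case 3
    then show ?thesis
      by (simp only: sph_def simp_thms zero_neq_one one_neq_zero if_True if_False prods sum_divide_distrib[symmetric] sum_subtractf S) simp
  next
    case 4
    then show ?thesis
      by (simp only: sph_def simp_thms zero_neq_one one_neq_zero if_True if_False prods sum_divide_distrib[symmetric] sum.distrib S) simp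
  qed
qed

text \<open>Both indices belong to the same degree k, so k - 2l and k - 2l' have equal parity. The
  coefficient \<open>lambda_coeff\<close> makes the diagonal value the plain number of
  views.\<close>

lemma basis_discrete_orthogonality:
  assumes mu: "\<mu> \<ge> 0" and c: "c > 0" and kn: "k \<le> n" and i: "(l, e) \<in> basis_index k" "(l', e') \<in> basis_index k"
  shows "(\<Sum>\<nu><c * (n + 1). basis_poly \<mu> k l e (cos (view_angle n \<nu>), sin (view_angle n \<nu>)) *
      (lambda_coeff \<mu> l' k * basis_poly \<mu> k l' e' (cos (view_angle n \<nu>), sin (view_angle n \<nu>)))) =
    (if (l, e) = (l', e') then real (c * (n + 1)) else 0)"
proof -
  define a where "a l = h_coeff \<mu> l k / sqrt (jacobi_unit_norm (\<mu> - 1/2) (real (k - 2 * l)) l)" for l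
  let ?j = "k - 2 * l" and ?j' = "k - 2 * l'"
  have e: "e \<in> {0, 1}" "e' \<in> {0, 1}" "e \<le> ?j" "e' \<le> ?j'" "2 * l \<le> k" "2 * l' \<le> k"
    using i by (auto simp: basis_index_def)
  have par: "even (?j + ?j')" using e(5,6) by presburger
  have jj: "?j = ?j' \<longleftrightarrow> l = l'" using e(5,6) by auto
  have "(\<Sum>\<nu><c * (n + 1). basis_poly \<mu> k l e (cos (view_angle n \<nu>), sin (view_angle n \<nu>)) *
      (lambda_coeff \<mu> l' k * basis_poly \<mu> k l' e' (cos (view_angle n \<nu>), sin (view_angle n \<nu>)))) =
     lambda_coeff \<mu> l' k * a l * a l' * (\<Sum>\<nu><c * (n + 1). sph ?j e (view_angle n \<nu>) * sph ?j' e' (view_angle n \<nu>))"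
    unfolding basis_poly_circle[OF mu] a_def[symmetric] sum_distrib_left by (intro sum.cong) (auto simp: mult_ac)
  also have "\<dots> = lambda_coeff \<mu> l' k * a l * a l' * (if l = l' \<and> e = e' then real (c * (n + 1)) * (if ?j = 0 then 1 else 1/2) else 0)"
    using sph_discrete_orthogonality[OF c _ _ par e(1-4), of n] kn by (simp only: jj)
  also have "\<dots> = (if (l, e) = (l', e') then real (c * (n + 1)) else 0)"
  proof (cases "(l, e) = (l', e')")
    case True
    then have l: "l = l'" "e = e'" by auto
    have d: "(if ?j = 0 then 1 else 1/2) = d_coeff l k" using e(5) by (auto simp: d_coeff_def)
    have "jacobi_unit_norm (\<mu> - 1/2) (real ?j) l > 0" using mu by (intro jacobi_unit_norm_pos) auto
    then have aa: "a l * a l = (h_coeff \<mu> l k)\<^sup>2 / jacobi_unit_norm (\<mu> - 1/2) (real ?j) l"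
      by (simp add: a_def power2_eq_square)
    have "lambda_coeff \<mu> l k * a l * a l * d_coeff l k = lambda_coeff \<mu> l k * (a l * a l * d_coeff l k)"
      by (simp only: mult.assoc)
    then have "lambda_coeff \<mu> l k * a l * a l * d_coeff l k = 1"
      by (simp only: aa lambda_coeff_eq[OF mu e(5)])
    moreover have "lambda_coeff \<mu> l k * a l * a l * (real (c * (n + 1)) * d_coeff l k) =
       lambda_coeff \<mu> l k * a l * a l * d_coeff l k * real (c * (n + 1))" by (simp only: mult_ac)
    ultimately show ?thesis unfolding d l(1)[symmetric] l(2)[symmetric] by simp
  qed auto
  finally show ?thesis .
qed

text \<open>In each view the integral becomes a finite sum of Fourier coefficients of f times basis
  values on the circle times \<open>D_kernel\<close>. Summation over the views then acts on circle
  values alone and is independent of f.\<close>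

lemma partial_sum_eq_views:
  assumes mu: "\<mu> \<ge> 0" and f: "f \<in> L2_disk \<mu>" and c: "c > 0"
  shows "real (c * (n + 1)) * partial_sum \<mu> n f z =
    (\<Sum>\<nu><c * (n + 1). norm_const \<mu> * (LINT t:{-1..1}|lebesgue. radon \<mu> (view_angle n \<nu>) f t * Phi_kernel \<mu> n (view_angle n \<nu>) t z))"
proof -
  define P where "P k i = basis_poly \<mu> k (fst i) (snd i)" for k i
  define L where "L k i = lambda_coeff \<mu> (fst i) k" for k and i :: "nat \<times> nat"
  define u where "u \<nu> = (cos (view_angle n \<nu>), sin (view_angle n \<nu>))" for \<nu>
  have fi: "disk_integrable \<mu> f" unfolding disk_integrable_def by (rule L2_disk_integrable[OF mu f])
  have Pp: "P k i \<in> poly2 k" if "i \<in> basis_index k" for k i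
    unfolding P_def using that by (intro poly2_basis_poly[OF mu]) simp
  have D: "D_kernel \<mu> k (view_angle n \<nu>) z = (\<Sum>i'\<in>basis_index k. L k i' * P k i' (u \<nu>) * P k i' z)" for k \<nu>
    by (simp add: D_kernel_def P_def L_def u_def split_beta)
  have view: "norm_const \<mu> * (LINT t:{-1..1}|lebesgue. radon \<mu> (view_angle n \<nu>) f t * Phi_kernel \<mu> n (view_angle n \<nu>) t z) =
     (\<Sum>k\<le>n. \<Sum>i\<in>basis_index k. D_kernel \<mu> k (view_angle n \<nu>) z * (P k i (u \<nu>) * disk_inner \<mu> f (P k i)))" for \<nu>
  proof -
    let ?x = "view_angle n \<nu>"
    \<comment> \<open>For fixed view and \<open>z\<close> the kernel is a polynomial in t, so the
      Fubini identity for ridge polynomials applies to it as a whole.\<close>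
    define G where "G = (\<Sum>k\<le>n. smult ((real k + \<mu> + 1/2) / (\<mu> + 1/2) * D_kernel \<mu> k ?x z) (gegenbauer (\<mu> + 1/2) k))"
    have "poly G t = Phi_kernel \<mu> n ?x t z" for t
      by (simp add: G_def Phi_kernel_def poly_sum atLeast0AtMost mult_ac)
    then have "norm_const \<mu> * (LINT t:{-1..1}|lebesgue. radon \<mu> ?x f t * Phi_kernel \<mu> n ?x t z) =
        disk_mean \<mu> (\<lambda>w. f w * poly G (fst w * cos ?x + snd w * sin ?x))"
      unfolding disk_mean_def using radon_Fubini(2)[OF mu fi[unfolded disk_integrable_def], of G ?x] by simp
    also have "(\<lambda>w. f w * poly G (fst w * cos ?x + snd w * sin ?x)) =
        (\<lambda>w. \<Sum>k\<le>n. \<Sum>i\<in>basis_index k. D_kernel \<mu> k ?x z * P k i (u \<nu>) * (f w * P k i w))"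
    proof
      fix w
      have "poly G (fst w * cos ?x + snd w * sin ?x) = (\<Sum>k\<le>n. D_kernel \<mu> k ?x z *
          ((real k + \<mu> + 1/2) / (\<mu> + 1/2) * poly (gegenbauer (\<mu> + 1/2) k) (fst w * cos ?x + snd w * sin ?x)))"
        by (simp add: G_def poly_sum mult_ac)
      also have "\<dots> = (\<Sum>k\<le>n. D_kernel \<mu> k ?x z * (\<Sum>i\<in>basis_index k. P k i (u \<nu>) * P k i w))"
        unfolding gegenbauer_ridge[OF mu] by (simp add: P_def u_def split_beta)
      finally show "f w * poly G (fst w * cos ?x + snd w * sin ?x) =
          (\<Sum>k\<le>n. \<Sum>i\<in>basis_index k. D_kernel \<mu> k ?x z * P k i (u \<nu>) * (f w * P k i w))"
        by (simp add: sum_distrib_left mult_ac)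
    qed
    also have "disk_mean \<mu> \<dots> = (\<Sum>k\<le>n. \<Sum>i\<in>basis_index k. D_kernel \<mu> k ?x z * P k i (u \<nu>) * disk_mean \<mu> (\<lambda>w. f w * P k i w))"
    proof -
      have "disk_integrable \<mu> (\<lambda>w. D_kernel \<mu> k ?x z * P k i (u \<nu>) * (f w * P k i w))" if "i \<in> basis_index k" for k i
        by (intro disk_integrable_scale disk_integrable_mult_poly2[OF mu fi Pp[OF that]])
      then show ?thesis by (simp add: disk_mean_sum disk_integrable_sum disk_mean_scale del: mult.assoc)
    qed
    finally show ?thesis by (simp add: disk_inner_eq_disk_mean mult.assoc)
  qed
  have disc: "(\<Sum>\<nu><c * (n + 1). P k i (u \<nu>) * (L k i' * P k i' (u \<nu>))) = (if i = i' then real (c * (n + 1)) else 0)"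
    if "k \<le> n" "i \<in> basis_index k" "i' \<in> basis_index k" for k i i'
    using basis_discrete_orthogonality[OF mu c that(1), of "fst i" "snd i" "fst i'" "snd i'"] that(2,3)
    by (simp add: P_def L_def u_def)
  \<comment> \<open>The sum over views evaluates the basis polynomial at \<open>z\<close> from its
    values on the circle.\<close>
  have inner: "(\<Sum>\<nu><c * (n + 1). D_kernel \<mu> k (view_angle n \<nu>) z * P k i (u \<nu>)) = real (c * (n + 1)) * P k i z"
    if "k \<le> n" "i \<in> basis_index k" for k i
  proof -
    have "(\<Sum>\<nu><c * (n + 1). D_kernel \<mu> k (view_angle n \<nu>) z * P k i (u \<nu>)) =
      (\<Sum>\<nu><c * (n + 1). \<Sum>i'\<in>basis_index k. (P k i (u \<nu>) * (L k i' * P k i' (u \<nu>))) * P k i' z)"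
      by (simp only: D sum_distrib_right) (simp only: mult_ac)
    also have "\<dots> = (\<Sum>i'\<in>basis_index k. (\<Sum>\<nu><c * (n + 1). P k i (u \<nu>) * (L k i' * P k i' (u \<nu>))) * P k i' z)"
      by (subst sum.swap) (simp only: sum_distrib_right)
    also have "\<dots> = (\<Sum>i'\<in>basis_index k. if i' = i then real (c * (n + 1)) * P k i z else 0)"
      using disc[OF that] by (intro sum.cong refl) auto
    also have "\<dots> = real (c * (n + 1)) * P k i z"
      using that(2) by (simp only: sum.delta[OF finite_basis_index] if_True)
    finally show ?thesis .
  qed
  have "(\<Sum>\<nu><c * (n + 1). norm_const \<mu> * (LINT t:{-1..1}|lebesgue. radon \<mu> (view_angle n \<nu>) f t * Phi_kernel \<mu> n (view_angle n \<nu>) t z)) =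
      (\<Sum>\<nu><c * (n + 1). \<Sum>k\<le>n. \<Sum>i\<in>basis_index k. D_kernel \<mu> k (view_angle n \<nu>) z * P k i (u \<nu>) * disk_inner \<mu> f (P k i))"
    by (simp only: view mult.assoc)
  also have "\<dots> = (\<Sum>k\<le>n. \<Sum>\<nu><c * (n + 1). \<Sum>i\<in>basis_index k. D_kernel \<mu> k (view_angle n \<nu>) z * P k i (u \<nu>) * disk_inner \<mu> f (P k i))"
    by (rule sum.swap)
  also have "\<dots> = (\<Sum>k\<le>n. \<Sum>i\<in>basis_index k. (\<Sum>\<nu><c * (n + 1). D_kernel \<mu> k (view_angle n \<nu>) z * P k i (u \<nu>)) * disk_inner \<mu> f (P k i))"
    by (intro sum.cong refl, subst sum.swap) (simp only: sum_distrib_right)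
  also have "\<dots> = (\<Sum>k\<le>n. \<Sum>i\<in>basis_index k. real (c * (n + 1)) * (disk_inner \<mu> f (P k i) * P k i z))"
    by (intro sum.cong refl, subst inner) (auto simp: mult_ac)
  also have "\<dots> = real (c * (n + 1)) * (\<Sum>k\<le>n. basis_proj \<mu> k f z)"
    by (simp only: sum_distrib_left basis_proj_def split_beta P_def)
  also have "(\<Sum>k\<le>n. basis_proj \<mu> k f z) = partial_sum \<mu> n f z"
    by (simp add: partial_sum_def disk_proj_eq[OF mu fi] atLeast0AtMost)
  finally show ?thesis by simp
qed

theorem corollary2p10:
  fixes \<mu> :: real and n :: nat and f :: "real \<times> real \<Rightarrow> real" and x y :: real
  assumes "\<mu> \<ge> 0"
    and "f \<in> L2_disk \<mu>"
    and "(x, y) \<in> disk"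
  shows "partial_sum \<mu> n f (x, y) =
           1 / (real n + 1) *
             (\<Sum>\<nu>=0..n. norm_const \<mu> *
               (LINT t:{-1..1}|lebesgue.
                  radon \<mu> (view_angle n \<nu>) f t * Phi_kernel \<mu> n (view_angle n \<nu>) t (x, y)))
       \<and> partial_sum \<mu> n f (x, y) =
           1 / (2 * real n + 2) *
             (\<Sum>\<nu>=0..2 * n + 1. norm_const \<mu> *
               (LINT t:{-1..1}|lebesgue.
                  radon \<mu> (view_angle n \<nu>) f t * Phi_kernel \<mu> n (view_angle n \<nu>) t (x, y)))"
proof -
  \<comment> \<open>Half a turn is c = 1 and a full turn c = 2.\<close>
  have sets: "{0..n} = {..<1 * (n + 1)}" "{0..2 * n + 1} = {..<2 * (n + 1)}" by auto
  have "real (1 * (n + 1)) = real n + 1" "real (2 * (n + 1)) = 2 * real n + 2" by simp_all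
  then show ?thesis
    unfolding sets partial_sum_eq_views[OF assms(1,2), of 1, OF zero_less_one, symmetric]
      partial_sum_eq_views[OF assms(1,2), of 2, OF zero_less_numeral, symmetric]
    by (simp add: field_simps)
qed

end
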